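(* Let $G$ be a connected complex reductive algebraic group with maximal compact subgroup $K\subseteq G$, and let $\phi\colon G\to \mathrm{GL}(V)$ be a finite-dimensional rational representation on a complex vector space $V$ equipped with a $K$-invariant Hermitian inner product, with induced norm $\|\cdot\|$. For each positive integer $k$, let $\Pi_k$ denote the orthogonal projection of $V^{\otimes k}$ onto its $G$-invariant subspace $(V^{\otimes k})^G$. Then for all $v\in V$, $$\limsup_{k\to\infty}\,\|\Pi_k v^{\otimes k}\|^{1/k} \;=\; \inf_{g\in G}\,\|\phi(g)v\|.$$
   Context: $G$ is the complexification of the compact connected Lie group $K$. The group $G$ acts on $V^{\otimes k}$ by $g\mapsto \phi(g)^{\otimes k}$, and $V^{\otimes k}$ carries the canonical inner product induced from $V$, determined by $\langle v_1\otimes\cdots\otimes v_k, w_1\otimes\cdots\otimes w_k\rangle=\prod_i\langle v_i,w_i\rangle$, and the corresponding norm. *)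

theory Defs
  imports "HOL-Analysis.Analysis" "HOL-Algebra.Coset"
begin

subsection \<open>Linear algebraic groups\<close>

definition general_linear :: "(complex^'n^'n) monoid" where
  "general_linear = \<lparr>carrier = {A. invertible A}, mult = (**), one = mat 1\<rparr>"

lemma group_general_linear: "group (general_linear :: (complex^'n^'n) monoid)"
proof (rule groupI)
  fix A :: "complex^'n^'n" assume "A \<in> carrier general_linear"
  then obtain B where "A ** B = mat 1" "B ** A = mat 1"
    by (auto simp: general_linear_def invertible_def)
  then show "\<exists>B\<in>carrier general_linear. B \<otimes>\<^bsub>general_linear\<^esub> A = \<one>\<^bsub>general_linear\<^esub>"
    by (auto simp: general_linear_def invertible_def)
qed (auto simp: general_linear_def invertible_mult matrix_mul_assoc
       invertible_def[of "mat 1"])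

abbreviation group_on :: "(complex^'n^'n) set \<Rightarrow> (complex^'n^'n) monoid" where
  "group_on H \<equiv> general_linear\<lparr>carrier := H\<rparr>"

text \<open>Polynomial functions of the matrix entries, with complex coefficients (so, unlike for
  \<^const>\<open>real_polynomial_function\<close>, complex conjugates of entries do not occur).\<close>

inductive entry_polynomial :: "((complex^'n^'n) \<Rightarrow> complex) \<Rightarrow> bool" where
  const: "entry_polynomial (\<lambda>A. c)"
| entry: "entry_polynomial (\<lambda>A. A $ i $ j)"
| add: "entry_polynomial p \<Longrightarrow> entry_polynomial q \<Longrightarrow> entry_polynomial (\<lambda>A. p A + q A)"
| mult: "entry_polynomial p \<Longrightarrow> entry_polynomial q \<Longrightarrow> entry_polynomial (\<lambda>A. p A * q A)"

definition zariski_closed_GL :: "(complex^'n^'n) set \<Rightarrow> bool" where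
  "zariski_closed_GL X \<longleftrightarrow>
     (\<exists>P. (\<forall>p\<in>P. entry_polynomial p) \<and> X = {A. invertible A \<and> (\<forall>p\<in>P. p A = 0)})"

definition linear_algebraic_group :: "(complex^'n^'n) set \<Rightarrow> bool" where
  "linear_algebraic_group G \<longleftrightarrow> subgroup G general_linear \<and> zariski_closed_GL G"

text \<open>The coordinate ring of the general linear group is generated by the matrix entries and the
  inverse of the determinant; regular functions on a closed subgroup are restrictions.\<close>

definition regular_on :: "(complex^'n^'n) set \<Rightarrow> ((complex^'n^'n) \<Rightarrow> complex) \<Rightarrow> bool" where
  "regular_on G f \<longleftrightarrow>
     (\<exists>p r. entry_polynomial p \<and> (\<forall>g\<in>G. f g = p g / det g ^ r))"

definition rational_representation ::
    "(complex^'n^'n) set \<Rightarrow> ((complex^'n^'n) \<Rightarrow> (complex^'m^'m)) \<Rightarrow> bool" where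
  "rational_representation G \<phi> \<longleftrightarrow>
     \<phi> \<in> hom (group_on G) general_linear \<and> (\<forall>i j. regular_on G (\<lambda>g. \<phi> g $ i $ j))"

text \<open>The product \<open>*\<close> on the type of matrices is componentwise, hence the explicit iteration of
  \<open>**\<close>.\<close>

definition matrix_power :: "complex^'n^'n \<Rightarrow> nat \<Rightarrow> complex^'n^'n" where
  "matrix_power A k = (((**) A) ^^ k) (mat 1)"

definition unipotent :: "complex^'n^'n \<Rightarrow> bool" where
  "unipotent A \<longleftrightarrow> (\<exists>k. matrix_power (A - mat 1) k = 0)"

text \<open>Reductive means that the unipotent radical is trivial. Connectedness refers to the Euclidean
  topology; for complex algebraic groups this agrees with connectedness in the Zariski topology.\<close>

definition reductive :: "(complex^'n^'n) set \<Rightarrow> bool" where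
  "reductive G \<longleftrightarrow> linear_algebraic_group G \<and>
     (\<forall>U. linear_algebraic_group U \<and> connected U \<and> U \<lhd> group_on G \<and> (\<forall>u\<in>U. unipotent u)
        \<longrightarrow> U = {mat 1})"

definition maximal_compact_subgroup :: "(complex^'n^'n) set \<Rightarrow> (complex^'n^'n) set \<Rightarrow> bool" where
  "maximal_compact_subgroup K G \<longleftrightarrow>
     subgroup K (group_on G) \<and> compact K \<and>
     (\<forall>L. subgroup L (group_on G) \<and> compact L \<and> K \<subseteq> L \<longrightarrow> L = K)"

definition matrix_exp :: "complex^'n^'n \<Rightarrow> complex^'n^'n" where
  "matrix_exp A = (\<Sum>k. (1 / fact k) *\<^sub>R matrix_power A k)"

definition lie_algebra :: "(complex^'n^'n) set \<Rightarrow> (complex^'n^'n) set" where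
  "lie_algebra H = {X. \<forall>t::real. matrix_exp (t *\<^sub>R X) \<in> H}"

definition i_times :: "complex^'n^'n \<Rightarrow> complex^'n^'n" where
  "i_times X = (\<chi> a b. \<i> * X $ a $ b)"

text \<open>\<open>Lie(G) = Lie(K) \<oplus> i Lie(K)\<close>. Together with connectedness of \<open>G\<close> and compactness of
  \<open>K\<close> this says that \<open>G\<close> is the complexification of \<open>K\<close>; it holds for every maximal
  compact subgroup of a connected complex reductive group.\<close>

definition complexification :: "(complex^'n^'n) set \<Rightarrow> (complex^'n^'n) set \<Rightarrow> bool" where
  "complexification K G \<longleftrightarrow>
     lie_algebra G = {X + i_times Y | X Y. X \<in> lie_algebra K \<and> Y \<in> lie_algebra K} \<and>
     lie_algebra K \<inter> i_times ` lie_algebra K = {0}"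

subsection \<open>Hermitian inner products\<close>

text \<open>Antilinear in the first and linear in the second argument.\<close>

definition hermitian_inner_product :: "(complex^'m \<Rightarrow> complex^'m \<Rightarrow> complex) \<Rightarrow> bool" where
  "hermitian_inner_product ip \<longleftrightarrow>
     (\<forall>x y z. ip x (y + z) = ip x y + ip x z) \<and>
     (\<forall>c x y. ip x (c *s y) = c * ip x y) \<and>
     (\<forall>x y. ip y x = cnj (ip x y)) \<and>
     (\<forall>x. x \<noteq> 0 \<longrightarrow> 0 < Re (ip x x))"

definition invariant_under ::
    "(complex^'n^'n) set \<Rightarrow> ((complex^'n^'n) \<Rightarrow> (complex^'m^'m)) \<Rightarrow>
     (complex^'m \<Rightarrow> complex^'m \<Rightarrow> complex) \<Rightarrow> bool" where
  "invariant_under K \<phi> ip \<longleftrightarrow> (\<forall>k\<in>K. \<forall>x y. ip (\<phi> k *v x) (\<phi> k *v y) = ip x y)"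

definition ip_norm :: "('v \<Rightarrow> 'v \<Rightarrow> complex) \<Rightarrow> 'v \<Rightarrow> real" where
  "ip_norm ip x = sqrt (Re (ip x x))"

subsection \<open>Tensor powers\<close>

text \<open>An element of the \<open>k\<close>-th tensor power of \<open>complex^'m\<close> is given by its
  coordinates \<open>T [i\<^sub>1, \<dots>, i\<^sub>k]\<close> with respect to the basis
  \<open>e\<^bsub>i\<^sub>1\<^esub> \<otimes> \<dots> \<otimes> e\<^bsub>i\<^sub>k\<^esub>\<close>, extended by \<open>0\<close> to index lists of other lengths.\<close>

type_synonym 'm tensor = "'m list \<Rightarrow> complex"

definition tensors :: "nat \<Rightarrow> 'm tensor set" where
  "tensors k = {T. \<forall>I. length I \<noteq> k \<longrightarrow> T I = 0}"

definition pure_tensor :: "nat \<Rightarrow> (nat \<Rightarrow> complex^'m) \<Rightarrow> 'm tensor" where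
  "pure_tensor k w = (\<lambda>I. if length I = k then \<Prod>l<k. w l $ (I ! l) else 0)"

definition tensor_power :: "nat \<Rightarrow> complex^'m \<Rightarrow> 'm tensor" where
  "tensor_power k v = pure_tensor k (\<lambda>_. v)"

definition tensor_power_map :: "nat \<Rightarrow> complex^'m^'m \<Rightarrow> 'm tensor \<Rightarrow> 'm tensor" where
  "tensor_power_map k A T =
     (\<lambda>I. if length I = k
          then \<Sum>J | length J = k. (\<Prod>l<k. A $ (I ! l) $ (J ! l)) * T J else 0)"

definition tensor_ip ::
    "nat \<Rightarrow> (complex^'m \<Rightarrow> complex^'m \<Rightarrow> complex) \<Rightarrow> 'm tensor \<Rightarrow> 'm tensor \<Rightarrow> complex" where
  "tensor_ip k ip S T =
     (\<Sum>I | length I = k. \<Sum>J | length J = k.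
        cnj (S I) * T J * (\<Prod>l<k. ip (axis (I ! l) 1) (axis (J ! l) 1)))"

lemma sum_lists_prod:
  fixes f :: "nat \<Rightarrow> 'm::finite \<Rightarrow> complex"
  shows "(\<Sum>I | length I = k. \<Prod>l<k. f l (I ! l)) = (\<Prod>l<k. \<Sum>i\<in>UNIV. f l i)"
proof (induction k)
  case 0
  have "{I :: 'm list. length I = 0} = {[]}" by auto
  then show ?case by simp
next
  case (Suc k)
  let ?h = "\<lambda>(I :: 'm list, i). I @ [i]"
  have bij: "bij_betw ?h ({I. length I = k} \<times> UNIV) {I. length I = Suc k}"
    unfolding bij_betw_def
  proof
    show "inj_on ?h ({I. length I = k} \<times> UNIV)" by (auto simp: inj_on_def)
    show "?h ` ({I. length I = k} \<times> UNIV) = {I. length I = Suc k}"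
      by (force simp: length_Suc_conv_rev image_iff)
  qed
  have "(\<Sum>I | length I = Suc k. \<Prod>l<Suc k. f l (I ! l))
      = (\<Sum>x\<in>{I. length I = k} \<times> UNIV. \<Prod>l<Suc k. f l (?h x ! l))"
    using sum.reindex_bij_betw[OF bij, of "\<lambda>I. \<Prod>l<Suc k. f l (I ! l)"] by simp
  also have "\<dots> = (\<Sum>(I, i)\<in>{I. length I = k} \<times> UNIV. (\<Prod>l<k. f l (I ! l)) * f k i)"
    by (rule sum.cong) (auto simp: nth_append)
  also have "\<dots> = (\<Sum>I | length I = k. \<Prod>l<k. f l (I ! l)) * (\<Sum>i\<in>UNIV. f k i)"
    by (simp add: sum_product sum.cartesian_product)
  finally show ?case using Suc by simp
qed

lemma tensor_power_map_pure_tensor: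
  "tensor_power_map k A (pure_tensor k w) = pure_tensor k (\<lambda>l. A *v w l)"
proof
  fix I
  have "(\<Sum>J | length J = k. (\<Prod>l<k. A $ (I ! l) $ (J ! l)) * pure_tensor k w J)
      = (\<Sum>J | length J = k. \<Prod>l<k. A $ (I ! l) $ (J ! l) * w l $ (J ! l))"
    by (rule sum.cong) (auto simp: pure_tensor_def prod.distrib)
  also have "\<dots> = (\<Prod>l<k. (A *v w l) $ (I ! l))"
    by (subst sum_lists_prod) (simp add: matrix_vector_mult_def)
  finally show "tensor_power_map k A (pure_tensor k w) I = pure_tensor k (\<lambda>l. A *v w l) I"
    by (simp add: tensor_power_map_def pure_tensor_def)
qed

lemma hermitian_inner_product_expand:
  assumes "hermitian_inner_product ip"
  shows "ip x y = (\<Sum>i\<in>UNIV. \<Sum>j\<in>UNIV. cnj (x $ i) * y $ j * ip (axis i 1) (axis j 1))"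
proof -
  have add: "ip x (y + z) = ip x y + ip x z" and scale: "ip x (c *s y) = c * ip x y"
    and sym: "ip y x = cnj (ip x y)" for x y z c
    using assms unfolding hermitian_inner_product_def by blast+
  have zero: "ip x 0 = 0" for x using scale[of x 0 0] by simp
  have sum: "ip x (\<Sum>j\<in>S. f j) = (\<Sum>j\<in>S. ip x (f j))" if "finite S" for x f and S :: "'a set"
    using that by (induction S) (auto simp: zero add)
  have right: "ip x y = (\<Sum>j\<in>UNIV. y $ j * ip x (axis j 1))" for x y
    by (subst (1) basis_expansion[of y, symmetric]) (simp only: sum[OF finite_class.finite_UNIV] scale)
  have left: "ip x (axis j 1) = (\<Sum>i\<in>UNIV. cnj (x $ i) * ip (axis i 1) (axis j 1))" for j
  proof -
    have "ip x (axis j 1) = cnj (ip (axis j 1) x)" by (rule sym)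
    also have "\<dots> = (\<Sum>i\<in>UNIV. cnj (x $ i) * cnj (ip (axis j 1) (axis i 1)))"
      by (subst right) simp
    also have "\<dots> = (\<Sum>i\<in>UNIV. cnj (x $ i) * ip (axis i 1) (axis j 1))"
      by (intro sum.cong refl arg_cong2[of _ _ _ _ "(*)"] sym[THEN HOL.sym])
    finally show ?thesis .
  qed
  have "ip x y = (\<Sum>j\<in>UNIV. \<Sum>i\<in>UNIV. cnj (x $ i) * y $ j * ip (axis i 1) (axis j 1))"
    by (subst right, unfold left) (simp add: sum_distrib_left mult_ac)
  then show ?thesis by (subst sum.swap)
qed

lemma tensor_ip_pure_tensor:
  assumes "hermitian_inner_product ip"
  shows "tensor_ip k ip (pure_tensor k v) (pure_tensor k w) = (\<Prod>l<k. ip (v l) (w l))"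
proof -
  let ?e = "\<lambda>i j. ip (axis i 1) (axis j 1)"
  have "tensor_ip k ip (pure_tensor k v) (pure_tensor k w)
      = (\<Sum>I | length I = k. \<Sum>J | length J = k.
           \<Prod>l<k. cnj (v l $ (I ! l)) * w l $ (J ! l) * ?e (I ! l) (J ! l))"
    unfolding tensor_ip_def
    by (intro sum.cong refl) (auto simp: pure_tensor_def prod.distrib)
  also have "\<dots> = (\<Sum>I | length I = k. \<Prod>l<k. \<Sum>j\<in>UNIV.
                    cnj (v l $ (I ! l)) * w l $ j * ?e (I ! l) j)"
    by (intro sum.cong refl sum_lists_prod)
  also have "\<dots> = (\<Prod>l<k. \<Sum>i\<in>UNIV. \<Sum>j\<in>UNIV. cnj (v l $ i) * w l $ j * ?e i j)"
    by (rule sum_lists_prod)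
  finally show ?thesis by (simp add: hermitian_inner_product_expand[OF assms, symmetric])
qed

definition invariant_tensors ::
    "(complex^'n^'n) set \<Rightarrow> ((complex^'n^'n) \<Rightarrow> (complex^'m^'m)) \<Rightarrow> nat \<Rightarrow> 'm tensor set" where
  "invariant_tensors G \<phi> k = {T \<in> tensors k. \<forall>g\<in>G. tensor_power_map k (\<phi> g) T = T}"

definition orthogonal_projection ::
    "('m tensor \<Rightarrow> 'm tensor \<Rightarrow> complex) \<Rightarrow> 'm tensor set \<Rightarrow> 'm tensor \<Rightarrow> 'm tensor" where
  "orthogonal_projection h W T = (THE P. P \<in> W \<and> (\<forall>S\<in>W. h S (\<lambda>I. T I - P I) = 0))"

end

theory Submission
  imports Defs "HOL-Complex_Analysis.Conformal_Mappings"
begin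

text \<open>
For a \<open>G\<close>-invariant tensor \<open>P\<close> the pairing \<open>\<langle>P, (\<phi>(g) v)\<^sup>\<otimes>\<^sup>k\<rangle>\<close> does not depend on \<open>g\<close>, by analytic
continuation from \<open>K\<close>; with \<open>P = \<Pi>\<^sub>k v\<^sup>\<otimes>\<^sup>k\<close> and the Cauchy--Schwarz inequality this gives the upper
bound. For the lower bound let \<open>w\<close> be a vector of minimal norm \<open>m > 0\<close> in the closure of the orbit;
then \<open>\<Pi>\<^sub>k v\<^sup>\<otimes>\<^sup>k = \<Pi>\<^sub>k w\<^sup>\<otimes>\<^sup>k\<close> is the vector of least norm in the closed convex hull of the \<open>K\<close>-orbit
of \<open>w\<^sup>\<otimes>\<^sup>k\<close>. Since the norm is critical at \<open>w\<close>, the imaginary part of \<open>\<langle>w, \<kappa> w\<rangle>\<close> is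
\<open>o(\<parallel>\<kappa> w - w\<parallel>\<^sup>2)\<close> as \<open>\<kappa> w \<rightarrow> w\<close>. Consequently, for \<open>x, y\<close> in the \<open>K\<close>-orbit of \<open>w\<close>, the kernel
\<open>(1 - z \<langle>x, y\<rangle> / m\<^sup>2)\<^sup>-\<^sup>N\<close> has real part bounded below, and real part at least of order
\<open>(1 - z)\<^sup>-\<^sup>N\<close> when \<open>\<parallel>x - y\<parallel>\<^sup>2\<close> is at most of order \<open>1 - z\<close>. The orbit is covered by
\<open>O((1 - z)\<^sup>-\<^sup>n)\<close> sets of that size, where \<open>n\<close> is the complex dimension of \<open>V\<close>, so for \<open>N = n + 1\<close> the
averages of the kernel tend to infinity as \<open>z \<rightarrow> 1\<close>. Expanding the kernel as a power series in \<open>z\<close>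
shows that \<open>\<parallel>\<Pi>\<^sub>k v\<^sup>\<otimes>\<^sup>k\<parallel>\<^sup>2 / m\<^sup>2\<^sup>k\<close> cannot decay exponentially.
\<close>

section \<open>Banach algebras and the matrix exponential\<close>

text \<open>No single degree can be bounded from below: for a one-dimensional torus acting with
  weights 1 and -1, all invariants of odd degree vanish. Hence all degrees are summed with positive
  coefficients, and unboundedness of a generating function as z tends to 1 replaces an estimate in
  each degree. The bound must hold for every convex combination of orbit points, since the
  projection is reached only as a limit of such combinations; this is why cells are counted instead
  of integrating over the orbit. If \<tau> is 1 minus the real part of \<langle>x, y\<rangle> / m^2,
  the base of the kernel has real part (1 - z) + z \<tau>, and the phase estimate makes its
  imaginary part small against \<tau>; so a fixed power keeps a positive real part. The Lie algebra
  is defined only through one-parameter subgroups. Cartan's theorem on closed subgroups supplies the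
  rest: elements of K near the identity are exponentials of small elements, and a closed subgroup of
  G containing the exponentials of all complex multiples of elements of the Lie algebra of K is G
  itself.\<close>

typedef (overloaded) 'a endo = "UNIV :: ('a::real_normed_vector \<Rightarrow>\<^sub>L 'a) set"
  by simp

setup_lifting type_definition_endo

instantiation endo :: (real_normed_vector) real_normed_vector
begin

lift_definition zero_endo :: "'a endo" is 0 .
lift_definition plus_endo :: "'a endo \<Rightarrow> 'a endo \<Rightarrow> 'a endo" is "(+)" .
lift_definition minus_endo :: "'a endo \<Rightarrow> 'a endo \<Rightarrow> 'a endo" is "(-)" .
lift_definition uminus_endo :: "'a endo \<Rightarrow> 'a endo" is uminus .
lift_definition scaleR_endo :: "real \<Rightarrow> 'a endo \<Rightarrow> 'a endo" is "(*\<^sub>R)" .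
lift_definition norm_endo :: "'a endo \<Rightarrow> real" is norm .
definition dist_endo :: "'a endo \<Rightarrow> 'a endo \<Rightarrow> real"
  where "dist_endo a b = norm (a - b)"
definition sgn_endo :: "'a endo \<Rightarrow> 'a endo"
  where "sgn_endo a = scaleR (inverse (norm a)) a"
definition uniformity_endo :: "('a endo \<times> 'a endo) filter"
  where "uniformity_endo = (INF e\<in>{0<..}. principal {(x, y). dist x y < e})"
definition open_endo :: "'a endo set \<Rightarrow> bool"
  where "open_endo S \<longleftrightarrow> (\<forall>x\<in>S. \<forall>\<^sub>F (x', y) in uniformity. x' = x \<longrightarrow> y \<in> S)"

instance
proof
  fix a b c :: "'a endo" and r s :: real
  show "a + b + c = a + (b + c)" by transfer simp
  show "a + b = b + a" by transfer simp
  show "0 + a = a" by transfer simp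
  show "- a + a = 0" by transfer simp
  show "a - b = a + - b" by transfer simp
  show "r *\<^sub>R (a + b) = r *\<^sub>R a + r *\<^sub>R b" by transfer (simp add: scaleR_add_right)
  show "(r + s) *\<^sub>R a = r *\<^sub>R a + s *\<^sub>R a" by transfer (simp add: scaleR_add_left)
  show "r *\<^sub>R s *\<^sub>R a = (r * s) *\<^sub>R a" by transfer simp
  show "1 *\<^sub>R a = a" by transfer simp
  show "dist a b = norm (a - b)" by (fact dist_endo_def)
  show "sgn a = scaleR (inverse (norm a)) a" by (simp add: sgn_endo_def)
  show "uniformity = (INF e\<in>{0<..}. principal {(x, y :: 'a endo). dist x y < e})"
    by (fact uniformity_endo_def)
  show "open S = (\<forall>x\<in>S. \<forall>\<^sub>F (x', y) in uniformity. x' = x \<longrightarrow> y \<in> S)" for S :: "'a endo set"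
    by (fact open_endo_def)
  show "norm a = 0 \<longleftrightarrow> a = 0" by transfer simp
  show "norm (a + b) \<le> norm a + norm b" by transfer (rule norm_triangle_ineq)
  show "norm (r *\<^sub>R a) = \<bar>r\<bar> * norm a" by transfer simp
qed

end

text \<open>A copy of the operator space with composition as product, so that the generic
  \<open>exp\<close> applies; on matrices \<open>*\<close> is componentwise. The sort
  \<open>perfect_space\<close> rules out the zero space, where the identity would have norm
  0.\<close>

instantiation endo :: ("{real_normed_vector,perfect_space}") real_normed_algebra_1
begin

lift_definition one_endo :: "'a endo" is id_blinfun .
lift_definition times_endo :: "'a endo \<Rightarrow> 'a endo \<Rightarrow> 'a endo" is "(o\<^sub>L)" .

instance
proof
  fix a b c :: "'a endo" and r :: real
  show "a * b * c = a * (b * c)" by transfer (rule blinfun_eqI, simp)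
  show "(a + b) * c = a * c + b * c" by transfer (rule blinfun_eqI, simp add: blinfun.bilinear_simps)
  show "a * (b + c) = a * b + a * c" by transfer (rule blinfun_eqI, simp add: blinfun.bilinear_simps)
  show "r *\<^sub>R a * b = r *\<^sub>R (a * b)" by transfer (rule blinfun_eqI, simp add: blinfun.bilinear_simps)
  show "a * r *\<^sub>R b = r *\<^sub>R (a * b)" by transfer (rule blinfun_eqI, simp add: blinfun.bilinear_simps)
  show "1 * a = a" by transfer (rule blinfun_eqI, simp)
  show "a * 1 = a" by transfer (rule blinfun_eqI, simp)
  show one: "norm (1 :: 'a endo) = 1" by transfer simp
  then show "(0 :: 'a endo) \<noteq> 1" by (metis norm_zero zero_neq_one)
  show "norm (a * b) \<le> norm a * norm b" by transfer (rule norm_blinfun_compose)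
qed

end

lemma Rep_endo_isometry: "norm (Rep_endo a) = norm a"
  by (simp add: norm_endo.rep_eq)

instance endo :: ("{banach,perfect_space}") banach
proof
  fix X :: "nat \<Rightarrow> 'a endo"
  assume "Cauchy X"
  then have "Cauchy (\<lambda>n. Rep_endo (X n))"
    by (simp add: Cauchy_def dist_norm flip: minus_endo.rep_eq norm_endo.rep_eq)
  then obtain l where "(\<lambda>n. Rep_endo (X n)) \<longlonglongrightarrow> l"
    by (auto simp: Cauchy_convergent_iff convergent_def)
  then have "X \<longlonglongrightarrow> Abs_endo l"
    by (simp add: LIMSEQ_iff norm_endo.rep_eq minus_endo.rep_eq Abs_endo_inverse)
  then show "convergent X" by (auto simp: convergent_def)
qed

section \<open>Estimates for the exponential in a Banach algebra\<close>

lemma norm_exp_remainder: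
  fixes x :: "'a::{real_normed_algebra_1,banach}"
  shows "norm (exp x - 1 - x) \<le> norm x ^ 2 * exp (norm x)"
proof -
  let ?f = "\<lambda>n. x ^ n /\<^sub>R fact n"
  let ?g = "\<lambda>n. norm x ^ n /\<^sub>R fact n"
  have "exp x = (\<Sum>n. ?f (n + 2)) + (\<Sum>n<2. ?f n)"
    unfolding exp_def by (rule suminf_split_initial_segment) (rule summable_exp_generic)
  then have eq: "exp x - 1 - x = (\<Sum>n. ?f (n + 2))"
    by (simp add: numeral_2_eq_2)
  have bound: "norm (?f (n + 2)) \<le> norm x ^ 2 * ?g n" for n
  proof -
    have "norm (?f m) \<le> norm x ^ m / fact m" for m
      using norm_power_ineq[of x m] by (simp add: inverse_eq_divide divide_right_mono)
    then have "norm (?f (n + 2)) \<le> norm x ^ (n + 2) / fact (n + 2)" .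
    also have "\<dots> \<le> norm x ^ (n + 2) / fact n"
      by (intro divide_left_mono fact_mono) auto
    also have "\<dots> = norm x ^ 2 * ?g n" by (simp add: power_add field_simps power2_eq_square)
    finally show ?thesis .
  qed
  have summ: "summable (\<lambda>n. norm x ^ 2 * ?g n)"
    by (intro summable_mult summable_exp_generic)
  have "norm (\<Sum>n. ?f (n + 2)) \<le> (\<Sum>n. norm x ^ 2 * ?g n)"
    by (rule norm_suminf_le[OF bound summ])
  also have "\<dots> = norm x ^ 2 * exp (norm x)"
    unfolding exp_def by (rule suminf_mult) (rule summable_exp_generic)
  finally show ?thesis using eq by simp
qed

lemma continuous_on_exp_algebra:
  "continuous_on UNIV (exp :: 'a::{real_normed_algebra_1,banach} \<Rightarrow> 'a)"
proof -
  have "isCont exp (a :: 'a)" for a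
  proof -
    define R where "R = norm a + 1"
    have "uniform_limit (ball 0 R) (\<lambda>n x. \<Sum>i<n. x ^ i /\<^sub>R fact i) (\<lambda>x :: 'a. \<Sum>i. x ^ i /\<^sub>R fact i) sequentially"
    proof (rule Weierstrass_m_test)
      fix n and x :: 'a assume "x \<in> ball 0 R"
      then have "norm x ^ n \<le> R ^ n" by (intro power_mono) auto
      then show "norm (x ^ n /\<^sub>R fact n) \<le> R ^ n /\<^sub>R fact n"
        using order_trans[OF norm_power_ineq[of x n]] by (simp add: divide_right_mono)
    qed (rule summable_exp_generic)
    moreover have "continuous_on (ball 0 R) (\<lambda>x :: 'a. \<Sum>i<n. x ^ i /\<^sub>R fact i)" for n
      by (intro continuous_intros)
    ultimately have "continuous_on (ball 0 R) (exp :: 'a \<Rightarrow> 'a)"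
      unfolding exp_def by (intro uniform_limit_theorem) auto
    moreover have "a \<in> ball 0 R" by (simp add: R_def)
    ultimately show ?thesis by (simp add: continuous_on_eq_continuous_at)
  qed
  then show ?thesis by (simp add: continuous_on_eq_continuous_at)
qed

lemma norm_power_diff_le:
  fixes a b :: "'a::real_normed_algebra_1"
  assumes "norm a \<le> M" "norm b \<le> M" "1 \<le> M"
  shows "norm (a ^ k - b ^ k) \<le> real k * norm (a - b) * M ^ k"
proof (induction k)
  case (Suc k)
  have "a ^ Suc k - b ^ Suc k = a * (a ^ k - b ^ k) + (a - b) * b ^ k"
    by (simp add: algebra_simps)
  then have "norm (a ^ Suc k - b ^ Suc k) \<le> norm (a * (a ^ k - b ^ k)) + norm ((a - b) * b ^ k)"
    by (metis norm_triangle_ineq)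
  also have "\<dots> \<le> M * (real k * norm (a - b) * M ^ k) + norm (a - b) * M ^ k"
  proof (intro add_mono)
    show "norm (a * (a ^ k - b ^ k)) \<le> M * (real k * norm (a - b) * M ^ k)"
      using assms Suc by (intro order_trans[OF norm_mult_ineq] mult_mono) auto
    have "norm (b ^ k) \<le> M ^ k"
      using assms by (intro order_trans[OF norm_power_ineq] power_mono) auto
    then show "norm ((a - b) * b ^ k) \<le> norm (a - b) * M ^ k"
      by (intro order_trans[OF norm_mult_ineq] mult_mono) auto
  qed
  also have "norm (a - b) * M ^ k \<le> norm (a - b) * M ^ Suc k"
    using assms by (intro mult_left_mono power_increasing) auto
  finally show ?case by (simp add: algebra_simps)
qed simp

lemma exp_scaleR_of_nat: "exp (real k *\<^sub>R x) = exp x ^ k"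
  for x :: "'a::{real_normed_algebra_1,banach}"
proof (induction k)
  case (Suc k)
  have "exp (real (Suc k) *\<^sub>R x) = exp (x + real k *\<^sub>R x)" by (simp add: algebra_simps)
  also have "\<dots> = exp x * exp (real k *\<^sub>R x)" by (rule exp_add_commuting) simp
  finally show ?case using Suc by simp
qed simp

text \<open>A form of (1 + Y/n)^n -> exp Y for bases known only to first order. Each factor
  \<open>h n\<close> differs from \<open>exp (r n *\<^sub>R Y)\<close> by o(r n), there are
  \<open>k n\<close> factors, and \<open>k n * r n\<close> stays bounded. This turns tangent
  directions of a group into one-parameter subgroups.\<close>

lemma power_tendsto_exp:
  fixes h :: "nat \<Rightarrow> 'a::{real_normed_algebra_1,banach}"
  assumes h: "(\<lambda>n. (h n - 1) /\<^sub>R r n) \<longlonglongrightarrow> Y"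
    and r: "\<And>n. 0 < r n" "r \<longlonglongrightarrow> 0" and k: "(\<lambda>n. real (k n) * r n) \<longlonglongrightarrow> t"
  shows "(\<lambda>n. h n ^ k n) \<longlonglongrightarrow> exp (t *\<^sub>R Y)"
proof -
  obtain C where C: "C > 0" "\<And>n. norm ((h n - 1) /\<^sub>R r n) \<le> C"
    using convergent_imp_Bseq[OF convergentI[OF h]] by (auto simp: Bseq_def)
  \<comment> \<open>A common rate: both bases have norm at most \<open>exp (B * r n)\<close>, so
    their powers stay bounded.\<close>
  define B where "B = max C (norm Y)"
  have nh: "norm (h n) \<le> exp (B * r n)" for n
  proof -
    have "norm (h n - 1) = r n * norm ((h n - 1) /\<^sub>R r n)"
      using r(1)[of n] by simp
    also have "\<dots> \<le> r n * B"
      using C(2)[of n] r(1)[of n] by (intro mult_left_mono) (auto simp: B_def)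
    finally have "norm (h n) \<le> 1 + B * r n"
      using norm_triangle_ineq[of "h n - 1" 1] by (simp add: mult.commute)
    then show ?thesis using exp_ge_add_one_self[of "B * r n"] by linarith
  qed
  have ne: "norm (exp (r n *\<^sub>R Y)) \<le> exp (B * r n)" for n
  proof -
    have "norm (r n *\<^sub>R Y) \<le> B * r n"
      using r(1)[of n] by (simp add: B_def mult.commute)
    then show ?thesis using norm_exp[of "r n *\<^sub>R Y"] by (meson exp_le_cancel_iff order_trans)
  qed
  have B0: "B > 0" using C by (simp add: B_def)
  have le: "norm (h n ^ k n - exp (r n *\<^sub>R Y) ^ k n)
      \<le> (real (k n) * r n) * norm ((h n - exp (r n *\<^sub>R Y)) /\<^sub>R r n) * exp (B * (real (k n) * r n))" for n
  proof -
    have "1 \<le> exp (B * r n)" using B0 r(1)[of n] by simp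
    then have "norm (h n ^ k n - exp (r n *\<^sub>R Y) ^ k n)
       \<le> real (k n) * norm (h n - exp (r n *\<^sub>R Y)) * exp (B * r n) ^ k n" 
      using norm_power_diff_le[OF nh ne \<open>1 \<le> exp (B * r n)\<close>] by blast
    also have "exp (B * r n) ^ k n = exp (B * (real (k n) * r n))"
      by (simp add: exp_of_nat_mult[symmetric] mult_ac)
    also have "real (k n) * norm (h n - exp (r n *\<^sub>R Y))
        = (real (k n) * r n) * norm ((h n - exp (r n *\<^sub>R Y)) /\<^sub>R r n)"
      using r(1)[of n] by (simp add: mult.assoc)
    finally show ?thesis .
  qed
  have q: "(\<lambda>n. (h n - exp (r n *\<^sub>R Y)) /\<^sub>R r n) \<longlonglongrightarrow> 0"
  proof -
    have "(\<lambda>n. (exp (r n *\<^sub>R Y) - 1 - r n *\<^sub>R Y) /\<^sub>R r n) \<longlonglongrightarrow> 0"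
    proof (rule Lim_null_comparison)
      show "\<forall>\<^sub>F n in sequentially. norm ((exp (r n *\<^sub>R Y) - 1 - r n *\<^sub>R Y) /\<^sub>R r n)
              \<le> r n * norm Y ^ 2 * exp (r n * norm Y)"
      proof (intro always_eventually allI)
        fix n
        show "norm ((exp (r n *\<^sub>R Y) - 1 - r n *\<^sub>R Y) /\<^sub>R r n) \<le> r n * norm Y ^ 2 * exp (r n * norm Y)"
          using norm_exp_remainder[of "r n *\<^sub>R Y"] r(1)[of n]
          by (simp add: divide_simps power2_eq_square mult_ac)
      qed
      have "(\<lambda>n. r n * norm Y ^ 2 * exp (r n * norm Y)) \<longlonglongrightarrow> 0 * norm Y ^ 2 * exp (0 * norm Y)"
        by (intro tendsto_intros r)
      then show "(\<lambda>n. r n * norm Y ^ 2 * exp (r n * norm Y)) \<longlonglongrightarrow> 0" by simp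
    qed
    from tendsto_diff[OF tendsto_diff[OF h tendsto_const[of Y]] this]
    have "(\<lambda>n. (h n - 1) /\<^sub>R r n - Y - (exp (r n *\<^sub>R Y) - 1 - r n *\<^sub>R Y) /\<^sub>R r n) \<longlonglongrightarrow> 0" by simp
    moreover have "(h n - 1) /\<^sub>R r n - Y - (exp (r n *\<^sub>R Y) - 1 - r n *\<^sub>R Y) /\<^sub>R r n
        = (h n - exp (r n *\<^sub>R Y)) /\<^sub>R r n" for n
      using r(1)[of n] by (simp add: algebra_simps)
    ultimately show ?thesis by simp
  qed
  have "(\<lambda>n. h n ^ k n - exp (r n *\<^sub>R Y) ^ k n) \<longlonglongrightarrow> 0"
  proof (rule Lim_null_comparison[OF always_eventually[OF allI[OF le]]])
    have "(\<lambda>n. (real (k n) * r n) * norm ((h n - exp (r n *\<^sub>R Y)) /\<^sub>R r n) * exp (B * (real (k n) * r n)))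
        \<longlonglongrightarrow> t * norm (0 :: 'a) * exp (B * t)"
      by (intro tendsto_intros k q)
    then show "(\<lambda>n. (real (k n) * r n) * norm ((h n - exp (r n *\<^sub>R Y)) /\<^sub>R r n) * exp (B * (real (k n) * r n)))
        \<longlonglongrightarrow> 0" by simp
  qed
  moreover have "(\<lambda>n. exp (r n *\<^sub>R Y) ^ k n) \<longlonglongrightarrow> exp (t *\<^sub>R Y)"
  proof -
    have "(\<lambda>n. (real (k n) * r n) *\<^sub>R Y) \<longlonglongrightarrow> t *\<^sub>R Y"
      by (intro tendsto_intros k)
    then have "(\<lambda>n. exp ((real (k n) * r n) *\<^sub>R Y)) \<longlonglongrightarrow> exp (t *\<^sub>R Y)"
      using continuous_on_exp_algebra isCont_tendsto_compose
      by (metis UNIV_I continuous_on_eq_continuous_at open_UNIV)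
    then show ?thesis by (simp add: exp_scaleR_of_nat[symmetric])
  qed
  ultimately show ?thesis using tendsto_add by fastforce
qed

section \<open>Matrices as bounded operators\<close>

lemma bounded_bilinear_matrix_mult:
  "bounded_bilinear ((**) :: complex^'n^'m \<Rightarrow> complex^'k^'n \<Rightarrow> complex^'k^'m)"
  unfolding bilinear_conv_bounded_bilinear[symmetric] bilinear_def
proof (intro conjI allI linearI)
  fix A B :: "complex^'n^'m" and C D :: "complex^'k^'n" and r :: real
  show "A ** (C + D) = A ** C + A ** D" by (rule matrix_add_ldistrib)
  show "A ** (r *\<^sub>R C) = r *\<^sub>R (A ** C)" by (simp add: matrix_matrix_mult_def vec_eq_iff scaleR_right.sum)
  show "(A + B) ** C = A ** C + B ** C"
    by (simp add: matrix_matrix_mult_def vec_eq_iff sum.distrib distrib_right)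
  show "(r *\<^sub>R A) ** C = r *\<^sub>R (A ** C)" by (rule scalar_matrix_assoc[symmetric])
qed

lemma norm_vec_le_sum: "norm (x :: 'a::real_normed_vector^'n) \<le> (\<Sum>i\<in>UNIV. norm (x $ i))"
  unfolding norm_vec_def by (rule L2_set_le_sum) simp

definition endo_of_matrix :: "complex^'n^'n \<Rightarrow> (complex^'n) endo" where
  "endo_of_matrix A = Abs_endo (Blinfun ((*v) A))"

definition matrix_of_endo :: "(complex^'n) endo \<Rightarrow> complex^'n^'n" where
  "matrix_of_endo a = matrix (blinfun_apply (Rep_endo a))"

lemma apply_endo_of_matrix: "blinfun_apply (Rep_endo (endo_of_matrix A)) x = A *v x"
  by (simp add: endo_of_matrix_def Abs_endo_inverse bounded_linear_Blinfun_apply)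

lemma endo_eqI: "(\<And>x. blinfun_apply (Rep_endo a) x = blinfun_apply (Rep_endo b) x) \<Longrightarrow> a = b"
  by (metis Rep_endo_inject blinfun_eqI)

lemma matrix_of_endo_of_matrix [simp]: "matrix_of_endo (endo_of_matrix A) = A"
  by (simp add: matrix_of_endo_def apply_endo_of_matrix[abs_def] matrix_of_matrix_vector_mul)

lemma endo_of_matrix_mult: "endo_of_matrix (A ** B) = endo_of_matrix A * endo_of_matrix B"
  by (rule endo_eqI) (simp add: apply_endo_of_matrix times_endo.rep_eq matrix_vector_mul_assoc)

lemma endo_of_matrix_one: "endo_of_matrix (mat 1) = 1"
  by (rule endo_eqI) (simp add: apply_endo_of_matrix one_endo.rep_eq)

lemma endo_of_matrix_power: "endo_of_matrix (matrix_power A k) = endo_of_matrix A ^ k"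
  by (induction k) (simp_all add: matrix_power_def endo_of_matrix_one endo_of_matrix_mult)

lemma bounded_linear_endo_of_matrix: "bounded_linear endo_of_matrix"
  unfolding linear_conv_bounded_linear[symmetric]
  by (rule linearI; rule endo_eqI)
    (simp_all add: apply_endo_of_matrix plus_endo.rep_eq scaleR_endo.rep_eq blinfun.bilinear_simps
      matrix_vector_mult_def vec_eq_iff scaleR_right.sum sum.distrib distrib_right)

lemma bounded_linear_matrix_of_endo: "bounded_linear (matrix_of_endo :: (complex^'n) endo \<Rightarrow> _)"
proof (rule bounded_linear_intro)
  fix a b :: "(complex^'n) endo" and r :: real
  show "matrix_of_endo (a + b) = matrix_of_endo a + matrix_of_endo b"
    by (simp add: matrix_of_endo_def matrix_def vec_eq_iff plus_endo.rep_eq blinfun.bilinear_simps)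
  show "matrix_of_endo (r *\<^sub>R a) = r *\<^sub>R matrix_of_endo a"
    by (simp add: matrix_of_endo_def matrix_def vec_eq_iff scaleR_endo.rep_eq blinfun.bilinear_simps)
  have "norm (matrix_of_endo a $ i $ j) \<le> norm a" for i j
  proof -
    have "norm (matrix_of_endo a $ i $ j) = norm (blinfun_apply (Rep_endo a) (axis j 1) $ i)"
      by (simp add: matrix_of_endo_def matrix_def)
    also have "\<dots> \<le> norm (blinfun_apply (Rep_endo a) (axis j 1))" by (rule Finite_Cartesian_Product.norm_nth_le)
    also have "\<dots> \<le> norm a"
      using norm_blinfun[of "Rep_endo a" "axis j 1"] by (simp add: Rep_endo_isometry)
    finally show ?thesis .
  qed
  then have "(\<Sum>i\<in>UNIV. \<Sum>j\<in>UNIV. norm (matrix_of_endo a $ i $ j))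
      \<le> (\<Sum>i\<in>(UNIV :: 'n set). \<Sum>j\<in>(UNIV :: 'n set). norm a)"
    by (intro sum_mono)
  moreover have "norm (matrix_of_endo a) \<le> (\<Sum>i\<in>UNIV. \<Sum>j\<in>UNIV. norm (matrix_of_endo a $ i $ j))"
    by (rule order_trans[OF norm_vec_le_sum sum_mono[OF norm_vec_le_sum]])
  ultimately show "norm (matrix_of_endo a) \<le> norm a * (real CARD('n) * real CARD('n))"
    by (simp add: mult_ac)
qed

lemma sums_matrix_exp:
  "(\<lambda>k. (1 / fact k) *\<^sub>R matrix_power X k) sums matrix_exp X"
  and endo_of_matrix_exp: "endo_of_matrix (matrix_exp X) = exp (endo_of_matrix X)"
proof -
  have 1: "(\<lambda>k. endo_of_matrix ((1 / fact k) *\<^sub>R matrix_power X k)) sums exp (endo_of_matrix X)"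
    using exp_converges[of "endo_of_matrix X"]
    by (simp add: linear_simps[OF bounded_linear_endo_of_matrix] endo_of_matrix_power inverse_eq_divide)
  from bounded_linear.sums[OF bounded_linear_matrix_of_endo this]
  have "summable (\<lambda>k. (1 / fact k) *\<^sub>R matrix_power X k)" by (simp add: sums_iff)
  then show 2: "(\<lambda>k. (1 / fact k) *\<^sub>R matrix_power X k) sums matrix_exp X"
    unfolding matrix_exp_def by (rule summable_sums)
  show "endo_of_matrix (matrix_exp X) = exp (endo_of_matrix X)"
    using bounded_linear.sums[OF bounded_linear_endo_of_matrix 2] 1 by (rule sums_unique2)
qed

lemma matrix_exp_eq: "matrix_exp X = matrix_of_endo (exp (endo_of_matrix X))"
  by (metis endo_of_matrix_exp matrix_of_endo_of_matrix)

lemma endo_of_matrix_inject: "endo_of_matrix A = endo_of_matrix B \<Longrightarrow> A = B"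
  by (metis matrix_of_endo_of_matrix)

lemma matrix_exp_0 [simp]: "matrix_exp 0 = mat 1"
  by (rule endo_of_matrix_inject)
    (simp add: endo_of_matrix_exp endo_of_matrix_one linear_simps[OF bounded_linear_endo_of_matrix])

lemma matrix_exp_add_scaleR:
  "matrix_exp ((s + t) *\<^sub>R X) = matrix_exp (s *\<^sub>R X) ** matrix_exp (t *\<^sub>R X)"
  by (rule endo_of_matrix_inject)
    (simp add: endo_of_matrix_exp endo_of_matrix_mult scaleR_add_left exp_add_commuting
      linear_simps[OF bounded_linear_endo_of_matrix])

lemma matrix_exp_uminus: "matrix_exp X ** matrix_exp (- X) = mat 1" "matrix_exp (- X) ** matrix_exp X = mat 1"
  using matrix_exp_add_scaleR[of 1 "- 1" X] matrix_exp_add_scaleR[of "- 1" 1 X] by simp_all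

lemma invertible_matrix_exp: "invertible (matrix_exp X)"
  unfolding invertible_def using matrix_exp_uminus by blast

lemma continuous_on_matrix_exp: "continuous_on S matrix_exp"
  unfolding matrix_exp_eq[abs_def]
  by (intro bounded_linear.continuous_on[OF bounded_linear_matrix_of_endo]
      continuous_on_compose2[OF continuous_on_exp_algebra]
      bounded_linear.continuous_on[OF bounded_linear_endo_of_matrix] continuous_on_id) auto

lemma tendsto_matrix_exp: "(f \<longlongrightarrow> X) F \<Longrightarrow> ((\<lambda>x. matrix_exp (f x)) \<longlongrightarrow> matrix_exp X) F"
  using continuous_on_matrix_exp[of UNIV]
  by (auto simp: continuous_on_eq_continuous_at intro: isCont_tendsto_compose)

lemma has_derivative_matrix_exp_0:
  "((matrix_exp :: complex^'n^'n \<Rightarrow> _) has_derivative (\<lambda>X. X)) (at 0)"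
proof -
  obtain C1 where C1: "C1 > 0" "\<And>a :: (complex^'n) endo. norm (matrix_of_endo a) \<le> norm a * C1"
    using bounded_linear.pos_bounded[OF bounded_linear_matrix_of_endo] by blast
  obtain C2 where C2: "C2 > 0" "\<And>A :: complex^'n^'n. norm (endo_of_matrix A) \<le> norm A * C2"
    using bounded_linear.pos_bounded[OF bounded_linear_endo_of_matrix] by blast
  have bound: "norm (matrix_exp X - mat 1 - X) / norm X \<le> norm X * C2^2 * exp (norm X * C2) * C1"
    for X :: "complex^'n^'n"
  proof (cases "X = 0")
    case False
    let ?a = "endo_of_matrix X"
    have "matrix_exp X - mat 1 - X = matrix_of_endo (exp ?a - 1 - ?a)"
      by (simp add: linear_simps[OF bounded_linear_matrix_of_endo] matrix_exp_eq flip: endo_of_matrix_one)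
    then have "norm (matrix_exp X - mat 1 - X) \<le> norm (exp ?a - 1 - ?a) * C1"
      by (simp only: C1(2))
    also have "\<dots> \<le> norm ?a ^ 2 * exp (norm ?a) * C1"
      using C1(1) by (intro mult_right_mono norm_exp_remainder) simp
    also have "\<dots> \<le> (norm X * C2)^2 * exp (norm X * C2) * C1"
      using C1(1) C2 by (intro mult_right_mono mult_mono power_mono) auto
    finally show ?thesis using False by (simp add: divide_simps power2_eq_square mult_ac)
  qed simp
  have lim: "((\<lambda>X :: complex^'n^'n. norm X * C2^2 * exp (norm X * C2) * C1) \<longlongrightarrow> 0) (at 0)"
  proof -
    have "((\<lambda>X :: complex^'n^'n. norm X * C2^2 * exp (norm X * C2) * C1)
        \<longlongrightarrow> norm (0 :: complex^'n^'n) * C2^2 * exp (norm (0 :: complex^'n^'n) * C2) * C1) (at 0)"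
      by (intro tendsto_intros)
    then show ?thesis by simp
  qed
  show ?thesis
    unfolding has_derivative_at
    by (auto intro!: Lim_null_comparison[OF always_eventually[OF allI] lim] bounded_linear_ident simp: bound)
qed

lemma matrix_power_tendsto_exp:
  fixes h :: "nat \<Rightarrow> complex^'n^'n"
  assumes h: "(\<lambda>n. (h n - mat 1) /\<^sub>R r n) \<longlonglongrightarrow> Y"
    and r: "\<And>n. 0 < r n" "r \<longlonglongrightarrow> 0" and k: "(\<lambda>n. real (k n) * r n) \<longlonglongrightarrow> t"
  shows "(\<lambda>n. matrix_power (h n) (k n)) \<longlonglongrightarrow> matrix_exp (t *\<^sub>R Y)"
proof -
  have "(\<lambda>n. (endo_of_matrix (h n) - 1) /\<^sub>R r n) \<longlonglongrightarrow> endo_of_matrix Y"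
    using bounded_linear.tendsto[OF bounded_linear_endo_of_matrix h]
    by (simp add: linear_simps[OF bounded_linear_endo_of_matrix] endo_of_matrix_one)
  from power_tendsto_exp[OF this r k]
  have "(\<lambda>n. endo_of_matrix (matrix_power (h n) (k n))) \<longlonglongrightarrow> endo_of_matrix (matrix_exp (t *\<^sub>R Y))"
    by (simp add: endo_of_matrix_power endo_of_matrix_exp linear_simps[OF bounded_linear_endo_of_matrix])
  from bounded_linear.tendsto[OF bounded_linear_matrix_of_endo this] show ?thesis by simp
qed

lemma matrix_exp_quotient_tendsto:
  assumes r: "\<And>n. r n \<noteq> 0" "r \<longlonglongrightarrow> 0" and X: "X \<longlonglongrightarrow> Y"
  shows "(\<lambda>n. (matrix_exp (r n *\<^sub>R X n) - mat 1) /\<^sub>R r n) \<longlonglongrightarrow> Y"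
proof -
  let ?d = "\<lambda>Z :: complex^'a^'a. if Z = 0 then 0 else (matrix_exp Z - mat 1 - Z) /\<^sub>R norm Z"
  have "(?d \<longlongrightarrow> 0) (at 0)"
  proof (rule Lim_transform_eventually)
    show "((\<lambda>Z. (matrix_exp Z - mat 1 - Z) /\<^sub>R norm Z) \<longlongrightarrow> 0) (at 0)"
      using has_derivative_matrix_exp_0 unfolding has_derivative_at_within by simp
    show "\<forall>\<^sub>F Z in at 0. (matrix_exp Z - mat 1 - Z) /\<^sub>R norm Z = ?d Z"
      by (auto simp: eventually_at_filter)
  qed
  then have c: "isCont ?d 0" by (simp add: isCont_def)
  have z: "(\<lambda>n. r n *\<^sub>R X n) \<longlonglongrightarrow> 0" using tendsto_scaleR[OF r(2) X] by simp
  have "(\<lambda>n. ?d (r n *\<^sub>R X n)) \<longlonglongrightarrow> 0"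
    using isCont_tendsto_compose[OF c z] by simp
  then have dn: "(\<lambda>n. norm (?d (r n *\<^sub>R X n)) * norm (X n)) \<longlonglongrightarrow> 0 * norm Y"
    by (intro tendsto_mult tendsto_norm X tendsto_norm_zero)
  have "(\<lambda>n. (matrix_exp (r n *\<^sub>R X n) - mat 1) /\<^sub>R r n - X n) \<longlonglongrightarrow> 0"
  proof (rule Lim_null_comparison[OF always_eventually[OF allI]])
    fix n
    have "matrix_exp (r n *\<^sub>R X n) - mat 1 - r n *\<^sub>R X n = norm (r n *\<^sub>R X n) *\<^sub>R ?d (r n *\<^sub>R X n)"
      by (cases "r n *\<^sub>R X n = 0") (auto simp del: norm_scaleR)
    moreover have "X n = (r n *\<^sub>R X n) /\<^sub>R r n" using r(1)[of n] by simp
    ultimately have "(matrix_exp (r n *\<^sub>R X n) - mat 1) /\<^sub>R r n - X n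
        = (norm (r n *\<^sub>R X n) / r n) *\<^sub>R ?d (r n *\<^sub>R X n)"
      by (metis (no_types) scaleR_right_diff_distrib scaleR_scaleR divide_inverse_commute)
    then show "norm ((matrix_exp (r n *\<^sub>R X n) - mat 1) /\<^sub>R r n - X n)
        \<le> norm (?d (r n *\<^sub>R X n)) * norm (X n)"
      using r(1)[of n] by (simp add: mult.commute del: scaleR_eq_0_iff)
  next
    show "(\<lambda>n. norm (?d (r n *\<^sub>R X n)) * norm (X n)) \<longlonglongrightarrow> 0" using dn by simp
  qed
  from tendsto_add[OF this X] show ?thesis by simp
qed

section \<open>Closed matrix groups and their Lie algebras\<close>

text \<open>Closedness is required only towards invertible limits, that is, inside the general
  linear group. This covers algebraic groups, which need not be closed among all matrices, as well
  as compact groups.\<close>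

locale closed_matrix_group =
  fixes H :: "(complex^'n^'n) set"
  assumes one_mem: "mat 1 \<in> H"
    and mult_mem: "g \<in> H \<Longrightarrow> h \<in> H \<Longrightarrow> g ** h \<in> H"
    and inverse_mem: "g \<in> H \<Longrightarrow> \<exists>h\<in>H. g ** h = mat 1 \<and> h ** g = mat 1"
    and limit_mem: "(\<And>n :: nat. hs n \<in> H) \<Longrightarrow> hs \<longlonglongrightarrow> g \<Longrightarrow> invertible g \<Longrightarrow> g \<in> H"
begin

lemma power_mem: "g \<in> H \<Longrightarrow> matrix_power g k \<in> H"
  by (induction k) (simp_all add: matrix_power_def one_mem mult_mem)

lemma exp_uminus_mem: assumes "matrix_exp X \<in> H" shows "matrix_exp (- X) \<in> H"
proof -
  obtain h where h: "h \<in> H" "h ** matrix_exp X = mat 1"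
    using inverse_mem[OF assms] by blast
  have "matrix_exp (- X) = (h ** matrix_exp X) ** matrix_exp (- X)"
    unfolding h(2) by (rule matrix_mul_lid[symmetric])
  also have "\<dots> = h"
    unfolding matrix_mul_assoc[symmetric] matrix_exp_uminus by (rule matrix_mul_rid)
  finally show ?thesis using h(1) by (rule ssubst)
qed

lemma exp_mem: assumes "X \<in> lie_algebra H" shows "matrix_exp X \<in> H"
proof -
  have "matrix_exp (1 *\<^sub>R X) \<in> H" using assms unfolding lie_algebra_def by blast
  then show ?thesis by simp
qed

text \<open>Powers of elements close to the identity trace out a one-parameter group: with exponents
  about t / r they converge to the exponential of t Y, which is invertible and therefore stays in H.
  Negative t follow by inversion.\<close>

lemma lie_algebra_limit:
  assumes h: "\<And>n. h n \<in> H" and lim: "(\<lambda>n. (h n - mat 1) /\<^sub>R r n) \<longlonglongrightarrow> Y"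
    and r: "\<And>n. 0 < r n" "r \<longlonglongrightarrow> 0"
  shows "Y \<in> lie_algebra H"
proof -
  have pos: "matrix_exp (t *\<^sub>R Y) \<in> H" if "t \<ge> 0" for t
  proof (rule limit_mem[OF _ _ invertible_matrix_exp])
    define k where "k n = nat \<lfloor>t / r n\<rfloor>" for n
    have "(\<lambda>n. real (k n) * r n) \<longlonglongrightarrow> t"
    proof (rule Lim_transform)
      show "(\<lambda>n. t) \<longlonglongrightarrow> t" by simp
      show "(\<lambda>n. real (k n) * r n - t) \<longlonglongrightarrow> 0"
      proof (rule Lim_null_comparison[OF always_eventually[OF allI] r(2)])
        fix n
        have "real (k n) \<le> t / r n" "t / r n < real (k n) + 1"
          using that r(1)[of n] unfolding k_def by auto
        then show "norm (real (k n) * r n - t) \<le> r n"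
          using r(1)[of n] by (simp add: field_simps abs_if)
      qed
    qed
    then show "(\<lambda>n. matrix_power (h n) (k n)) \<longlonglongrightarrow> matrix_exp (t *\<^sub>R Y)"
      by (rule matrix_power_tendsto_exp[OF lim r])
    show "matrix_power (h n) (k n) \<in> H" for n by (rule power_mem[OF h])
  qed
  have "matrix_exp (t *\<^sub>R Y) \<in> H" for t
    using pos[of t] exp_uminus_mem[OF pos[of "- t"]] by (cases "t \<ge> 0") auto
  then show ?thesis by (simp add: lie_algebra_def)
qed

text \<open>For sums: the products of the exponentials of r X and r Y lie in H and have tangent
  direction X + Y as r tends to 0.\<close>

lemma subspace_lie_algebra: "subspace (lie_algebra H)"
proof (rule subspaceI)
  show "0 \<in> lie_algebra H" by (simp add: lie_algebra_def one_mem)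
  show "c *\<^sub>R X \<in> lie_algebra H" if "X \<in> lie_algebra H" for c X
    using that by (simp add: lie_algebra_def)
  show "X + Y \<in> lie_algebra H" if X: "X \<in> lie_algebra H" and Y: "Y \<in> lie_algebra H" for X Y
  proof -
    define r where "r n = 1 / (1 + real n)" for n
    have r: "0 < r n" "r \<longlonglongrightarrow> 0" for n
      unfolding r_def using lim_1_over_n[THEN LIMSEQ_Suc] by (auto simp: add_ac)
    let ?h = "\<lambda>n. matrix_exp (r n *\<^sub>R X) ** matrix_exp (r n *\<^sub>R Y)"
    have "(\<lambda>n. (matrix_exp (r n *\<^sub>R X) - mat 1) /\<^sub>R r n ** matrix_exp (r n *\<^sub>R Y)
          + (matrix_exp (r n *\<^sub>R Y) - mat 1) /\<^sub>R r n) \<longlonglongrightarrow> X ** mat 1 + Y"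
    proof (intro tendsto_add bounded_bilinear.tendsto[OF bounded_bilinear_matrix_mult])
      have "(\<lambda>n. r n *\<^sub>R Y) \<longlonglongrightarrow> 0 *\<^sub>R Y" by (intro tendsto_intros r)
      then show "(\<lambda>n. matrix_exp (r n *\<^sub>R Y)) \<longlonglongrightarrow> mat 1"
        using tendsto_matrix_exp by fastforce
    qed (use r in \<open>auto intro!: matrix_exp_quotient_tendsto simp: less_imp_neq[symmetric]\<close>)
    moreover have "(matrix_exp (r n *\<^sub>R X) - mat 1) /\<^sub>R r n ** matrix_exp (r n *\<^sub>R Y)
          + (matrix_exp (r n *\<^sub>R Y) - mat 1) /\<^sub>R r n = (?h n - mat 1) /\<^sub>R r n" for n
      by (simp add: scalar_matrix_assoc[symmetric] bounded_bilinear.diff_left[OF bounded_bilinear_matrix_mult]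
          algebra_simps)
    ultimately have "(\<lambda>n. (?h n - mat 1) /\<^sub>R r n) \<longlonglongrightarrow> X + Y" by simp
    moreover have "?h n \<in> H" for n using X Y by (auto simp: lie_algebra_def intro: mult_mem)
    ultimately show ?thesis using r by (intro lie_algebra_limit)
  qed
qed

text \<open>Cartan's closed subgroup theorem. With a linear projection p onto the Lie algebra, the
  map F covers a neighbourhood of the identity. If F Z is in H but is not the exponential of a small
  element of the Lie algebra, then the exponential of Z - p Z is in H and Z - p Z is nonzero. Along
  a sequence of such Z tending to 0, the normalized vectors Z - p Z accumulate at a unit vector that
  lies both in the Lie algebra and in the kernel of p, which is impossible.\<close>

theorem exp_covers_neighbourhood:
  assumes "e > 0"
  shows "\<exists>d>0. \<forall>h\<in>H. norm (h - mat 1) < d \<longrightarrow> (\<exists>X\<in>lie_algebra H. norm X < e \<and> h = matrix_exp X)"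
proof -
  let ?L = "lie_algebra H"
  obtain p where p: "range p \<subseteq> ?L" "linear p" "\<And>X. X \<in> ?L \<Longrightarrow> p X = X"
    using real_vector.linear_exists_left_inverse_on[OF real_vector.module_hom_id subspace_lie_algebra]
    by auto
  then have bl: "bounded_linear p" by (simp add: linear_conv_bounded_linear)
  define F where "F Z = matrix_exp (p Z) ** matrix_exp (Z - p Z)" for Z
  have contF: "continuous_on UNIV F"
    unfolding F_def
    by (intro bounded_bilinear.continuous_on[OF bounded_bilinear_matrix_mult]
        continuous_on_compose2[OF continuous_on_matrix_exp[of UNIV]]
        bounded_linear.continuous_on[OF bl] continuous_intros) auto
  have p0: "p 0 = 0" using p(2) by (simp add: linear_0)
  have derF: "(F has_derivative (\<lambda>Z. Z)) (at 0)"
  proof -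
    have e: "(matrix_exp has_derivative (\<lambda>X. X)) (at (p 0))" "(matrix_exp has_derivative (\<lambda>X. X)) (at (0 - p 0))"
      using has_derivative_matrix_exp_0 by (simp_all add: p0)
    have "((\<lambda>Z. matrix_exp (p Z)) has_derivative (\<lambda>Z. p Z)) (at 0)"
      by (rule has_derivative_compose[OF bounded_linear_imp_has_derivative[OF bl] e(1)])
    moreover have "((\<lambda>Z. matrix_exp (Z - p Z)) has_derivative (\<lambda>Z. Z - p Z)) (at 0)"
      by (rule has_derivative_compose[where g = matrix_exp and g' = "\<lambda>X. X" and f = "\<lambda>Z. Z - p Z", OF _ e(2)])
        (intro derivative_intros bounded_linear_imp_has_derivative[OF bl])
    ultimately have "(F has_derivative (\<lambda>Z. matrix_exp (p 0) ** (Z - p Z) + p Z ** matrix_exp (0 - p 0))) (at 0)"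
      unfolding F_def by (rule bounded_bilinear.FDERIV[OF bounded_bilinear_matrix_mult])
    then show ?thesis by (simp add: p0)
  qed
  have cover: "\<exists>d>0. ball (mat 1) d \<subseteq> F ` ball 0 s" if "s > 0" for s
  proof -
    \<comment> \<open>This open mapping theorem asks for continuity and for an invertible derivative
      at the single point 0.\<close>
    have "F 0 \<in> interior (F ` ball 0 s)"
      by (rule sussmann_open_mapping[OF open_UNIV contF UNIV_I derF bounded_linear_ident])
        (use that in auto)
    then show ?thesis by (simp add: F_def p0 mem_interior)
  qed
  show ?thesis
  proof (rule ccontr)
    assume neg: "\<not> ?thesis"
    have no: "\<exists>h\<in>H. norm (h - mat 1) < d \<and> \<not> (\<exists>X\<in>?L. norm X < e \<and> h = matrix_exp X)"
      if "d > 0" for d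
      using that neg by blast
    have "\<exists>Z. norm Z < s \<and> F Z \<in> H \<and> \<not> (\<exists>X\<in>?L. norm X < e \<and> F Z = matrix_exp X)"
      if "s > 0" for s
    proof -
      from cover[OF that] obtain d where d: "d > 0" "ball (mat 1) d \<subseteq> F ` ball 0 s" by blast
      from no[OF d(1)] obtain h where h: "h \<in> H" "norm (h - mat 1) < d"
          "\<not> (\<exists>X\<in>?L. norm X < e \<and> h = matrix_exp X)" by blast
      then have "h \<in> F ` ball 0 s" using d(2) by (auto simp: dist_norm norm_minus_commute)
      with h show ?thesis by auto
    qed
    then have "\<exists>Z. norm Z < 1 / (1 + real n) \<and> F Z \<in> H \<and> \<not> (\<exists>X\<in>?L. norm X < e \<and> F Z = matrix_exp X)" for n
      by (simp add: add_nonneg_pos)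
    then obtain Z where Z: "\<And>n. norm (Z n) < 1 / (1 + real n)" "\<And>n. F (Z n) \<in> H"
        "\<And>n. \<not> (\<exists>X\<in>?L. norm X < e \<and> F (Z n) = matrix_exp X)" by metis
    have Z0: "Z \<longlonglongrightarrow> 0"
    proof (rule Lim_null_comparison[OF always_eventually[OF allI]])
      show "norm (Z n) \<le> 1 / (1 + real n)" for n using Z(1)[of n] by simp
      show "(\<lambda>n. 1 / (1 + real n)) \<longlonglongrightarrow> 0"
        using lim_1_over_n[THEN LIMSEQ_Suc] by (simp add: add_ac)
    qed
    have pZ0: "(\<lambda>n. p (Z n)) \<longlonglongrightarrow> 0"
      using bounded_linear.tendsto[OF bl Z0] by (simp add: p0)
    obtain n0 where n0: "\<And>n. n \<ge> n0 \<Longrightarrow> norm (p (Z n)) < e"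
      using LIMSEQ_D[OF pZ0 \<open>e > 0\<close>] by auto
    \<comment> \<open>The shift by \<open>n0\<close> makes \<open>p (Z (n + n0))\<close> shorter
      than e; if \<open>Y n\<close> were 0, then \<open>F (Z (n + n0))\<close> would be an
      admissible exponential.\<close>
    define Y where "Y n = Z (n + n0) - p (Z (n + n0))" for n
    have expY: "matrix_exp (Y n) \<in> H" for n
    proof -
      have "matrix_exp (p (Z (n + n0))) \<in> H"
        using p(1) exp_mem by blast
      then have "matrix_exp (- p (Z (n + n0))) ** F (Z (n + n0)) \<in> H"
        by (intro mult_mem exp_uminus_mem Z)
      then show ?thesis
        by (simp add: F_def Y_def matrix_mul_assoc matrix_exp_uminus)
    qed
    have Yn: "Y n \<noteq> 0" for n
    proof
      assume "Y n = 0"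
      then have "F (Z (n + n0)) = matrix_exp (p (Z (n + n0)))" by (simp add: F_def Y_def)
      moreover have "p (Z (n + n0)) \<in> ?L" using p(1) by blast
      ultimately show False using Z(3)[of "n + n0"] n0[of "n + n0"] by auto
    qed
    have Y0: "Y \<longlonglongrightarrow> 0"
      using tendsto_diff[OF LIMSEQ_ignore_initial_segment[OF Z0] LIMSEQ_ignore_initial_segment[OF pZ0]]
      by (simp add: Y_def[abs_def])
    have sph: "Y n /\<^sub>R norm (Y n) \<in> sphere 0 1" for n using Yn[of n] by simp
    obtain l s where ls: "l \<in> sphere 0 1" "strict_mono s" "((\<lambda>n. Y n /\<^sub>R norm (Y n)) \<circ> s) \<longlonglongrightarrow> l"
      by (rule seq_compactE[OF compact_imp_seq_compact[OF compact_sphere], of "\<lambda>n. Y n /\<^sub>R norm (Y n)" 0 1])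
        (use sph in blast)+
    have "(\<lambda>n. (matrix_exp (norm (Y (s n)) *\<^sub>R (Y (s n) /\<^sub>R norm (Y (s n)))) - mat 1) /\<^sub>R norm (Y (s n))) \<longlonglongrightarrow> l"
      using Yn ls(3) LIMSEQ_subseq_LIMSEQ[OF tendsto_norm_zero[OF Y0] ls(2)]
      by (intro matrix_exp_quotient_tendsto) (auto simp: o_def)
    then have "(\<lambda>n. (matrix_exp (Y (s n)) - mat 1) /\<^sub>R norm (Y (s n))) \<longlonglongrightarrow> l"
      using Yn by simp
    then have lL: "l \<in> ?L"
      using Yn expY LIMSEQ_subseq_LIMSEQ[OF tendsto_norm_zero[OF Y0] ls(2)]
      by (intro lie_algebra_limit[where h = "\<lambda>n. matrix_exp (Y (s n))" and r = "\<lambda>n. norm (Y (s n))"])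
        (auto simp: o_def)
    have pY: "p (Y n) = 0" for n
    proof -
      have "p (p (Z (n + n0))) = p (Z (n + n0))" using p(1,3) by blast
      then show ?thesis using p(2) by (simp add: Y_def linear_diff)
    qed
    have "(\<lambda>n. p (((\<lambda>n. Y n /\<^sub>R norm (Y n)) \<circ> s) n)) \<longlonglongrightarrow> p l"
      by (rule bounded_linear.tendsto[OF bl ls(3)])
    then have "(\<lambda>n. 0) \<longlonglongrightarrow> p l" using p(2) by (simp add: linear_cmul pY o_def)
    then have "p l = 0" by (simp add: LIMSEQ_const_iff)
    with lL p(3) ls(1) show False by simp
  qed
qed

end

section \<open>Generation by one-parameter subgroups\<close>

text \<open>By Cartan's theorem U contains all elements of G near the identity. Translating,
  membership in U is locally constant on G, and G is connected.\<close>

lemma connected_matrix_group_eqI: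
  assumes G: "closed_matrix_group G" and U: "closed_matrix_group U" and "U \<subseteq> G" "connected G"
    and lie: "lie_algebra G \<subseteq> lie_algebra U"
  shows "U = G"
proof -
  interpret G: closed_matrix_group G by fact
  interpret U: closed_matrix_group U by fact
  obtain d where d: "d > 0" "\<And>g. g \<in> G \<Longrightarrow> norm (g - mat 1) < d \<Longrightarrow> g \<in> U"
    using G.exp_covers_neighbourhood[of 1] lie U.exp_mem by fastforce
  have "mat 1 \<in> U \<longleftrightarrow> b \<in> U" if "b \<in> G" for b
  proof (rule connected_equivalence_relation[OF \<open>connected G\<close> G.one_mem that])
    fix a assume "a \<in> G"
    then obtain a' where a': "a' \<in> G" "a ** a' = mat 1" "a' ** a = mat 1"
      using G.inverse_mem by blast
    let ?T = "{x \<in> G. norm (a' ** x - mat 1) < d}"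
    have "open {x. norm (a' ** x - mat 1) < d}"
      by (intro open_Collect_less continuous_intros
          bounded_linear.continuous_on[OF bounded_bilinear.bounded_linear_right[OF bounded_bilinear_matrix_mult]])
    then have "openin (top_of_set G) ?T"
      unfolding openin_open by (intro exI[of _ "{x. norm (a' ** x - mat 1) < d}"]) auto
    moreover have "a \<in> ?T" using \<open>a \<in> G\<close> a' d by simp
    moreover have "(a \<in> U) = (x \<in> U)" if "x \<in> ?T" for x
    proof -
      have u: "a' ** x \<in> U" using that a' by (intro d(2) G.mult_mem) auto
      have x: "x = a ** (a' ** x)" by (simp add: matrix_mul_assoc a')
      from u obtain u' where u': "u' \<in> U" "(a' ** x) ** u' = mat 1" using U.inverse_mem by blast
      have "x ** u' = a ** ((a' ** x) ** u')" by (simp add: matrix_mul_assoc a')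
      then have "x ** u' = a" by (simp only: u'(2) matrix_mul_rid)
      then show ?thesis using U.mult_mem u u' x by metis
    qed
    ultimately show "\<exists>T. openin (top_of_set G) T \<and> a \<in> T \<and> (\<forall>x\<in>T. (a \<in> U) = (x \<in> U))"
      by blast
  qed auto
  then show ?thesis using \<open>U \<subseteq> G\<close> U.one_mem by auto
qed

section \<open>Algebraic and compact groups as closed matrix groups\<close>

lemma continuous_on_entry_polynomial: "entry_polynomial p \<Longrightarrow> continuous_on S p"
  by (induction rule: entry_polynomial.induct) (auto intro!: continuous_intros)

lemma closed_matrix_groupI:
  assumes H: "subgroup H general_linear"
    and lim: "\<And>hs g. (\<And>n :: nat. hs n \<in> H) \<Longrightarrow> hs \<longlonglongrightarrow> g \<Longrightarrow> invertible g \<Longrightarrow> g \<in> H"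
  shows "closed_matrix_group H"
proof
  show "mat 1 \<in> H" using subgroup.one_closed[OF H] by (simp add: general_linear_def)
  show "g ** h \<in> H" if "g \<in> H" "h \<in> H" for g h
    using subgroup.m_closed[OF H that] by (simp add: general_linear_def)
  show "\<exists>h\<in>H. g ** h = mat 1 \<and> h ** g = mat 1" if "g \<in> H" for g
  proof (intro bexI conjI)
    show "inv\<^bsub>general_linear\<^esub> g \<in> H" by (rule subgroup.m_inv_closed[OF H that])
    have g: "g \<in> carrier general_linear" using subgroup.subset[OF H] that by blast
    show "g ** inv\<^bsub>general_linear\<^esub> g = mat 1" "inv\<^bsub>general_linear\<^esub> g ** g = mat 1"
      using group.r_inv[OF group_general_linear g] group.l_inv[OF group_general_linear g]
      by (simp_all add: general_linear_def)
  qed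
qed (fact lim)

lemma linear_algebraic_group_closed_matrix_group:
  assumes "linear_algebraic_group G" shows "closed_matrix_group G"
proof (rule closed_matrix_groupI)
  show "subgroup G general_linear" using assms by (simp add: linear_algebraic_group_def)
  fix hs g assume hs: "\<And>n. hs n \<in> G" and lim: "hs \<longlonglongrightarrow> g" and g: "invertible g"
  obtain P where P: "\<And>p. p \<in> P \<Longrightarrow> entry_polynomial p" "G = {A. invertible A \<and> (\<forall>p\<in>P. p A = 0)}"
    using assms by (auto simp: linear_algebraic_group_def zariski_closed_GL_def)
  have "p g = 0" if "p \<in> P" for p
  proof -
    have "isCont p g"
      using continuous_on_entry_polynomial[OF P(1)[OF that], of UNIV] by (simp add: continuous_on_eq_continuous_at)
    then have "(\<lambda>n. p (hs n)) \<longlonglongrightarrow> p g" by (rule isCont_tendsto_compose[OF _ lim])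
    moreover have "p (hs n) = 0" for n using hs[of n] that unfolding P(2) by blast
    ultimately show ?thesis by (simp add: LIMSEQ_const_iff)
  qed
  then show "g \<in> G" using g by (simp add: P(2))
qed

lemma compact_subgroup_closed_matrix_group:
  assumes G: "subgroup G general_linear" and K: "subgroup K (group_on G)" "compact K"
  shows "closed_matrix_group K" "K \<subseteq> G"
proof -
  show "K \<subseteq> G" using subgroup.subset[OF K(1)] by simp
  have "subgroup K general_linear"
    by (rule group.incl_subgroup[OF group_general_linear G K(1)])
  then show "closed_matrix_group K"
    by (rule closed_matrix_groupI) (meson K(2) compact_imp_closed closed_sequentially)
qed

section \<open>Complex one-parameter subgroups and holomorphic dependence\<close>

definition scale_matrix :: "complex \<Rightarrow> complex^'n^'n \<Rightarrow> complex^'n^'n" where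
  "scale_matrix z X = (\<chi> i j. z * X $ i $ j)"

lemma scale_matrix_of_real: "scale_matrix (of_real t) X = t *\<^sub>R X"
  by (simp add: scale_matrix_def vec_eq_iff scaleR_conv_of_real[symmetric])

lemma scale_matrix_Complex: "scale_matrix z X = Re z *\<^sub>R X + i_times (Im z *\<^sub>R X)"
  by (simp add: scale_matrix_def i_times_def vec_eq_iff complex_eq_iff)

lemma matrix_power_scale_matrix: "matrix_power (scale_matrix z X) k = scale_matrix (z ^ k) (matrix_power X k)"
proof (induction k)
  case 0
  then show ?case by (simp add: matrix_power_def scale_matrix_def vec_eq_iff)
next
  case (Suc k)
  have "matrix_power (scale_matrix z X) (Suc k) = scale_matrix z X ** scale_matrix (z ^ k) (matrix_power X k)"
    using Suc by (simp add: matrix_power_def)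
  also have "\<dots> = scale_matrix (z ^ Suc k) (X ** matrix_power X k)"
    by (simp add: scale_matrix_def matrix_matrix_mult_def vec_eq_iff sum_distrib_left mult_ac)
  finally show ?case by (simp add: matrix_power_def)
qed

text \<open>Entrywise the exponential series is a power series in z that converges
  everywhere.\<close>

lemma holomorphic_matrix_exp_scale: "(\<lambda>z. matrix_exp (scale_matrix z X) $ i $ j) holomorphic_on S"
proof -
  have "(\<lambda>k. (matrix_power X k $ i $ j / fact k) * (w - 0) ^ k) sums (matrix_exp (scale_matrix w X) $ i $ j)" for w
  proof -
    have "bounded_linear (\<lambda>A :: complex^'a^'a. A $ i $ j)"
      by (intro bounded_linear_compose[OF bounded_linear_vec_nth] bounded_linear_vec_nth)
    from bounded_linear.sums[OF this sums_matrix_exp[of "scale_matrix w X"]]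
    moreover have "((1 / fact k) *\<^sub>R matrix_power (scale_matrix w X) k) $ i $ j
        = (matrix_power X k $ i $ j / fact k) * (w - 0) ^ k" for k
      unfolding matrix_power_scale_matrix vector_scaleR_component
      by (simp add: scale_matrix_def scaleR_conv_of_real)
    ultimately show ?thesis by simp
  qed
  then have hol: "(\<lambda>z. matrix_exp (scale_matrix z X) $ i $ j) holomorphic_on ball 0 r" for r
    by (rule power_series_holomorphic)
  have "(\<lambda>z. matrix_exp (scale_matrix z X) $ i $ j) field_differentiable at z" for z
    using hol[of "norm z + 1"] by (rule holomorphic_on_imp_differentiable_at) auto
  then show ?thesis
    using field_differentiable_at_within by (auto simp: holomorphic_on_def)
qed

lemma entry_polynomial_holomorphic:
  assumes "entry_polynomial p" and "\<And>i j. (\<lambda>z. A z $ i $ j) holomorphic_on S"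
  shows "(\<lambda>z. p (A z)) holomorphic_on S"
  using assms by (induction rule: entry_polynomial.induct) (auto intro!: holomorphic_intros)

lemma det_holomorphic:
  assumes "\<And>i j. (\<lambda>z. A z $ i $ j) holomorphic_on S"
  shows "(\<lambda>z. det (A z)) holomorphic_on S"
  unfolding det_def using assms by (intro holomorphic_intros)

lemma regular_on_holomorphic:
  assumes "regular_on G f" "\<And>i j. (\<lambda>z. A z $ i $ j) holomorphic_on S"
    and "\<And>z. z \<in> S \<Longrightarrow> A z \<in> G" "\<And>g. g \<in> G \<Longrightarrow> invertible g"
  shows "(\<lambda>z. f (A z)) holomorphic_on S"
proof -
  obtain p r where pr: "entry_polynomial p" "\<And>g. g \<in> G \<Longrightarrow> f g = p g / det g ^ r"
    using assms(1) by (auto simp: regular_on_def)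
  have "(\<lambda>z. p (A z) / det (A z) ^ r) holomorphic_on S"
    using assms by (intro holomorphic_intros entry_polynomial_holomorphic[OF pr(1)] det_holomorphic)
      (auto simp: invertible_det_nz)
  then show ?thesis by (rule holomorphic_transform) (simp add: pr(2) assms(3))
qed

lemma regular_on_continuous:
  assumes "regular_on G f" "\<And>g. g \<in> G \<Longrightarrow> invertible g"
  shows "continuous_on G f"
proof -
  obtain p r where pr: "entry_polynomial p" "\<And>g. g \<in> G \<Longrightarrow> f g = p g / det g ^ r"
    using assms(1) by (auto simp: regular_on_def)
  have "continuous_on G (\<lambda>g. p g / det g ^ r)"
    unfolding det_def
    using assms(2)
    by (intro continuous_intros continuous_on_entry_polynomial[OF pr(1)])
      (auto simp: invertible_det_nz det_def[symmetric])
  then show ?thesis by (simp add: pr(2) cong: continuous_on_cong)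
qed

section \<open>Hermitian forms on tensor powers\<close>

lemma Re_cnj_mult_self: "Re (cnj z * z) = (norm z)^2"
  unfolding cmod_power2 by (simp add: power2_eq_square)

lemma scaleR_eq_vector_smult: "r *\<^sub>R x = complex_of_real r *s x"
  unfolding vec_eq_iff vector_scaleR_component vector_smult_component by (simp add: scaleR_conv_of_real)

lemma finite_length_eq: "finite {J :: 'm::finite list. length J = k}"
  using finite_lists_length_eq[of "UNIV :: 'm set" k] by simp

locale hermitian =
  fixes ip :: "complex^'m \<Rightarrow> complex^'m \<Rightarrow> complex"
  assumes herm: "hermitian_inner_product ip"
begin

lemma add_right: "ip x (y + z) = ip x y + ip x z"
  and scale_right: "ip x (c *s y) = c * ip x y"
  and conj_sym: "ip y x = cnj (ip x y)"
  and pos: "x \<noteq> 0 \<Longrightarrow> 0 < Re (ip x x)"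
  using herm unfolding hermitian_inner_product_def by blast+

lemma zero_right [simp]: "ip x 0 = 0"
  using scale_right[of x 0 0] by simp

lemma zero_left [simp]: "ip 0 x = 0"
  using conj_sym[of 0 x] by simp

lemma add_left: "ip (x + y) z = ip x z + ip y z"
proof -
  have "ip (x + y) z = cnj (ip z (x + y))" by (rule conj_sym)
  also have "\<dots> = cnj (ip z x) + cnj (ip z y)" by (simp add: add_right)
  finally show ?thesis by (simp only: conj_sym[symmetric])
qed

lemma scale_left: "ip (c *s x) y = cnj c * ip x y"
proof -
  have "ip (c *s x) y = cnj (ip y (c *s x))" by (rule conj_sym)
  also have "\<dots> = cnj c * cnj (ip y x)" by (simp add: scale_right)
  finally show ?thesis by (simp only: conj_sym[symmetric])
qed

lemma minus_right: "ip x (- y) = - ip x y"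
  using scale_right[of x "- 1" y] by (simp add: vector_sneg_minus1[symmetric])

lemma minus_left: "ip (- x) y = - ip x y"
  using scale_left[of "- 1" x y] by (simp add: vector_sneg_minus1[symmetric])

lemma diff_right: "ip x (y - z) = ip x y - ip x z"
  using add_right[of x y "- z"] by (simp add: minus_right)

lemma diff_left: "ip (x - y) z = ip x z - ip y z"
  using add_left[of x "- y" z] by (simp add: minus_left)

lemma sum_right: "ip x (\<Sum>j\<in>F. f j) = (\<Sum>j\<in>F. ip x (f j))"
  by (induction F rule: infinite_finite_induct) (auto simp: add_right)

lemma im_self: "Im (ip x x) = 0"
  using conj_sym[of x x] by (metis cnj.simps(2) neg_equal_zero)

lemma nonneg: "0 \<le> Re (ip x x)"
  using pos[of x] by (cases "x = 0") auto

lemma ip_norm_sq: "ip_norm ip x ^ 2 = Re (ip x x)"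
  by (simp add: ip_norm_def nonneg)

lemma ip_self: "ip x x = of_real (ip_norm ip x ^ 2)"
  by (simp add: ip_norm_sq complex_eq_iff im_self)

lemma ip_norm_nonneg: "0 \<le> ip_norm ip x"
  by (simp add: ip_norm_def nonneg)

lemma ip_norm_eq_0: "ip_norm ip x = 0 \<longleftrightarrow> x = 0"
  using pos[of x] by (cases "x = 0") (auto simp: ip_norm_def)

text \<open>Gram-Schmidt for an arbitrary finite family: a vector whose remainder vanishes is
  dropped, so no linear independence is asked for.\<close>

lemma orthonormal_family:
  assumes "finite B"
  shows "\<exists>S. finite S \<and> (\<forall>s\<in>S. \<forall>t\<in>S. ip s t = (if s = t then 1 else 0)) \<and>
    (\<forall>b\<in>B. b = (\<Sum>s\<in>S. ip s b *s s))"
  using assms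
proof (induction B)
  case empty
  show ?case by (rule exI[of _ "{}"]) simp
next
  case (insert b B)
  then obtain S where S: "finite S" "\<And>s t. s \<in> S \<Longrightarrow> t \<in> S \<Longrightarrow> ip s t = (if s = t then 1 else 0)"
      "\<And>b. b \<in> B \<Longrightarrow> b = (\<Sum>s\<in>S. ip s b *s s)" by blast
  define r where "r = b - (\<Sum>s\<in>S. ip s b *s s)"
  have orth: "ip s r = 0" if "s \<in> S" for s
  proof -
    have "ip s (\<Sum>t\<in>S. ip t b *s t) = (\<Sum>t\<in>S. if t = s then ip t b else 0)"
      unfolding sum_right using that S(2) by (intro sum.cong refl) (auto simp: scale_right)
    also have "\<dots> = ip s b" using that S(1) by simp
    finally show ?thesis by (simp add: r_def diff_right)
  qed
  show ?case
  proof (cases "r = 0")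
    case True
    then show ?thesis using S by (intro exI[of _ S]) (auto simp: r_def)
  next
    case False
    define n where "n = ip_norm ip r"
    define u where "u = of_real (1 / n) *s r"
    have n: "n > 0" using False ip_norm_nonneg[of r] ip_norm_eq_0[of r] by (auto simp: n_def less_le)
    have uu: "ip u u = 1"
      using n unfolding u_def scale_left scale_right ip_self[of r]
      by (simp add: n_def[symmetric] power2_eq_square)
    have ur: "ip u r *s u = r"
      using n unfolding u_def scale_left ip_self[of r]
      by (simp add: n_def[symmetric] power2_eq_square)
    have su: "ip s u = 0" "ip u s = 0" if "s \<in> S" for s
      using orth[OF that] conj_sym[of u s] by (simp_all add: u_def scale_right)
    have uS: "u \<notin> S" using su(1)[of u] uu by auto
    have ub: "ip u (\<Sum>s\<in>S. c s *s s) = 0" for c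
      unfolding sum_right by (intro sum.neutral ballI) (simp add: scale_right su)
    show ?thesis
    proof (intro exI[of _ "insert u S"] conjI ballI)
      show "finite (insert u S)" using S(1) by simp
      show "ip s t = (if s = t then 1 else 0)" if "s \<in> insert u S" "t \<in> insert u S" for s t
        using that S(2) su uu uS by auto
      fix b' assume "b' \<in> insert b B"
      then consider "b' = b" | "b' \<in> B" by blast
      then show "b' = (\<Sum>s\<in>insert u S. ip s b' *s s)"
      proof cases
        case 1
        have b: "b = r + (\<Sum>s\<in>S. ip s b *s s)" by (simp add: r_def)
        have "ip u b = ip u r" by (subst b) (simp only: add_right ub add_0_right)
        then show ?thesis using 1 S(1) uS ur b by simp
      next
        case 2
        have "ip u b' = 0" by (subst S(3)[OF 2]) (rule ub)
        then show ?thesis using S(1) uS S(3)[OF 2] by simp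
      qed
    qed
  qed
qed

lemma orthonormal_basis:
  "\<exists>S. finite S \<and> (\<forall>x. x = (\<Sum>s\<in>S. ip s x *s s)) \<and>
    (\<forall>x y. ip x y = (\<Sum>s\<in>S. cnj (ip s x) * ip s y))"
proof -
  obtain S where S: "finite S" "\<And>i. axis i 1 = (\<Sum>s\<in>S. ip s (axis i 1) *s s)"
    using orthonormal_family[of "range (\<lambda>i. axis i 1)"] by (auto simp del: axis_eq_axis)
  have ex: "x = (\<Sum>s\<in>S. ip s x *s s)" for x
  proof -
    have "x = (\<Sum>i\<in>UNIV. x $ i *s axis i 1)" by (rule basis_expansion[symmetric])
    also have "\<dots> = (\<Sum>i\<in>UNIV. x $ i *s (\<Sum>s\<in>S. ip s (axis i 1) *s s))"
      using S(2) by simp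
    also have "\<dots> = (\<Sum>s\<in>S. (\<Sum>i\<in>UNIV. x $ i * ip s (axis i 1)) *s s)"
      by (simp add: vec.scale_sum_right vec.scale_sum_left sum.swap[of _ UNIV])
    also have "\<dots> = (\<Sum>s\<in>S. ip s (\<Sum>i\<in>UNIV. x $ i *s axis i 1) *s s)"
      by (simp only: sum_right scale_right)
    finally show ?thesis by (simp only: basis_expansion)
  qed
  have "ip x y = (\<Sum>s\<in>S. cnj (ip s x) * ip s y)" for x y
  proof -
    have "ip x y = ip x (\<Sum>s\<in>S. ip s y *s s)" using ex[of y] by simp
    also have "\<dots> = (\<Sum>s\<in>S. ip s y * ip x s)" by (simp only: sum_right scale_right)
    also have "\<dots> = (\<Sum>s\<in>S. cnj (ip s x) * ip s y)"
      by (intro sum.cong refl) (subst conj_sym, simp)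
    finally show ?thesis .
  qed
  with S ex show ?thesis by blast
qed

section \<open>The induced inner product on tensor powers\<close>

abbreviation tip :: "nat \<Rightarrow> 'm tensor \<Rightarrow> 'm tensor \<Rightarrow> complex" where
  "tip k \<equiv> tensor_ip k ip"

lemma tip_cong:
  assumes "\<And>I. length I = k \<Longrightarrow> S I = S' I" "\<And>I. length I = k \<Longrightarrow> T I = T' I"
  shows "tip k S T = tip k S' T'"
  unfolding tensor_ip_def using assms by (intro sum.cong refl) simp

lemma tip_add_right: "tip k S (\<lambda>I. T I + T' I) = tip k S T + tip k S T'"
  by (simp add: tensor_ip_def algebra_simps sum.distrib)

lemma tip_scale_right: "tip k S (\<lambda>I. c * T I) = c * tip k S T"
  by (simp add: tensor_ip_def sum_distrib_left mult_ac)

lemma tip_conj_sym: "tip k T S = cnj (tip k S T)"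
proof -
  have "cnj (tip k S T) = (\<Sum>I | length I = k. \<Sum>J | length J = k.
      S I * cnj (T J) * (\<Prod>l<k. ip (axis (J ! l) 1) (axis (I ! l) 1)))"
    unfolding tensor_ip_def by (simp add: conj_sym[symmetric])
  also have "\<dots> = tip k T S"
    unfolding tensor_ip_def by (subst sum.swap) (simp add: mult_ac)
  finally show ?thesis by simp
qed

lemma tip_zero_right: "tip k S (\<lambda>I. 0) = 0"
  by (simp add: tensor_ip_def)

lemma tip_sum_right: "tip k S (\<lambda>I. \<Sum>x\<in>F. c x * T x I) = (\<Sum>x\<in>F. c x * tip k S (T x))"
  by (induction F rule: infinite_finite_induct)
    (simp_all add: tip_zero_right tip_add_right tip_scale_right)

lemma tip_sum_left: "tip k (\<lambda>I. \<Sum>x\<in>F. c x * T x I) S = (\<Sum>x\<in>F. cnj (c x) * tip k (T x) S)"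
proof -
  have "tip k (\<lambda>I. \<Sum>x\<in>F. c x * T x I) S = cnj (\<Sum>x\<in>F. c x * tip k S (T x))"
    by (subst tip_conj_sym) (simp add: tip_sum_right)
  also have "\<dots> = (\<Sum>x\<in>F. cnj (c x) * tip k (T x) S)"
    by (simp add: tip_conj_sym[of k _ S])
  finally show ?thesis .
qed

lemma tip_add_left: "tip k (\<lambda>I. T I + T' I) S = tip k T S + tip k T' S"
  by (simp add: tensor_ip_def algebra_simps sum.distrib)

lemma tip_minus_right: "tip k S (\<lambda>I. - T I) = - tip k S T"
  using tip_scale_right[of k S "-1" T] by simp

lemma tip_minus_left: "tip k (\<lambda>I. - T I) S = - tip k T S"
  by (simp add: tensor_ip_def sum_negf)

lemma tip_diff_right: "tip k S (\<lambda>I. T I - T' I) = tip k S T - tip k S T'"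
  using tip_add_right[of k S T "\<lambda>I. - T' I"] by (simp add: tip_minus_right)

lemma tip_diff_left: "tip k (\<lambda>I. T I - T' I) S = tip k T S - tip k T' S"
  using tip_add_left[of k T "\<lambda>I. - T' I" S] by (simp add: tip_minus_left)

lemma tip_tendsto:
  assumes "\<And>J. length J = k \<Longrightarrow> ((\<lambda>n. S n J) \<longlongrightarrow> S' J) F" "\<And>J. length J = k \<Longrightarrow> ((\<lambda>n. T n J) \<longlongrightarrow> T' J) F"
  shows "((\<lambda>n. tip k (S n) (T n)) \<longlongrightarrow> tip k S' T') F"
  unfolding tensor_ip_def using assms by (intro tendsto_intros) auto

lemma tensor_power_map_eq_sum:
  "length I = k \<Longrightarrow> tensor_power_map k A T I = (\<Sum>J | length J = k. T J * pure_tensor k (\<lambda>l. A *v axis (J ! l) 1) I)"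
  by (simp add: tensor_power_map_def pure_tensor_def matrix_vector_mult_def axis_def if_distrib mult.commute
      cong: if_cong)

lemma tip_tensor_power_map:
  assumes "\<And>x y. ip (A *v x) (A *v y) = ip x y"
  shows "tip k (tensor_power_map k A S) (tensor_power_map k A T) = tip k S T"
proof -
  let ?L = "{J :: 'm list. length J = k}"
  have "tip k (tensor_power_map k A S) (tensor_power_map k A T)
      = tip k (\<lambda>I. \<Sum>P\<in>?L. S P * pure_tensor k (\<lambda>l. A *v axis (P ! l) 1) I)
          (\<lambda>I. \<Sum>Q\<in>?L. T Q * pure_tensor k (\<lambda>l. A *v axis (Q ! l) 1) I)"
    by (rule tip_cong) (simp_all add: tensor_power_map_eq_sum)
  also have "\<dots> = (\<Sum>P\<in>?L. \<Sum>Q\<in>?L. cnj (S P) * T Q * (\<Prod>l<k. ip (axis (P ! l) 1) (axis (Q ! l) 1)))"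
    by (simp only: tip_sum_left tip_sum_right tensor_ip_pure_tensor[OF herm] assms sum_distrib_left mult.assoc)
  finally show ?thesis by (simp add: tensor_ip_def)
qed

text \<open>\<open>L \<sigma> T\<close> is the inner product of T with the tensor product of the
  vectors \<open>\<sigma> l\<close>. For \<sigma> running over the k-tuples from an orthonormal
  basis, these products form an orthonormal basis of the tensor power. Positivity, Cauchy-Schwarz
  and definiteness of \<open>tip k\<close> are read off from it.\<close>

lemma tip_coordinates:
  "\<exists>(X :: (nat \<Rightarrow> complex^'m) set) L. finite X \<and>
    (\<forall>S T. tip k S T = (\<Sum>\<sigma>\<in>X. cnj (L \<sigma> S) * L \<sigma> T)) \<and>
    (\<forall>T J. length J = k \<longrightarrow> T J = (\<Sum>\<sigma>\<in>X. (\<Prod>l<k. \<sigma> l $ (J ! l)) * L \<sigma> T))"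
proof -
  obtain B where B: "finite B" "\<And>x. x = (\<Sum>s\<in>B. ip s x *s s)"
      "\<And>x y. ip x y = (\<Sum>s\<in>B. cnj (ip s x) * ip s y)"
    using orthonormal_basis by blast
  define X where "X = (\<Pi>\<^sub>E l\<in>{..<k}. B)"
  define L where "L \<sigma> T = (\<Sum>J | length J = k. T J * (\<Prod>l<k. ip (\<sigma> l) (axis (J ! l) 1)))"
    for \<sigma> :: "nat \<Rightarrow> complex^'m" and T :: "'m tensor"
  let ?L = "{J :: 'm list. length J = k}"
  have X: "finite X" unfolding X_def using B(1) by (intro finite_PiE) auto
  have dist: "(\<Prod>l<k. \<Sum>s\<in>B. f l s) = (\<Sum>\<sigma>\<in>X. \<Prod>l<k. f l (\<sigma> l))" for f :: "nat \<Rightarrow> complex^'m \<Rightarrow> complex"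
    unfolding X_def using B(1) by (intro prod_sum_PiE) auto
  have "tip k S T = (\<Sum>\<sigma>\<in>X. cnj (L \<sigma> S) * L \<sigma> T)" for S T
  proof -
    have "tip k S T = (\<Sum>I\<in>?L. \<Sum>J\<in>?L. \<Sum>\<sigma>\<in>X. cnj (S I) * T J *
        (\<Prod>l<k. cnj (ip (\<sigma> l) (axis (I ! l) 1)) * ip (\<sigma> l) (axis (J ! l) 1)))"
      unfolding tensor_ip_def by (subst B(3)) (simp only: dist sum_distrib_left)
    also have "\<dots> = (\<Sum>\<sigma>\<in>X. \<Sum>I\<in>?L. \<Sum>J\<in>?L. cnj (S I) * T J *
        (\<Prod>l<k. cnj (ip (\<sigma> l) (axis (I ! l) 1)) * ip (\<sigma> l) (axis (J ! l) 1)))"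
      by (simp only: sum.swap[of _ X])
    also have "\<dots> = (\<Sum>\<sigma>\<in>X. cnj (L \<sigma> S) * L \<sigma> T)"
    proof (intro sum.cong refl)
      fix \<sigma>
      show "(\<Sum>I\<in>?L. \<Sum>J\<in>?L. cnj (S I) * T J *
          (\<Prod>l<k. cnj (ip (\<sigma> l) (axis (I ! l) 1)) * ip (\<sigma> l) (axis (J ! l) 1))) = cnj (L \<sigma> S) * L \<sigma> T"
        unfolding L_def cnj_sum sum_product by (intro sum.cong refl) (simp add: prod.distrib mult_ac)
    qed
    finally show ?thesis .
  qed
  moreover have "T J = (\<Sum>\<sigma>\<in>X. (\<Prod>l<k. \<sigma> l $ (J ! l)) * L \<sigma> T)" if J: "length J = k" for T J
  proof -
    \<comment> \<open>Completeness of the basis: in each factor the sum over its vectors collapses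
      to a Kronecker delta.\<close>
    have comp: "(axis i 1 :: complex^'m) $ j = (\<Sum>s\<in>B. ip s (axis i 1) * s $ j)" for i j
      using arg_cong[OF B(2)[of "axis i 1"], of "\<lambda>v. v $ j"] by simp
    have "(\<Sum>\<sigma>\<in>X. (\<Prod>l<k. \<sigma> l $ (J ! l)) * L \<sigma> T)
        = (\<Sum>\<sigma>\<in>X. \<Sum>I\<in>?L. T I * (\<Prod>l<k. ip (\<sigma> l) (axis (I ! l) 1) * \<sigma> l $ (J ! l)))"
      by (simp add: L_def sum_distrib_left prod.distrib mult_ac)
    also have "\<dots> = (\<Sum>I\<in>?L. T I * (\<Prod>l<k. (axis (I ! l) 1 :: complex^'m) $ (J ! l)))"
      by (subst sum.swap) (simp only: comp dist sum_distrib_left[symmetric])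
    also have "\<dots> = (\<Sum>I\<in>?L. if I = J then T I else 0)"
    proof (intro sum.cong refl)
      fix I :: "'m list" assume I: "I \<in> ?L"
      show "T I * (\<Prod>l<k. (axis (I ! l) 1 :: complex^'m) $ (J ! l)) = (if I = J then T I else 0)"
      proof (cases "I = J")
        case False
        then obtain l where "l < k" "I ! l \<noteq> J ! l" using I J by (auto simp: list_eq_iff_nth_eq)
        then have "(\<Prod>l<k. (axis (I ! l) 1 :: complex^'m) $ (J ! l)) = 0"
          by (intro prod_zero bexI[of _ l]) (auto simp: axis_def)
        with False show ?thesis by simp
      qed (simp add: axis_def)
    qed
    also have "\<dots> = T J" using J by (simp add: finite_length_eq)
    finally show ?thesis by simp
  qed
  ultimately show ?thesis using X by blast
qed

lemma tip_self_real: "Im (tip k T T) = 0"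
  using tip_conj_sym[of k T T] by (metis cnj.simps(2) neg_equal_zero)

lemma tip_nonneg: "0 \<le> Re (tip k T T)"
proof -
  obtain X :: "(nat \<Rightarrow> complex^'m) set" and L where XL: "\<And>S T. tip k S T = (\<Sum>\<sigma>\<in>X. cnj (L \<sigma> S) * L \<sigma> T)"
    using tip_coordinates[of k] by blast
  have "Re (tip k T T) = (\<Sum>\<sigma>\<in>X. (Re (L \<sigma> T))^2 + (Im (L \<sigma> T))^2)"
    by (simp add: XL power2_eq_square)
  then show ?thesis by (simp add: sum_nonneg)
qed

lemma tip_norm_sq: "ip_norm (tip k) T ^ 2 = Re (tip k T T)"
  by (simp add: ip_norm_def tip_nonneg)

lemma tip_self: "tip k T T = of_real (ip_norm (tip k) T ^ 2)"
  by (simp add: tip_norm_sq complex_eq_iff tip_self_real)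

lemma tip_norm_nonneg: "0 \<le> ip_norm (tip k) T"
  by (simp add: ip_norm_def tip_nonneg)

lemma tip_Cauchy_Schwarz: "norm (tip k S T) \<le> ip_norm (tip k) S * ip_norm (tip k) T"
proof -
  obtain X :: "(nat \<Rightarrow> complex^'m) set" and L where XL: "\<And>S T. tip k S T = (\<Sum>\<sigma>\<in>X. cnj (L \<sigma> S) * L \<sigma> T)"
    using tip_coordinates[of k] by blast
  have n: "ip_norm (tip k) T = L2_set (\<lambda>\<sigma>. norm (L \<sigma> T)) X" for T
    by (simp only: ip_norm_def L2_set_def XL Re_sum Re_cnj_mult_self)
  have "norm (tip k S T) \<le> (\<Sum>\<sigma>\<in>X. norm (cnj (L \<sigma> S) * L \<sigma> T))"
    unfolding XL by (rule norm_sum)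
  also have "\<dots> = (\<Sum>\<sigma>\<in>X. \<bar>norm (L \<sigma> S)\<bar> * \<bar>norm (L \<sigma> T)\<bar>)"
    by (simp add: norm_mult)
  also have "\<dots> \<le> ip_norm (tip k) S * ip_norm (tip k) T"
    unfolding n by (rule L2_set_mult_ineq)
  finally show ?thesis .
qed

text \<open>Serves twice: a tensor of norm 0 vanishes on the lists of that length, and Cauchy
  sequences in norm converge in every coordinate.\<close>

lemma tip_coordinate_bound:
  obtains C where "C > 0" "\<And>T. norm (T J) \<le> C * ip_norm (tip (length J)) T"
proof -
  define k where "k = length J"
  obtain X :: "(nat \<Rightarrow> complex^'m) set" and L where XL: "finite X" "\<And>S T. tip k S T = (\<Sum>\<sigma>\<in>X. cnj (L \<sigma> S) * L \<sigma> T)"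
      "\<And>T J. length J = k \<Longrightarrow> T J = (\<Sum>\<sigma>\<in>X. (\<Prod>l<k. \<sigma> l $ (J ! l)) * L \<sigma> T)"
    using tip_coordinates[of k] by blast
  have n: "ip_norm (tip k) T = L2_set (\<lambda>\<sigma>. norm (L \<sigma> T)) X" for T
    by (simp only: ip_norm_def L2_set_def XL(2) Re_sum Re_cnj_mult_self)
  define C where "C = 1 + (\<Sum>\<sigma>\<in>X. norm (\<Prod>l<k. \<sigma> l $ (J ! l)))"
  have "norm (T J) \<le> C * ip_norm (tip (length J)) T" for T
  proof -
    have "norm (T J) \<le> (\<Sum>\<sigma>\<in>X. norm (\<Prod>l<k. \<sigma> l $ (J ! l)) * norm (L \<sigma> T))"
      by (subst XL(3)) (auto simp: k_def norm_mult[symmetric] simp del: norm_mult intro: norm_sum)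
    also have "\<dots> \<le> (\<Sum>\<sigma>\<in>X. norm (\<Prod>l<k. \<sigma> l $ (J ! l)) * ip_norm (tip k) T)"
      unfolding n using member_le_L2_set[OF XL(1)]
      by (intro sum_mono mult_left_mono) auto
    also have "\<dots> \<le> C * ip_norm (tip k) T"
      using tip_norm_nonneg[of k T] by (simp add: C_def sum_distrib_right distrib_right)
    finally show ?thesis by (simp add: k_def)
  qed
  moreover have "C > 0" unfolding C_def by (intro add_pos_nonneg sum_nonneg) auto
  ultimately show ?thesis using that by blast
qed

section \<open>The norm on the representation space\<close>

lemma Cauchy_Schwarz: "norm (ip x y) \<le> ip_norm ip x * ip_norm ip y"
proof -
  obtain S where S: "\<And>x y. ip x y = (\<Sum>s\<in>S. cnj (ip s x) * ip s y)"
    using orthonormal_basis by blast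
  have "ip_norm ip x = sqrt (Re (\<Sum>s\<in>S. cnj (ip s x) * ip s x))" for x
    unfolding ip_norm_def by (subst S) (rule refl)
  then have n: "ip_norm ip x = L2_set (\<lambda>s. norm (ip s x)) S" for x
    by (simp only: L2_set_def Re_sum Re_cnj_mult_self)
  have "norm (ip x y) \<le> (\<Sum>s\<in>S. norm (cnj (ip s x) * ip s y))"
    by (subst S) (rule norm_sum)
  also have "\<dots> = (\<Sum>s\<in>S. \<bar>norm (ip s x)\<bar> * \<bar>norm (ip s y)\<bar>)"
    by (simp add: norm_mult)
  also have "\<dots> \<le> ip_norm ip x * ip_norm ip y"
    unfolding n by (rule L2_set_mult_ineq)
  finally show ?thesis .
qed

lemma norm_diff_sq: "ip_norm ip (x - y) ^ 2 = ip_norm ip x ^ 2 + ip_norm ip y ^ 2 - 2 * Re (ip x y)"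
  using conj_sym[of x y] by (simp add: ip_norm_sq diff_left diff_right)

lemma ip_norm_triangle: "ip_norm ip (x + y) \<le> ip_norm ip x + ip_norm ip y"
proof (rule power2_le_imp_le)
  have "ip_norm ip (x + y) ^ 2 = ip_norm ip x ^ 2 + ip_norm ip y ^ 2 + 2 * Re (ip x y)"
    using norm_diff_sq[of x "- y"] by (simp add: minus_right ip_norm_def minus_left)
  also have "Re (ip x y) \<le> ip_norm ip x * ip_norm ip y"
    using Cauchy_Schwarz[of x y] complex_Re_le_cmod[of "ip x y"] by linarith
  finally show "ip_norm ip (x + y) ^ 2 \<le> (ip_norm ip x + ip_norm ip y) ^ 2"
    by (simp add: power2_sum)
qed (simp add: ip_norm_nonneg)

lemma bounded_bilinear_ip: "bounded_bilinear ip"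
proof -
  have "bilinear ip"
    unfolding bilinear_def
    by (auto intro!: linearI simp: add_left add_right scaleR_eq_vector_smult scale_left scale_right
        scaleR_conv_of_real)
  then show ?thesis by (simp add: bilinear_conv_bounded_bilinear)
qed

lemma tendsto_ip: "(f \<longlongrightarrow> a) F \<Longrightarrow> (g \<longlongrightarrow> b) F \<Longrightarrow> ((\<lambda>x. ip (f x) (g x)) \<longlongrightarrow> ip a b) F"
  by (rule bounded_bilinear.tendsto[OF bounded_bilinear_ip])

lemma tendsto_ip_norm: "(f \<longlongrightarrow> a) F \<Longrightarrow> ((\<lambda>x. ip_norm ip (f x)) \<longlongrightarrow> ip_norm ip a) F"
  unfolding ip_norm_def by (intro tendsto_intros tendsto_ip)

lemma ip_norm_equiv:
  obtains c C where "c > 0" "C > 0" "\<And>x. c * norm x \<le> ip_norm ip x" "\<And>x. ip_norm ip x \<le> C * norm x"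
proof -
  have cont: "continuous_on S (ip_norm ip)" for S
    unfolding continuous_on_def by (auto intro!: tendsto_ip_norm)
  have scale: "ip_norm ip (r *\<^sub>R x) = \<bar>r\<bar> * ip_norm ip x" for r x
    using bounded_bilinear.scaleR_left[OF bounded_bilinear_ip] bounded_bilinear.scaleR_right[OF bounded_bilinear_ip]
    by (simp add: ip_norm_def real_sqrt_mult)
  have ne: "sphere (0 :: complex^'m) 1 \<noteq> {}" by simp
  obtain a where a: "a \<in> sphere 0 1" "\<And>x. x \<in> sphere 0 1 \<Longrightarrow> ip_norm ip a \<le> ip_norm ip x"
    using continuous_attains_inf[OF compact_sphere ne cont] by blast
  obtain b where b: "b \<in> sphere 0 1" "\<And>x. x \<in> sphere 0 1 \<Longrightarrow> ip_norm ip x \<le> ip_norm ip b"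
    using continuous_attains_sup[OF compact_sphere ne cont] by blast
  have pos: "0 < ip_norm ip x" if "x \<in> sphere 0 1" for x
    using that ip_norm_nonneg[of x] ip_norm_eq_0[of x] by (cases "x = 0") auto
  have "ip_norm ip a * norm x \<le> ip_norm ip x \<and> ip_norm ip x \<le> ip_norm ip b * norm x" for x
  proof (cases "x = 0")
    case False
    let ?y = "x /\<^sub>R norm x"
    have y: "?y \<in> sphere 0 1" using False by simp
    have "ip_norm ip x = norm x * ip_norm ip ?y" using False by (simp add: scale)
    then show ?thesis using a(2)[OF y] b(2)[OF y] by (simp add: mult.commute mult_left_mono)
  qed (simp add: ip_norm_def)
  then show ?thesis using that[of "ip_norm ip a" "ip_norm ip b"] pos a(1) b(1) by blast
qed

end

section \<open>Invariant averages\<close>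

text \<open>The formal sum of all tensor powers of x, each with coefficient 1; \<open>tip k\<close>
  reads only the part of degree k. Having all degrees in one object allows the same convex
  combination to be used in every degree.\<close>

definition tensor_exp :: "complex^'m \<Rightarrow> 'm tensor" where
  "tensor_exp x = (\<lambda>I. \<Prod>l<length I. x $ (I ! l))"

definition tensor_map :: "complex^'m^'m \<Rightarrow> 'm tensor \<Rightarrow> 'm tensor" where
  "tensor_map A T = (\<lambda>I. tensor_power_map (length I) A T I)"

definition averages :: "(complex^'m) set \<Rightarrow> 'm tensor set" where
  "averages X = {T. \<exists>F a. finite F \<and> F \<subseteq> X \<and> (\<forall>x\<in>F. 0 \<le> a x) \<and> sum a F = 1 \<and>
     T = (\<lambda>I. \<Sum>x\<in>F. complex_of_real (a x) * tensor_exp x I)}"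

lemma tensor_power_map_tensor_exp: "tensor_power_map (length I) A (tensor_exp x) I = tensor_exp (A *v x) I"
proof -
  have "tensor_power_map (length I) A (tensor_exp x) I
      = tensor_power_map (length I) A (pure_tensor (length I) (\<lambda>_. x)) I"
    by (simp add: tensor_power_map_def tensor_exp_def pure_tensor_def)
  then show ?thesis
    unfolding tensor_power_map_pure_tensor by (simp add: pure_tensor_def tensor_exp_def)
qed

lemma tensor_map_sum:
  "tensor_map A (\<lambda>I. \<Sum>x\<in>F. c x * T x I) = (\<lambda>I. \<Sum>x\<in>F. c x * tensor_map A (T x) I)"
proof
  fix I :: "'a list"
  have "(\<Sum>J | length J = length I. w J * (\<Sum>x\<in>F. c x * T x J))
      = (\<Sum>x\<in>F. c x * (\<Sum>J | length J = length I. w J * T x J))" for w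
    unfolding sum_distrib_left by (subst sum.swap) (simp add: mult_ac)
  then show "tensor_map A (\<lambda>I. \<Sum>x\<in>F. c x * T x I) I = (\<Sum>x\<in>F. c x * tensor_map A (T x) I)"
    by (simp add: tensor_map_def tensor_power_map_def)
qed

lemma tensor_map_tensor_exp: "tensor_map A (tensor_exp x) = tensor_exp (A *v x)"
  by (rule ext) (simp add: tensor_map_def tensor_power_map_tensor_exp)

lemma tensor_exp_in_averages: "x \<in> X \<Longrightarrow> tensor_exp x \<in> averages X"
  unfolding averages_def by (intro CollectI exI[of _ "{x}"] exI[of _ "\<lambda>_. 1"]) auto

text \<open>Midpoints are the only convexity that the parallelogram argument uses. The two weight
  functions are extended by 0 to the union of their supports.\<close>

lemma averages_midpoint:
  assumes "S \<in> averages X" "T \<in> averages X"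
  shows "(\<lambda>I. (1 / 2) * (S I + T I)) \<in> averages X"
proof -
  obtain F a where F: "finite F" "F \<subseteq> X" "\<And>x. x \<in> F \<Longrightarrow> 0 \<le> a x" "sum a F = 1"
      "S = (\<lambda>I. \<Sum>x\<in>F. complex_of_real (a x) * tensor_exp x I)"
    using assms(1) by (auto simp: averages_def)
  obtain G b where G: "finite G" "G \<subseteq> X" "\<And>x. x \<in> G \<Longrightarrow> 0 \<le> b x" "sum b G = 1"
      "T = (\<lambda>I. \<Sum>x\<in>G. complex_of_real (b x) * tensor_exp x I)"
    using assms(2) by (auto simp: averages_def)
  define a' where "a' x = (if x \<in> F then a x else 0)" for x
  define b' where "b' x = (if x \<in> G then b x else 0)" for x
  have ext: "(\<Sum>x\<in>F \<union> G. complex_of_real (a' x) * f x) = (\<Sum>x\<in>F. complex_of_real (a x) * f x)"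
    "(\<Sum>x\<in>F \<union> G. complex_of_real (b' x) * f x) = (\<Sum>x\<in>G. complex_of_real (b x) * f x)"
    "sum a' (F \<union> G) = sum a F" "sum b' (F \<union> G) = sum b G" for f
    using F(1) G(1) by (auto intro!: sum.mono_neutral_cong_right simp: a'_def b'_def)
  show ?thesis
    unfolding averages_def
  proof (intro CollectI exI[of _ "F \<union> G"] exI[of _ "\<lambda>x. (a' x + b' x) / 2"] conjI)
    show "(\<Sum>x\<in>F \<union> G. (a' x + b' x) / 2) = 1"
      using F(4) G(4) ext(3,4) by (simp add: sum_divide_distrib[symmetric] sum.distrib)
    show "\<forall>x\<in>F \<union> G. 0 \<le> (a' x + b' x) / 2"
      using F(3) G(3) by (auto simp: a'_def b'_def)
    show "(\<lambda>I. (1 / 2) * (S I + T I))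
        = (\<lambda>I. \<Sum>x\<in>F \<union> G. complex_of_real ((a' x + b' x) / 2) * tensor_exp x I)"
    proof
      fix I
      have "(\<Sum>x\<in>F \<union> G. complex_of_real ((a' x + b' x) / 2) * tensor_exp x I)
          = (\<Sum>x\<in>F \<union> G. (1 / 2) * (complex_of_real (a' x) * tensor_exp x I + complex_of_real (b' x) * tensor_exp x I))"
        by (intro sum.cong refl) (simp add: field_simps)
      also have "\<dots> = (1 / 2) * (S I + T I)"
        unfolding sum_distrib_left[symmetric] sum.distrib ext F(5) G(5) ..
      finally show "(1 / 2) * (S I + T I)
          = (\<Sum>x\<in>F \<union> G. complex_of_real ((a' x + b' x) / 2) * tensor_exp x I)" ..
    qed
  qed (use F G in auto)
qed

text \<open>The left inverse B makes A injective, so the points of the support stay distinct and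
  carry their weights along.\<close>

lemma averages_tensor_map:
  assumes T: "T \<in> averages X" and A: "\<And>x. x \<in> X \<Longrightarrow> A *v x \<in> X" and B: "B ** A = mat 1"
  shows "tensor_map A T \<in> averages X"
proof -
  obtain F a where F: "finite F" "F \<subseteq> X" "\<And>x. x \<in> F \<Longrightarrow> 0 \<le> a x" "sum a F = 1"
      "T = (\<lambda>I. \<Sum>x\<in>F. complex_of_real (a x) * tensor_exp x I)"
    using assms(1) by (auto simp: averages_def)
  have BA: "B *v (A *v x) = x" for x by (simp add: matrix_vector_mul_assoc B)
  have inj: "inj_on ((*v) A) F" by (rule inj_on_inverseI[where g = "(*v) B"]) (rule BA)
  show ?thesis
    unfolding averages_def
  proof (intro CollectI exI[of _ "(*v) A ` F"] exI[of _ "\<lambda>y. a (B *v y)"] conjI)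
    show "tensor_map A T = (\<lambda>I. \<Sum>x\<in>(*v) A ` F. complex_of_real (a (B *v x)) * tensor_exp x I)"
      unfolding F(5) tensor_map_sum sum.reindex[OF inj] by (simp add: BA tensor_map_tensor_exp)
    show "(\<Sum>y\<in>(*v) A ` F. a (B *v y)) = 1"
      unfolding sum.reindex[OF inj] using F(4) by (simp add: BA)
  qed (use F A in \<open>auto simp: BA\<close>)
qed

context hermitian
begin

lemma tip_tensor_exp: "tip k (tensor_exp x) (tensor_exp y) = ip x y ^ k"
proof -
  have "tip k (tensor_exp x) (tensor_exp y) = tip k (pure_tensor k (\<lambda>_. x)) (pure_tensor k (\<lambda>_. y))"
    by (rule tip_cong) (simp_all add: tensor_exp_def pure_tensor_def)
  then show ?thesis by (simp add: tensor_ip_pure_tensor[OF herm])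
qed

lemma tip_parallelogram:
  "Re (tip k (\<lambda>I. S I - T I) (\<lambda>I. S I - T I)) = 2 * Re (tip k S S) + 2 * Re (tip k T T)
     - 4 * Re (tip k (\<lambda>I. (1 / 2) * (S I + T I)) (\<lambda>I. (1 / 2) * (S I + T I)))"
proof -
  have "tip k (\<lambda>I. (1 / 2) * (S I + T I)) (\<lambda>I. (1 / 2) * (S I + T I))
      = (1 / 4) * tip k (\<lambda>I. S I + T I) (\<lambda>I. S I + T I)"
    by (subst tip_scale_right, subst tip_conj_sym, subst tip_scale_right) (simp add: tip_conj_sym[symmetric])
  then have "4 * Re (tip k (\<lambda>I. (1 / 2) * (S I + T I)) (\<lambda>I. (1 / 2) * (S I + T I)))
      = Re (tip k (\<lambda>I. S I + T I) (\<lambda>I. S I + T I))" by (simp only:) simp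
  then show ?thesis
    by (simp only: tip_add_left tip_add_right tip_diff_left tip_diff_right) simp
qed

text \<open>Squared norm of a weighted direct sum of the tensor powers of degree at most M. The
  weights will be the coefficients of the kernel, \<open>c k * (z / m ^ 2) ^ k\<close>.\<close>

definition weighted_norm_sq :: "nat \<Rightarrow> (nat \<Rightarrow> real) \<Rightarrow> 'm tensor \<Rightarrow> real" where
  "weighted_norm_sq M c T = (\<Sum>k\<le>M. c k * Re (tip k T T))"

lemma weighted_norm_sq_nonneg: "(\<And>k. k \<le> M \<Longrightarrow> 0 < c k) \<Longrightarrow> 0 \<le> weighted_norm_sq M c T"
  unfolding weighted_norm_sq_def by (intro sum_nonneg mult_nonneg_nonneg tip_nonneg) (auto simp: less_imp_le)

lemma weighted_parallelogram:
  "weighted_norm_sq M c (\<lambda>I. S I - T I) = 2 * weighted_norm_sq M c S + 2 * weighted_norm_sq M c T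
     - 4 * weighted_norm_sq M c (\<lambda>I. (1 / 2) * (S I + T I))"
  unfolding weighted_norm_sq_def tip_parallelogram
  by (simp add: sum_distrib_left sum.distrib sum_subtractf algebra_simps)

lemma weighted_norm_sq_coordinate:
  assumes c: "\<And>k. k \<le> M \<Longrightarrow> 0 < c k" and J: "length J \<le> M"
  obtains C where "\<And>T. norm (T J) ^ 2 \<le> C * weighted_norm_sq M c T"
proof -
  obtain C where C: "C > 0" "\<And>T. norm (T J) \<le> C * ip_norm (tip (length J)) T"
    using tip_coordinate_bound by blast
  have "norm (T J) ^ 2 \<le> (C ^ 2 / c (length J)) * weighted_norm_sq M c T" for T
  proof -
    have "norm (T J) ^ 2 \<le> (C * ip_norm (tip (length J)) T) ^ 2"
      by (intro power_mono C) simp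
    also have "\<dots> = (C ^ 2 / c (length J)) * (c (length J) * Re (tip (length J) T T))"
      using c[OF J] by (simp add: power_mult_distrib tip_norm_sq)
    also have "\<dots> \<le> (C ^ 2 / c (length J)) * weighted_norm_sq M c T"
      unfolding weighted_norm_sq_def
      using J c by (intro mult_left_mono member_le_sum[where f = "\<lambda>k. c k * Re (tip k T T)"]) (auto intro!: mult_nonneg_nonneg tip_nonneg simp: less_imp_le)
    finally show ?thesis .
  qed
  then show ?thesis using that by blast
qed

lemma weighted_norm_sq_tendsto:
  assumes "\<And>J. length J \<le> M \<Longrightarrow> ((\<lambda>n. T n J) \<longlongrightarrow> P J) F"
  shows "((\<lambda>n. weighted_norm_sq M c (T n)) \<longlongrightarrow> weighted_norm_sq M c P) F"
  unfolding weighted_norm_sq_def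
  by (intro tendsto_sum tendsto_mult_left tendsto_Re tip_tendsto) (auto intro: assms)

lemma weighted_norm_sq_tensor_map:
  assumes "\<And>x y. ip (A *v x) (A *v y) = ip x y"
  shows "weighted_norm_sq M c (tensor_map A T) = weighted_norm_sq M c T"
proof -
  have "tip k (tensor_map A T) (tensor_map A T) = tip k T T" for k
  proof -
    have "tip k (tensor_map A T) (tensor_map A T) = tip k (tensor_power_map k A T) (tensor_power_map k A T)"
      by (rule tip_cong) (simp_all add: tensor_map_def)
    then show ?thesis using tip_tensor_power_map[OF assms] by simp
  qed
  then show ?thesis by (simp add: weighted_norm_sq_def)
qed

text \<open>A point of minimal norm in the closed convex hull of an orbit is invariant; this replaces
  averaging with respect to Haar measure. All degrees up to \<open>M\<close> are treated at once, so that the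
  same averages approximate the projections in all these degrees.\<close>

lemma invariant_average:
  assumes X: "X \<noteq> {}" and c: "\<And>k. k \<le> M \<Longrightarrow> 0 < c k"
    and low: "\<And>T. T \<in> averages X \<Longrightarrow> L \<le> weighted_norm_sq M c T"
    and iso: "\<And>A x y. A \<in> \<A> \<Longrightarrow> ip (A *v x) (A *v y) = ip x y"
    and inv: "\<And>A. A \<in> \<A> \<Longrightarrow> \<exists>B. B ** A = mat 1"
    and stable: "\<And>A x. A \<in> \<A> \<Longrightarrow> x \<in> X \<Longrightarrow> A *v x \<in> X"
  obtains P where "L \<le> weighted_norm_sq M c P"
    "\<And>A J. A \<in> \<A> \<Longrightarrow> length J \<le> M \<Longrightarrow> tensor_map A P J = P J"
    "\<And>k S s. k \<le> M \<Longrightarrow> (\<And>x. x \<in> X \<Longrightarrow> tip k S (tensor_exp x) = s) \<Longrightarrow> tip k S P = s"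
proof -
  let ?q = "weighted_norm_sq M c"
  define \<mu> where "\<mu> = Inf (?q ` averages X)"
  have ne: "averages X \<noteq> {}" using X tensor_exp_in_averages by blast
  have bdd: "bdd_below (?q ` averages X)"
    by (rule bdd_belowI[where m = 0]) (auto intro: weighted_norm_sq_nonneg c)
  have \<mu>: "\<mu> \<le> ?q T" if "T \<in> averages X" for T
    unfolding \<mu>_def using that bdd by (intro cInf_lower) auto
  have "\<exists>T\<in>averages X. ?q T < \<mu> + 1 / (1 + real n)" for n
  proof -
    have "\<mu> < \<mu> + 1 / (1 + real n)" by (simp add: add_nonneg_pos)
    then show ?thesis unfolding \<mu>_def using cInf_lessD[of "?q ` averages X"] ne by blast
  qed
  then obtain T where T: "\<And>n. T n \<in> averages X" "\<And>n. ?q (T n) < \<mu> + 1 / (1 + real n)"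
    by metis
  define r where "r n = 1 / (1 + real n)" for n
  have r0: "r \<longlonglongrightarrow> 0" and rpos: "r n \<ge> 0" for n
    unfolding r_def using lim_1_over_n[THEN LIMSEQ_Suc] by (auto simp: add_ac)
  \<comment> \<open>The midpoint is again an average, so its squared norm is at least \<mu>; the
    parallelogram identity then forces near-minimizers to be close to each other.\<close>
  have close: "?q (\<lambda>I. S I - S' I) \<le> 2 * r n + 2 * r m"
    if "S \<in> averages X" "S' \<in> averages X" "?q S < \<mu> + r n" "?q S' < \<mu> + r m" for S S' n m
    using that \<mu>[OF averages_midpoint[OF that(1,2)]] unfolding weighted_parallelogram by linarith
  have conv: "convergent (\<lambda>n. T n J)" if J: "length J \<le> M" for J
  proof -
    obtain C where C: "\<And>T. norm (T J) ^ 2 \<le> C * ?q T"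
      using weighted_norm_sq_coordinate[where c = c and M = M, OF c J] by blast
    have bound: "norm (T m J - T n J) ^ 2 \<le> \<bar>C\<bar> * (2 * r m + 2 * r n)" for m n
    proof -
      have "norm (T m J - T n J) ^ 2 \<le> C * ?q (\<lambda>I. T m I - T n I)"
        using C[of "\<lambda>I. T m I - T n I"] by simp
      also have "\<dots> \<le> \<bar>C\<bar> * ?q (\<lambda>I. T m I - T n I)"
        by (intro mult_right_mono weighted_norm_sq_nonneg c) auto
      also have "\<dots> \<le> \<bar>C\<bar> * (2 * r m + 2 * r n)"
        using close[OF T(1) T(1), of m m n n] T(2) by (intro mult_left_mono) (auto simp: r_def)
      finally show ?thesis .
    qed
    have "Cauchy (\<lambda>n. T n J)"
    proof (rule metric_CauchyI)
      fix e :: real assume e: "e > 0"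
      have "(\<lambda>n. \<bar>C\<bar> * (4 * r n)) \<longlonglongrightarrow> \<bar>C\<bar> * (4 * 0)" by (intro tendsto_intros r0)
      then have "(\<lambda>n. \<bar>C\<bar> * (4 * r n)) \<longlonglongrightarrow> 0" by simp
      from LIMSEQ_D[OF this, of "e^2"] e
      obtain N where N: "\<And>n. n \<ge> N \<Longrightarrow> \<bar>C\<bar> * (4 * r n) < e^2" by (auto simp: abs_mult rpos)
      show "\<exists>N. \<forall>m\<ge>N. \<forall>n\<ge>N. dist (T m J) (T n J) < e"
      proof (intro exI[of _ N] allI impI)
        fix m n assume "N \<le> m" "N \<le> n"
        then have "\<bar>C\<bar> * (4 * r m) < e^2" "\<bar>C\<bar> * (4 * r n) < e^2" using N by auto
        then have "norm (T m J - T n J) ^ 2 < e ^ 2"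
          using bound[of m n] by (simp add: algebra_simps)
        then show "dist (T m J) (T n J) < e"
          using e by (simp add: dist_norm power_less_imp_less_base)
      qed
    qed
    then show ?thesis by (simp add: Cauchy_convergent_iff)
  qed
  define P where "P J = lim (\<lambda>n. T n J)" for J
  have lim: "(\<lambda>n. T n J) \<longlonglongrightarrow> P J" if "length J \<le> M" for J
    using conv[OF that] by (simp add: P_def convergent_LIMSEQ_iff)
  show ?thesis
  proof (rule that)
    show "L \<le> ?q P"
      by (rule LIMSEQ_le_const[OF weighted_norm_sq_tendsto[OF lim]]) (auto intro: low T)
  next
    fix A and J :: "'m list" assume A: "A \<in> \<A>" and J: "length J \<le> M"
    obtain B where B: "B ** A = mat 1" using inv[OF A] by blast
    \<comment> \<open>Being an isometry, A keeps \<open>T n\<close> as near to the minimum as it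
      was; so \<open>close\<close> applies to \<open>T n\<close> and its image, and the limit is
      fixed by A.\<close>
    have AT: "tensor_map A (T n) \<in> averages X" for n
      by (rule averages_tensor_map[OF T(1) stable[OF A] B])
    obtain C where C: "\<And>T. norm (T J) ^ 2 \<le> C * ?q T"
      using weighted_norm_sq_coordinate[where c = c and M = M, OF c J] by blast
    have bound: "norm (tensor_map A (T n) J - T n J) ^ 2 \<le> \<bar>C\<bar> * (4 * r n)" for n
    proof -
      let ?D = "\<lambda>I. tensor_map A (T n) I - T n I"
      have "norm (?D J) ^ 2 \<le> C * ?q ?D" by (rule C)
      also have "\<dots> \<le> \<bar>C\<bar> * ?q ?D"
        by (intro mult_right_mono weighted_norm_sq_nonneg c) auto
      also have "\<dots> \<le> \<bar>C\<bar> * (4 * r n)"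
        using close[OF AT T(1), of n n n n] T(2)[of n] iso[OF A]
        by (intro mult_left_mono) (auto simp: r_def weighted_norm_sq_tensor_map)
      finally show ?thesis .
    qed
    have "(\<lambda>n. norm (tensor_map A (T n) J - T n J) ^ 2) \<longlonglongrightarrow> 0"
    proof (rule tendsto_sandwich[OF _ always_eventually[OF allI[OF bound]] tendsto_const])
      have "(\<lambda>n. \<bar>C\<bar> * (4 * r n)) \<longlonglongrightarrow> \<bar>C\<bar> * (4 * 0)" by (intro tendsto_intros r0)
      then show "(\<lambda>n. \<bar>C\<bar> * (4 * r n)) \<longlonglongrightarrow> 0" by simp
    qed simp
    moreover have "(\<lambda>n. norm (tensor_map A (T n) J - T n J) ^ 2) \<longlonglongrightarrow> norm (tensor_map A P J - P J) ^ 2"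
    proof (intro tendsto_intros lim J)
      show "(\<lambda>n. tensor_map A (T n) J) \<longlonglongrightarrow> tensor_map A P J"
        unfolding tensor_map_def tensor_power_map_def using J lim by (auto intro!: tendsto_intros)
    qed
    ultimately have "norm (tensor_map A P J - P J) ^ 2 = 0" using LIMSEQ_unique by blast
    then show "tensor_map A P J = P J" by simp
  next
    fix k S s assume k: "k \<le> M" and s: "\<And>x. x \<in> X \<Longrightarrow> tip k S (tensor_exp x) = s"
    have "tip k S (T n) = s" for n
    proof -
      obtain F a where F: "F \<subseteq> X" "sum a F = 1"
          "T n = (\<lambda>I. \<Sum>x\<in>F. complex_of_real (a x) * tensor_exp x I)"
        using T(1)[of n] by (auto simp: averages_def)
      have "tip k S (T n) = (\<Sum>x\<in>F. complex_of_real (a x) * tip k S (tensor_exp x))"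
        unfolding F(3) by (rule tip_sum_right)
      also have "\<dots> = (\<Sum>x\<in>F. complex_of_real (a x) * s)"
        using F(1) s by (intro sum.cong refl) auto
      also have "\<dots> = s" using F(2) by (simp add: sum_distrib_right[symmetric] flip: of_real_sum)
      finally show ?thesis .
    qed
    moreover have "(\<lambda>n. tip k S (T n)) \<longlonglongrightarrow> tip k S P"
      using k by (intro tip_tendsto tendsto_const lim) simp
    ultimately show "tip k S P = s" by (simp add: LIMSEQ_const_iff)
  qed
qed

end

section \<open>Lower bounds for averages\<close>

text \<open>The binomial coefficients of a negative power. Multiplying by the geometric series
  replaces coefficients by their partial sums, which preserves positivity.\<close>

lemma power_kernel_coefficients:
  "\<exists>c. (\<forall>k. 0 < c k) \<and>
     (\<forall>y :: complex. norm y < 1 \<longrightarrow> (\<lambda>k. complex_of_real (c k) * y ^ k) sums (1 / (1 - y)) ^ Suc N)"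
proof (induction N)
  case 0
  show ?case
    by (rule exI[of _ "\<lambda>_. 1"]) (auto intro: geometric_sums)
next
  case (Suc N)
  then obtain c where c: "\<And>k. 0 < c k"
      "\<And>y :: complex. norm y < 1 \<Longrightarrow> (\<lambda>k. complex_of_real (c k) * y ^ k) sums (1 / (1 - y)) ^ Suc N" by blast
  let ?d = "\<lambda>k. \<Sum>i\<le>k. c i"
  have "(\<lambda>k. complex_of_real (?d k) * y ^ k) sums (1 / (1 - y)) ^ Suc (Suc N)" if y: "norm y < 1" for y
  proof -
    have "(\<lambda>k. complex_of_real (c k) * of_real (norm y) ^ k) sums (1 / (1 - of_real (norm y))) ^ Suc N"
      using c(2)[of "of_real (norm y)"] y by simp
    then have "summable (\<lambda>k. complex_of_real (c k * norm y ^ k))" by (simp add: sums_iff)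
    then have s1: "summable (\<lambda>k. norm (complex_of_real (c k) * y ^ k))"
      using c(1) by (simp only: summable_of_real_iff norm_mult norm_power norm_of_real abs_of_pos)
    have s2: "summable (\<lambda>k. norm (y ^ k))"
      using y by (simp add: norm_power summable_geometric)
    have "(\<lambda>k. \<Sum>i\<le>k. (complex_of_real (c i) * y ^ i) * y ^ (k - i)) sums
        ((\<Sum>k. complex_of_real (c k) * y ^ k) * (\<Sum>k. y ^ k))"
      by (rule Cauchy_product_sums[OF s1 s2])
    moreover have "(\<Sum>i\<le>k. (complex_of_real (c i) * y ^ i) * y ^ (k - i)) = complex_of_real (?d k) * y ^ k" for k
      by (simp add: sum_distrib_right mult.assoc flip: power_add)
    ultimately show ?thesis
      using sums_unique[OF c(2)[OF y]] suminf_geometric[OF y] by (simp add: mult.commute)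
  qed
  moreover have "0 < ?d k" for k using c(1) by (intro sum_pos) auto
  ultimately show ?case by (intro exI[of _ ?d]) blast
qed

text \<open>The cells are cubes of side proportional to u in the real and imaginary parts of the
  coordinates. The number of real coordinates is twice \<open>CARD('m)\<close>, hence a power of 1 /
  u^2; it is used with u^2 = 1 - z.\<close>

lemma grid_cells:
  fixes R \<kappa> :: real
  assumes "R > 0" "\<kappa> > 0"
  shows "\<exists>E>0. \<forall>u. 0 < u \<and> u \<le> 1 \<longrightarrow> (\<exists>(cell :: complex^'m \<Rightarrow> 'm \<Rightarrow> int \<times> int) W. finite W \<and>
      real (card W) \<le> E * (1 / u ^ 2) ^ CARD('m) \<and> (\<forall>x. norm x \<le> R \<longrightarrow> cell x \<in> W) \<and>
      (\<forall>x y. cell x = cell y \<longrightarrow> norm (x - y) \<le> \<kappa> * u))"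
proof -
  define n where "n = CARD('m)"
  \<comment> \<open>Points of one cell of side h differ by at most 2 h in each complex coordinate,
    so by at most 2 n h in norm; this choice makes that \<kappa> u.\<close>
  define a where "a = \<kappa> / (2 * real n)"
  have n: "n > 0" by (simp add: n_def)
  have a: "a > 0" using assms n by (simp add: a_def)
  \<comment> \<open>Each real coordinate uses 2 L + 2 intervals, at most 2 R / h + 5; as u is at
    most 1, the 5 is absorbed into 5 / u.\<close>
  define E where "E = ((2 * R / a + 5) ^ 2) ^ n"
  show ?thesis
  proof (intro exI[of _ E] conjI allI impI)
    show "0 < E" using assms a unfolding E_def by (intro zero_less_power add_nonneg_pos) auto
    fix u :: real assume u: "0 < u \<and> u \<le> 1"
    define h where "h = a * u"
    have h: "h > 0" using u a by (simp add: h_def)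
    define L where "L = \<lceil>R / h\<rceil>"
    define cell where "cell x i = (\<lfloor>Re (x $ i) / h\<rfloor>, \<lfloor>Im (x $ i) / h\<rfloor>)" for x :: "complex^'m" and i
    define Q where "Q = {- L - 1 .. L} \<times> {- L - 1 .. L}"
    define W where "W = (\<Pi>\<^sub>E i\<in>(UNIV :: 'm set). Q)"
    have "0 < R / h" using assms h by simp
    then have L: "L \<ge> 0" unfolding L_def by linarith
    have finW: "finite W" unfolding W_def Q_def by (intro finite_PiE) auto
    have cardW: "real (card W) \<le> E * (1 / u ^ 2) ^ n"
    proof -
      have "card Q = nat (2 * L + 2) ^ 2"
        using L by (simp add: Q_def card_cartesian_product power2_eq_square add.commute)
      then have "card W = (nat (2 * L + 2) ^ 2) ^ n"
        unfolding W_def by (simp add: card_PiE n_def)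
      then have "real (card W) = (real_of_int (2 * L + 2) ^ 2) ^ n" using L by simp
      also have "\<dots> \<le> (((2 * R / a + 5) / u) ^ 2) ^ n"
      proof (intro power_mono)
        have "real_of_int L \<le> R / h + 1" unfolding L_def by linarith
        then have "real_of_int (2 * L + 2) \<le> 2 * (R / h) + 5" by simp
        also have "\<dots> = 2 * R / a / u + 5" by (simp add: h_def)
        also have "\<dots> \<le> (2 * R / a + 5) / u" using u by (simp add: field_simps)
        finally show "real_of_int (2 * L + 2) \<le> (2 * R / a + 5) / u" .
      qed (use L in auto)
      also have "\<dots> = E * (1 / u ^ 2) ^ n"
        by (simp add: E_def power_divide)
      finally show ?thesis .
    qed
    have cellW: "cell x \<in> W" if "norm x \<le> R" for x
    proof -
      have "\<bar>Re (x $ i)\<bar> \<le> R" "\<bar>Im (x $ i)\<bar> \<le> R" for i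
        using that Finite_Cartesian_Product.norm_nth_le[of x i] abs_Re_le_cmod[of "x $ i"] abs_Im_le_cmod[of "x $ i"]
        by linarith+
      moreover have "\<lfloor>t / h\<rfloor> \<in> {- L - 1 .. L}" if "\<bar>t\<bar> \<le> R" for t
      proof -
        have "t / h \<le> R / h" "- (R / h) \<le> t / h"
          using that h divide_right_mono[of "- R" t h] by (simp_all add: divide_right_mono abs_le_iff)
        then show ?thesis unfolding L_def by simp linarith
      qed
      ultimately show ?thesis by (auto simp: W_def Q_def cell_def simp del: atLeastAtMost_iff)
    qed
    have cell_close: "norm (x - y) \<le> \<kappa> * u" if "cell x = cell y" for x y
    proof -
      have near: "\<bar>s - t\<bar> \<le> h" if "\<lfloor>s / h\<rfloor> = \<lfloor>t / h\<rfloor>" for s t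
      proof -
        have "\<bar>s / h - t / h\<bar> \<le> 1" using that by linarith
        then show ?thesis using h by (simp add: diff_divide_distrib[symmetric] field_simps)
      qed
      have "norm ((x - y) $ i) \<le> h + h" for i
      proof -
        have "cell x i = cell y i" using that by simp
        then have "\<bar>Re ((x - y) $ i)\<bar> \<le> h" "\<bar>Im ((x - y) $ i)\<bar> \<le> h"
          using near by (auto simp: cell_def)
        then show ?thesis using cmod_le[of "(x - y) $ i"] by linarith
      qed
      then have "(\<Sum>i\<in>UNIV. norm ((x - y) $ i)) \<le> (\<Sum>i\<in>(UNIV :: 'm set). h + h)" by (intro sum_mono)
      then have "norm (x - y) \<le> real n * (h + h)"
        using norm_vec_le_sum[of "x - y"] by (simp add: n_def)
      also have "\<dots> = \<kappa> * u" using n by (simp add: h_def a_def field_simps)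
      finally show ?thesis .
    qed
    show "\<exists>(cell :: complex^'m \<Rightarrow> 'm \<Rightarrow> int \<times> int) W. finite W \<and>
      real (card W) \<le> E * (1 / u ^ 2) ^ CARD('m) \<and> (\<forall>x. norm x \<le> R \<longrightarrow> cell x \<in> W) \<and>
      (\<forall>x y. cell x = cell y \<longrightarrow> norm (x - y) \<le> \<kappa> * u)"
      using finW cardW cellW cell_close unfolding n_def by blast
  qed
qed

text \<open>The masses of the cells add up to 1, and the sum of their squares is the weight of the
  pairs in a common cell; Cauchy-Schwarz compares the two.\<close>

lemma same_cell_weight:
  fixes a :: "'a \<Rightarrow> real"
  assumes F: "finite F" "sum a F = 1" and W: "finite W" "cell ` F \<subseteq> W"
  shows "1 \<le> real (card W) * (\<Sum>x\<in>F. \<Sum>y\<in>F. if cell x = cell y then a x * a y else 0)"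
proof -
  define s where "s w = (\<Sum>x | x \<in> F \<and> cell x = w. a x)" for w
  have "sum s W = 1" unfolding s_def using sum.group[OF F(1) W, of a] F(2) by simp
  moreover have "(sum s W)^2 \<le> (\<Sum>w\<in>W. (s w)^2) * real (card W)"
    by (rule sum_squared_le_sum_of_squares)
  moreover have "(\<Sum>w\<in>W. (s w)^2) = (\<Sum>x\<in>F. \<Sum>y\<in>F. if cell x = cell y then a x * a y else 0)"
  proof -
    have "(\<Sum>x\<in>F. \<Sum>y\<in>F. if cell x = cell y then a x * a y else 0) = (\<Sum>x\<in>F. a x * s (cell x))"
    proof (intro sum.cong refl)
      fix x
      have "(\<Sum>y\<in>F. if cell x = cell y then a x * a y else 0) = (\<Sum>y | y \<in> F \<and> cell y = cell x. a x * a y)"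
        using F(1) by (intro sum.mono_neutral_cong_right) auto
      then show "(\<Sum>y\<in>F. if cell x = cell y then a x * a y else 0) = a x * s (cell x)"
        by (simp add: s_def sum_distrib_left)
    qed
    also have "\<dots> = (\<Sum>w\<in>W. \<Sum>x | x \<in> F \<and> cell x = w. a x * s (cell x))"
      using sum.group[OF F(1) W, of "\<lambda>x. a x * s (cell x)"] by simp
    also have "\<dots> = (\<Sum>w\<in>W. (s w)^2)"
    proof (intro sum.cong refl)
      fix w
      have "(\<Sum>x | x \<in> F \<and> cell x = w. a x * s (cell x)) = (\<Sum>x | x \<in> F \<and> cell x = w. a x * s w)"
        by (intro sum.cong) auto
      then show "(\<Sum>x | x \<in> F \<and> cell x = w. a x * s (cell x)) = (s w)^2"
        by (simp add: s_def[of w] sum_distrib_right[symmetric] power2_eq_square)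
    qed
    finally show ?thesis by simp
  qed
  ultimately show ?thesis by (simp add: mult.commute)
qed

lemma Re_power_near_one:
  obtains e where "0 < e" "\<And>t. \<bar>t\<bar> \<le> e \<Longrightarrow> 1 / 2 \<le> Re ((1 / (1 + \<i> * complex_of_real t)) ^ N)"
proof -
  let ?f = "\<lambda>t. Re ((1 / (1 + \<i> * complex_of_real t)) ^ N)"
  have "((\<lambda>t. Re ((1 / (1 + \<i> * complex_of_real t)) ^ N)) \<longlongrightarrow> ?f 0) (at 0)"
    by (intro tendsto_intros) simp
  then have "\<forall>\<^sub>F t in at 0. 1 / 2 < ?f t" by (rule order_tendstoD) simp
  then obtain d where d: "d > 0" "\<And>t. t \<noteq> 0 \<Longrightarrow> \<bar>t\<bar> < d \<Longrightarrow> 1 / 2 < ?f t"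
    by (auto simp: eventually_at dist_real_def)
  show ?thesis
  proof (rule that[of "d / 2"])
    fix t assume "\<bar>t\<bar> \<le> d / 2"
    then show "1 / 2 \<le> ?f t" using d(1) d(2)[of t] by (cases "t = 0") (auto intro: less_imp_le)
  qed (use d in simp)
qed

text \<open>For \<open>\<zeta>\<close> in a thin cone with vertex \<open>1\<close>, the argument of \<open>1 - z * \<zeta>\<close> is small enough for the
  real part of its \<open>-N\<close>-th power to stay positive.\<close>

lemma kernel_pointwise:
  fixes \<zeta> :: complex
  assumes e0: "0 < e" and e: "\<And>t. \<bar>t\<bar> \<le> e \<Longrightarrow> 1 / 2 \<le> Re ((1 / (1 + \<i> * complex_of_real t)) ^ N)"
    and z: "1 / 2 \<le> z" "z < 1" and d: "0 < d" "1 - z < d" and le1: "Re \<zeta> \<le> 1"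
    and cone: "1 - Re \<zeta> < d \<Longrightarrow> \<bar>Im \<zeta>\<bar> \<le> e * (1 - Re \<zeta>)"
  shows "(if 1 - Re \<zeta> \<le> 1 - z then (1 / 2) * (1 / (2 * (1 - z))) ^ N else 0) - (2 / d) ^ N
      \<le> Re ((1 / (1 - of_real z * \<zeta>)) ^ N)"
proof -
  define \<tau> where "\<tau> = 1 - Re \<zeta>"
  define \<eta> where "\<eta> = 1 - of_real z * \<zeta>"
  define r where "r = Re \<eta>"
  have r: "r = (1 - z) + z * \<tau>" by (simp add: r_def \<eta>_def \<tau>_def algebra_simps)
  have \<tau>: "\<tau> \<ge> 0" using le1 by (simp add: \<tau>_def)
  have rpos: "r > 0" using z \<tau> by (simp add: r add_pos_nonneg)
  have dN: "0 \<le> (2 / d) ^ N" using d by simp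
  show ?thesis
  proof (cases "\<tau> < d")
    case True
    \<comment> \<open>\<eta> is r times 1 + \<i> t. Since r dominates z \<tau>, the cone condition
      bounds the absolute value of t by e.\<close>
    define t where "t = Im \<eta> / r"
    have "\<bar>Im \<eta>\<bar> = z * \<bar>Im \<zeta>\<bar>" using z by (simp add: \<eta>_def abs_mult)
    also have "\<dots> \<le> z * (e * \<tau>)" using cone True z by (intro mult_left_mono) (auto simp: \<tau>_def)
    finally have 1: "\<bar>Im \<eta>\<bar> \<le> e * (z * \<tau>)" by (simp add: mult_ac)
    have "e * (z * \<tau>) \<le> e * r" using e0 z by (intro mult_left_mono) (auto simp: r)
    then have t: "\<bar>t\<bar> \<le> e" using 1 rpos by (simp add: t_def field_simps)
    have half: "1 / 2 \<le> Re ((1 / (1 + \<i> * complex_of_real t)) ^ N)"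
      by (rule e[OF t])
    have "\<eta> = of_real r * (1 + \<i> * of_real t)"
      using rpos by (simp add: complex_eq_iff t_def r_def)
    then have "(1 / \<eta>) ^ N = of_real ((1 / r) ^ N) * (1 / (1 + \<i> * of_real t)) ^ N"
      by (simp add: power_mult_distrib power_divide)
    then have eq: "Re ((1 / \<eta>) ^ N) = (1 / r) ^ N * Re ((1 / (1 + \<i> * of_real t)) ^ N)"
      by simp
    have ge: "(1 / r) ^ N * (1 / 2) \<le> Re ((1 / \<eta>) ^ N)"
      unfolding eq using rpos half by (intro mult_left_mono) auto
    have "(if \<tau> \<le> 1 - z then (1 / 2) * (1 / (2 * (1 - z))) ^ N else 0) \<le> (1 / r) ^ N * (1 / 2)"
    proof (cases "\<tau> \<le> 1 - z")
      case True
      have "z * \<tau> \<le> 1 * (1 - z)" using True z \<tau> by (intro mult_mono) auto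
      then have "r \<le> 2 * (1 - z)" by (simp add: r)
      then have "(1 / (2 * (1 - z))) ^ N \<le> (1 / r) ^ N"
        using rpos z by (intro power_mono divide_left_mono) auto
      then show ?thesis using True by simp
    qed (use rpos in simp)
    then show ?thesis using ge dN by (simp add: \<tau>_def \<eta>_def)
  next
    case False
    \<comment> \<open>Away from the vertex the modulus of \<eta> is at least d / 2, and the crude
      bound by the modulus suffices.\<close>
    have "d / 2 \<le> z * \<tau>" using False z d mult_mono[of "1 / 2" z d \<tau>] by simp
    then have "d / 2 \<le> r" using z by (simp add: r)
    also have "r \<le> norm \<eta>" unfolding r_def by (rule complex_Re_le_cmod)
    finally have dn: "d / 2 \<le> norm \<eta>" .
    then have "0 < norm \<eta>" using d by linarith
    with dn d have "norm (1 / \<eta>) \<le> 2 / d" by (simp add: norm_divide field_simps del: zero_less_norm_iff)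
    then have "norm ((1 / \<eta>) ^ N) \<le> (2 / d) ^ N"
      unfolding norm_power by (intro power_mono) auto
    then have "- ((2 / d) ^ N) \<le> Re ((1 / \<eta>) ^ N)"
      using abs_Re_le_cmod[of "(1 / \<eta>) ^ N"] by linarith
    then show ?thesis using False d by (simp add: \<tau>_def \<eta>_def)
  qed
qed

lemma Re_complex_of_real_mult: "Re (complex_of_real r * w) = r * Re w"
  by simp

context hermitian
begin

text \<open>Let s = 1 - z. Pairs in a common cell contribute at least a constant times s^-(n+1),
  their total weight is at least a constant times s^n, and the negative contributions cost at most
  the constant \<open>D\<close>. The one surplus power of 1 / s lifts the average above any
  B.\<close>

lemma kernel_lower_bound:
  assumes m: "m > 0" and X: "\<And>x. x \<in> X \<Longrightarrow> ip_norm ip x = m"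
    and phase: "\<And>e. 0 < e \<Longrightarrow> \<exists>d>0. \<forall>x\<in>X. \<forall>y\<in>X. ip_norm ip (x - y) < d \<longrightarrow> \<bar>Im (ip x y)\<bar> \<le> e * ip_norm ip (x - y) ^ 2"
  shows "\<exists>z. 0 < z \<and> z < 1 \<and> (\<forall>F a. finite F \<and> F \<subseteq> X \<and> (\<forall>x\<in>F. 0 \<le> a x) \<and> sum a F = 1 \<longrightarrow>
     B \<le> (\<Sum>x\<in>F. \<Sum>y\<in>F. a x * a y * Re ((1 / (1 - of_real z * (ip x y / of_real (m ^ 2)))) ^ Suc CARD('m))))"
proof -
  define n where "n = CARD('m)"
  obtain e where e: "0 < e" "\<And>t. \<bar>t\<bar> \<le> e \<Longrightarrow> 1 / 2 \<le> Re ((1 / (1 + \<i> * complex_of_real t)) ^ Suc n)"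
    using Re_power_near_one by blast
  \<comment> \<open>The squared distance of x and y is 2 m^2 \<tau> with \<tau> = 1 - Re \<zeta>.
    After division by m^2 the factor e / 2 therefore becomes e, and distance below \<open>d0\<close>
    becomes \<tau> < d.\<close>
  obtain d0 where d0: "d0 > 0" "\<And>x y. x \<in> X \<Longrightarrow> y \<in> X \<Longrightarrow> ip_norm ip (x - y) < d0 \<Longrightarrow>
      \<bar>Im (ip x y)\<bar> \<le> (e / 2) * ip_norm ip (x - y) ^ 2"
    using phase[of "e / 2"] e(1) by auto
  define d where "d = d0 ^ 2 / (2 * m ^ 2)"
  have d: "d > 0" using d0 m by (simp add: d_def)
  obtain c C where cC: "c > 0" "C > 0" "\<And>x. c * norm x \<le> ip_norm ip x" "\<And>x. ip_norm ip x \<le> C * norm x"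
    using ip_norm_equiv by blast
  \<comment> \<open>The radius m / c captures every vector of norm m. With u = sqrt s, points of one
    cell have squared distance at most m^2 s in the given norm, hence \<tau> is at most 1 -
    z.\<close>
  obtain E where E: "E > 0" "\<And>u. 0 < u \<Longrightarrow> u \<le> 1 \<Longrightarrow> \<exists>(cell :: complex^'m \<Rightarrow> 'm \<Rightarrow> int \<times> int) W. finite W \<and>
      real (card W) \<le> E * (1 / u ^ 2) ^ CARD('m) \<and> (\<forall>x. norm x \<le> m / c \<longrightarrow> cell x \<in> W) \<and>
      (\<forall>x y. cell x = cell y \<longrightarrow> norm (x - y) \<le> (m / C) * u)"
    using grid_cells[where 'm = 'm, of "m / c" "m / C"] m cC by auto
  \<comment> \<open>Chosen so that K / s is the kernel bound \<open>A\<close> divided by the bound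
    \<open>E * (1 / s) ^ n\<close> for the number of cells.\<close>
  define K where "K = (1 / 2) * (1 / 2) ^ Suc n / E"
  have K: "K > 0" using E by (simp add: K_def)
  define D where "D = (2 / d) ^ Suc n"
  have D: "D > 0" using d by (simp add: D_def)
  define s where "s = min (1 / 2) (min (d / 2) (K / (\<bar>B\<bar> + D)))"
  have "s \<le> d / 2" unfolding s_def by (rule min.coboundedI2, rule min.cobounded1)
  moreover have "s \<le> K / (\<bar>B\<bar> + D)" unfolding s_def by (rule min.coboundedI2, rule min.cobounded2)
  moreover have "s \<le> 1 / 2" unfolding s_def by (rule min.cobounded1)
  moreover have "0 < s" unfolding s_def using d K D by (simp add: add_nonneg_pos)
  ultimately have s: "0 < s" "s \<le> 1 / 2" "s < d" "s \<le> K / (\<bar>B\<bar> + D)" using d by auto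
  define z where "z = 1 - s"
  have z: "1 / 2 \<le> z" "z < 1" "1 - z < d" using s by (auto simp: z_def)
  obtain cell :: "complex^'m \<Rightarrow> 'm \<Rightarrow> int \<times> int" and W where cell: "finite W"
      "real (card W) \<le> E * (1 / sqrt s ^ 2) ^ CARD('m)" "\<And>x. norm x \<le> m / c \<Longrightarrow> cell x \<in> W"
      "\<And>x y. cell x = cell y \<Longrightarrow> norm (x - y) \<le> (m / C) * sqrt s"
    using E(2)[of "sqrt s"] s by auto
  let ?\<zeta> = "\<lambda>x y. ip x y / of_real (m ^ 2)"
  let ?k = "\<lambda>x y. Re ((1 / (1 - of_real z * ?\<zeta> x y)) ^ Suc n)"
  define A where "A = (1 / 2) * (1 / (2 * s)) ^ Suc n"
  have A: "A > 0" using s by (simp add: A_def)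
  have point: "(if cell x = cell y then A else 0) - D \<le> ?k x y" if xy: "x \<in> X" "y \<in> X" for x y
  proof -
    have \<tau>: "1 - Re (?\<zeta> x y) = ip_norm ip (x - y) ^ 2 / (2 * m ^ 2)"
      using m X[OF xy(1)] X[OF xy(2)] by (simp add: norm_diff_sq field_simps flip: of_real_power)
    have "(if 1 - Re (?\<zeta> x y) \<le> 1 - z then (1 / 2) * (1 / (2 * (1 - z))) ^ Suc n else 0) - (2 / d) ^ Suc n \<le> ?k x y"
    proof (rule kernel_pointwise[OF e(1,2) z(1,2) d z(3)])
      have "0 \<le> 1 - Re (?\<zeta> x y)" unfolding \<tau> by simp
      then show "Re (?\<zeta> x y) \<le> 1" by simp
      assume "1 - Re (?\<zeta> x y) < d"
      then have "ip_norm ip (x - y) ^ 2 < d0 ^ 2" using m unfolding \<tau> d_def by (simp add: divide_strict_right_mono field_simps)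
      then have "ip_norm ip (x - y) < d0" using d0(1) by (simp add: power_less_imp_less_base)
      then have "\<bar>Im (ip x y)\<bar> \<le> (e / 2) * ip_norm ip (x - y) ^ 2" by (rule d0(2)[OF xy])
      then have "\<bar>Im (ip x y)\<bar> / m ^ 2 \<le> (e / 2) * ip_norm ip (x - y) ^ 2 / m ^ 2"
        using m by (intro divide_right_mono) auto
      then show "\<bar>Im (?\<zeta> x y)\<bar> \<le> e * (1 - Re (?\<zeta> x y))"
        unfolding \<tau> using m by (simp add: abs_divide flip: of_real_power)
    qed
    moreover have "1 - Re (?\<zeta> x y) \<le> 1 - z" if "cell x = cell y"
    proof -
      have "ip_norm ip (x - y) \<le> C * ((m / C) * sqrt s)"
        using cell(4)[OF that] cC by (meson mult_left_mono order_trans less_imp_le)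
      then have "ip_norm ip (x - y) \<le> m * sqrt s" using cC by simp
      then have "ip_norm ip (x - y) ^ 2 \<le> (m * sqrt s) ^ 2"
        by (intro power_mono ip_norm_nonneg)
      then have "ip_norm ip (x - y) ^ 2 \<le> m ^ 2 * s" using s by (simp add: power_mult_distrib)
      also have "\<dots> \<le> s * (2 * m ^ 2)" using s by simp
      finally show ?thesis unfolding \<tau> z_def using m by (simp add: divide_le_eq)
    qed
    ultimately show ?thesis using A unfolding A_def D_def by (auto simp: z_def split: if_splits)
  qed
  show ?thesis
  proof (intro exI[of _ z] conjI allI impI)
    show "0 < z" "z < 1" using z by auto
    fix F :: "(complex^'m) set" and a :: "complex^'m \<Rightarrow> real"
    assume F: "finite F \<and> F \<subseteq> X \<and> (\<forall>x\<in>F. 0 \<le> a x) \<and> sum a F = 1"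
    have FW: "cell ` F \<subseteq> W"
    proof safe
      fix x assume "x \<in> F"
      then have "c * norm x \<le> m" using F X cC(3)[of x] by auto
      then show "cell x \<in> W" using cC by (intro cell(3)) (simp add: field_simps)
    qed
    let ?S = "\<Sum>x\<in>F. \<Sum>y\<in>F. if cell x = cell y then a x * a y else 0"
    have S1: "1 \<le> real (card W) * ?S"
      using F FW cell(1) by (intro same_cell_weight) auto
    have cardW: "real (card W) \<le> E * (1 / s) ^ n" using cell(2) s by (simp add: n_def)
    have S0: "?S \<ge> 0" using F by (intro sum_nonneg) auto
    have S2: "1 \<le> E * (1 / s) ^ n * ?S"
      using S1 mult_right_mono[OF cardW S0] by linarith
    have "\<bar>B\<bar> + D \<le> K / s" using s D by (simp add: field_simps)
    also have "K / s = A * (1 / (E * (1 / s) ^ n))"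
      using s E by (simp add: K_def A_def field_simps power_mult_distrib)
    also have "\<dots> \<le> A * ?S"
      using S2 A E s by (intro mult_left_mono) (auto simp: field_simps)
    finally have "B \<le> A * ?S - D" by linarith
    also have "\<dots> = A * ?S - D * (sum a F * sum a F)" using F by simp
    also have "\<dots> = (\<Sum>x\<in>F. \<Sum>y\<in>F. a x * a y * ((if cell x = cell y then A else 0) - D))"
    proof -
      have "A * ?S = (\<Sum>x\<in>F. \<Sum>y\<in>F. a x * a y * (if cell x = cell y then A else 0))"
        unfolding sum_distrib_left by (intro sum.cong refl) simp
      moreover have "D * (sum a F * sum a F) = (\<Sum>x\<in>F. \<Sum>y\<in>F. a x * a y * D)"
        by (subst sum_product) (simp only: sum_distrib_left mult_ac)
      ultimately show ?thesis by (simp only: sum_subtractf right_diff_distrib)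
    qed
    also have "\<dots> \<le> (\<Sum>x\<in>F. \<Sum>y\<in>F. a x * a y * ?k x y)"
    proof (intro sum_mono mult_left_mono)
      fix x y assume "x \<in> F" "y \<in> F"
      then show "(if cell x = cell y then A else 0) - D \<le> ?k x y" "0 \<le> a x * a y"
        using point[of x y] F by (blast, simp)
    qed
    finally show "B \<le> (\<Sum>x\<in>F. \<Sum>y\<in>F. a x * a y * Re ((1 / (1 - of_real z * ?\<zeta> x y)) ^ Suc CARD('m)))"
      by (simp add: n_def)
  qed
qed

text \<open>In the expansion of the kernel, the k-th power of \<open>ip x y\<close> averages to the
  squared norm of the part of T of degree k. On X the inner product is at most m^2 in modulus, so
  the series at z dominates uniformly. Cutting it at a common degree M costs at most 1, whence the
  start from B + 1, and leaves the finitely many degrees that \<open>invariant_average\<close> can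
  handle.\<close>

lemma averages_lower_bound:
  assumes m: "m > 0" and X: "\<And>x. x \<in> X \<Longrightarrow> ip_norm ip x = m"
    and phase: "\<And>e. 0 < e \<Longrightarrow> \<exists>d>0. \<forall>x\<in>X. \<forall>y\<in>X. ip_norm ip (x - y) < d \<longrightarrow> \<bar>Im (ip x y)\<bar> \<le> e * ip_norm ip (x - y) ^ 2"
    and c: "\<And>k. 0 < c k"
      "\<And>y :: complex. norm y < 1 \<Longrightarrow> (\<lambda>k. complex_of_real (c k) * y ^ k) sums (1 / (1 - y)) ^ Suc CARD('m)"
  shows "\<exists>z M. 0 < z \<and> z < 1 \<and> (\<forall>T\<in>averages X. B \<le> weighted_norm_sq M (\<lambda>k. c k * (z / m ^ 2) ^ k) T)"
proof -
  let ?N = "Suc CARD('m)"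
  have ex_z: "\<exists>z. 0 < z \<and> z < 1 \<and> (\<forall>F a. finite F \<and> F \<subseteq> X \<and> (\<forall>x\<in>F. 0 \<le> a x) \<and> sum a F = 1 \<longrightarrow>
     B + 1 \<le> (\<Sum>x\<in>F. \<Sum>y\<in>F. a x * a y * Re ((1 / (1 - of_real z * (ip x y / of_real (m ^ 2)))) ^ ?N)))"
    by (rule kernel_lower_bound[OF m X phase])
  obtain z where z: "0 < z \<and> z < 1 \<and> (\<forall>F a. finite F \<and> F \<subseteq> X \<and> (\<forall>x\<in>F. 0 \<le> a x) \<and> sum a F = 1 \<longrightarrow>
     B + 1 \<le> (\<Sum>x\<in>F. \<Sum>y\<in>F. a x * a y * Re ((1 / (1 - of_real z * (ip x y / of_real (m ^ 2)))) ^ ?N)))"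
    using ex_z by (elim exE) (rule that)
  have "(\<lambda>k. complex_of_real (c k) * of_real z ^ k) sums (1 / (1 - of_real z)) ^ ?N"
    using c(2)[of "of_real z"] z by simp
  then have "summable (\<lambda>k. complex_of_real (c k * z ^ k))" by (simp add: sums_iff)
  then have sz: "summable (\<lambda>k. c k * z ^ k)" by (simp only: summable_of_real_iff)
  obtain M where M: "norm (\<Sum>k. c (k + Suc M) * z ^ (k + Suc M)) < 1"
    using suminf_exist_split[OF zero_less_one sz] le_SucI[OF order_refl] by blast
  have point: "Re ((1 / (1 - of_real z * (ip x y / of_real (m ^ 2)))) ^ ?N) - 1
      \<le> (\<Sum>k\<le>M. c k * (z / m ^ 2) ^ k * Re (ip x y ^ k))" if xy: "x \<in> X" "y \<in> X" for x y
  proof -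
    define w where "w = of_real z * (ip x y / of_real (m ^ 2))"
    have "norm (ip x y) \<le> m ^ 2"
      using Cauchy_Schwarz[of x y] X[OF xy(1)] X[OF xy(2)] by (simp add: power2_eq_square)
    then have "norm w \<le> z * 1"
      unfolding w_def norm_mult using z m by (intro mult_mono) (auto simp: norm_divide norm_power)
    then have wz: "norm w \<le> z" by simp
    let ?f = "\<lambda>k. complex_of_real (c k) * w ^ k"
    have sums: "?f sums (1 / (1 - w)) ^ ?N" using c(2)[of w] wz z by simp
    have bound: "norm (?f (k + Suc M)) \<le> c (k + Suc M) * z ^ (k + Suc M)" for k
      unfolding norm_mult norm_power norm_of_real using c(1)[of "k + Suc M"] wz
      by (intro mult_mono power_mono) auto
    have "(1 / (1 - w)) ^ ?N = (\<Sum>k. ?f (k + Suc M)) + (\<Sum>k<Suc M. ?f k)"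
      using suminf_split_initial_segment[OF sums_summable[OF sums], of "Suc M"] sums_unique[OF sums] by simp
    moreover have "norm (\<Sum>k. ?f (k + Suc M)) \<le> (\<Sum>k. c (k + Suc M) * z ^ (k + Suc M))"
      by (rule norm_suminf_le[OF bound]) (rule summable_ignore_initial_segment[OF sz])
    then have "norm (\<Sum>k. ?f (k + Suc M)) \<le> 1" using M by simp
    then have "Re (\<Sum>k. ?f (k + Suc M)) \<le> 1" using complex_Re_le_cmod order_trans by blast
    ultimately have "Re ((1 / (1 - w)) ^ ?N) - 1 \<le> Re (\<Sum>k\<le>M. ?f k)"
      by (simp only: plus_complex.sel lessThan_Suc_atMost)
    also have "Re (\<Sum>k\<le>M. ?f k) = (\<Sum>k\<le>M. c k * (z / m ^ 2) ^ k * Re (ip x y ^ k))"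
      unfolding Re_sum
    proof (intro sum.cong refl)
      fix k
      have "?f k = of_real (c k * (z / m ^ 2) ^ k) * ip x y ^ k"
        by (simp add: w_def power_mult_distrib power_divide)
      then show "Re (?f k) = c k * (z / m ^ 2) ^ k * Re (ip x y ^ k)"
        by (simp only: Re_complex_of_real_mult)
    qed
    finally show ?thesis by (simp add: w_def)
  qed
  have "B \<le> weighted_norm_sq M (\<lambda>k. c k * (z / m ^ 2) ^ k) T" if TX: "T \<in> averages X" for T
  proof -
    obtain F a where F: "finite F" "F \<subseteq> X" "\<And>x. x \<in> F \<Longrightarrow> 0 \<le> a x" "sum a F = 1"
        "T = (\<lambda>I. \<Sum>x\<in>F. complex_of_real (a x) * tensor_exp x I)"
      using TX by (auto simp: averages_def)
    have T: "Re (tip k T T) = (\<Sum>x\<in>F. \<Sum>y\<in>F. a x * a y * Re (ip x y ^ k))" for k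
    proof -
      have "tip k T T = (\<Sum>x\<in>F. \<Sum>y\<in>F. of_real (a x * a y) * ip x y ^ k)"
        unfolding F(5) tip_sum_left tip_sum_right tip_tensor_exp by (simp add: sum_distrib_left mult.assoc)
      then show ?thesis by (simp only: Re_sum Re_complex_of_real_mult)
    qed
    let ?r = "\<lambda>x y. Re ((1 / (1 - of_real z * (ip x y / of_real (m ^ 2)))) ^ ?N)"
    have "B = (B + 1) - sum a F * sum a F" using F by simp
    also have "\<dots> \<le> (\<Sum>x\<in>F. \<Sum>y\<in>F. a x * a y * ?r x y) - sum a F * sum a F"
      using z[THEN conjunct2, THEN conjunct2, rule_format, of F a] F(1-4) by simp
    also have "\<dots> = (\<Sum>x\<in>F. \<Sum>y\<in>F. a x * a y * (?r x y - 1))"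
      unfolding sum_product sum_subtractf[symmetric] by (intro sum.cong refl) (simp add: algebra_simps)
    also have "\<dots> \<le> (\<Sum>x\<in>F. \<Sum>y\<in>F. a x * a y * (\<Sum>k\<le>M. c k * (z / m ^ 2) ^ k * Re (ip x y ^ k)))"
    proof (intro sum_mono mult_left_mono)
      fix x y assume "x \<in> F" "y \<in> F"
      then show "?r x y - 1 \<le> (\<Sum>k\<le>M. c k * (z / m ^ 2) ^ k * Re (ip x y ^ k))" "0 \<le> a x * a y"
        using point[of x y] F(2,3) by (blast, simp)
    qed
    also have "\<dots> = (\<Sum>k\<le>M. \<Sum>x\<in>F. \<Sum>y\<in>F. c k * (z / m ^ 2) ^ k * (a x * a y * Re (ip x y ^ k)))"
      unfolding sum_distrib_left
      by (subst (2) sum.swap, subst sum.swap) (simp add: mult_ac)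
    also have "\<dots> = weighted_norm_sq M (\<lambda>k. c k * (z / m ^ 2) ^ k) T"
      unfolding weighted_norm_sq_def T by (simp add: sum_distrib_left)
    finally show ?thesis .
  qed
  with z show ?thesis by blast
qed

end

section \<open>The unitarian trick and invariant projections\<close>

lemma tensor_power_map_mult: "tensor_power_map k (A ** B) T = tensor_power_map k A (tensor_power_map k B T)"
proof
  fix I :: "'a list"
  show "tensor_power_map k (A ** B) T I = tensor_power_map k A (tensor_power_map k B T) I"
  proof (cases "length I = k")
    case True
    let ?L = "{J :: 'a list. length J = k}"
    have "(\<Sum>J\<in>?L. (\<Prod>l<k. (A ** B) $ (I ! l) $ (J ! l)) * T J)
        = (\<Sum>J\<in>?L. (\<Sum>P\<in>?L. \<Prod>l<k. A $ (I ! l) $ (P ! l) * B $ (P ! l) $ (J ! l)) * T J)"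
    proof (intro sum.cong refl)
      fix J
      show "(\<Prod>l<k. (A ** B) $ (I ! l) $ (J ! l)) * T J
          = (\<Sum>P\<in>?L. \<Prod>l<k. A $ (I ! l) $ (P ! l) * B $ (P ! l) $ (J ! l)) * T J"
        using sum_lists_prod[of "\<lambda>l p. A $ (I ! l) $ p * B $ p $ (J ! l)" k]
        by (simp add: matrix_matrix_mult_def)
    qed
    also have "\<dots> = (\<Sum>P\<in>?L. (\<Prod>l<k. A $ (I ! l) $ (P ! l)) * (\<Sum>J\<in>?L. (\<Prod>l<k. B $ (P ! l) $ (J ! l)) * T J))"
      unfolding sum_distrib_left sum_distrib_right
      by (subst sum.swap) (simp add: prod.distrib mult.assoc)
    finally show ?thesis using True by (simp add: tensor_power_map_def)
  qed (simp add: tensor_power_map_def)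
qed

lemma tensor_power_map_one: "length I = k \<Longrightarrow> tensor_power_map k (mat 1) T I = T I"
proof -
  assume I: "length I = k"
  have "(\<Sum>J | length J = k. (\<Prod>l<k. (mat 1 :: complex^'a^'a) $ (I ! l) $ (J ! l)) * T J)
      = (\<Sum>J | length J = k. if J = I then T J else 0)"
  proof (intro sum.cong refl)
    fix J :: "'a list" assume J: "J \<in> {J. length J = k}"
    show "(\<Prod>l<k. (mat 1 :: complex^'a^'a) $ (I ! l) $ (J ! l)) * T J = (if J = I then T J else 0)"
    proof (cases "J = I")
      case False
      then obtain l where "l < k" "J ! l \<noteq> I ! l" using I J by (auto simp: list_eq_iff_nth_eq)
      then have "(\<Prod>l<k. (mat 1 :: complex^'a^'a) $ (I ! l) $ (J ! l)) = 0"
        by (intro prod_zero bexI[of _ l]) (auto simp: mat_def)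
      with False show ?thesis by simp
    qed (simp add: mat_def)
  qed
  also have "\<dots> = T I" using I by (simp add: finite_length_eq)
  finally show ?thesis using I by (simp add: tensor_power_map_def)
qed

lemma tensor_power_map_one_tensors: "T \<in> tensors k \<Longrightarrow> tensor_power_map k (mat 1) T = T"
proof
  fix I assume "T \<in> tensors k"
  then show "tensor_power_map k (mat 1) T I = T I"
    by (cases "length I = k") (simp_all add: tensor_power_map_one, simp add: tensor_power_map_def tensors_def)
qed

text \<open>Identity theorem, with the real line accumulating at 0.\<close>

lemma entire_constant:
  assumes f: "f holomorphic_on UNIV" and c: "\<And>t. f (complex_of_real t) = c"
  shows "f z = c"
proof -
  have hol: "(\<lambda>w. f w - c) holomorphic_on UNIV" using f by (intro holomorphic_intros)
  have lim: "0 islimpt range complex_of_real"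
    unfolding islimpt_approachable
  proof (intro allI impI)
    fix e :: real assume "0 < e"
    then show "\<exists>x'\<in>range complex_of_real. x' \<noteq> 0 \<and> dist x' 0 < e"
      by (intro bexI[OF _ rangeI[of complex_of_real "e / 2"]]) (simp add: dist_norm)
  qed
  have "f z - c = 0"
    by (rule analytic_continuation[OF hol open_UNIV connected_UNIV subset_UNIV UNIV_I lim]) (auto simp: c)
  then show ?thesis by simp
qed

section \<open>The group action and the passage from K to its complexification\<close>

locale unitary_group_action = hermitian ip
  for ip :: "complex^'m \<Rightarrow> complex^'m \<Rightarrow> complex" +
  fixes G K :: "(complex^'n^'n) set" and \<phi> :: "complex^'n^'n \<Rightarrow> complex^'m^'m"
  assumes G: "closed_matrix_group G" and K: "closed_matrix_group K" and KG: "K \<subseteq> G"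
    and conG: "connected G" and compK: "compact K" and complexif: "complexification K G"
    and invertG: "g \<in> G \<Longrightarrow> invertible g"
    and hom_mult: "g \<in> G \<Longrightarrow> h \<in> G \<Longrightarrow> \<phi> (g ** h) = \<phi> g ** \<phi> h"
    and hom_one: "\<phi> (mat 1) = mat 1"
    and reg: "regular_on G (\<lambda>g. \<phi> g $ i $ j)"
    and unitary: "k \<in> K \<Longrightarrow> ip (\<phi> k *v x) (\<phi> k *v y) = ip x y"
begin

sublocale G: closed_matrix_group G by (rule G)
sublocale K: closed_matrix_group K by (rule K)

lemma scale_lie_algebra:
  assumes "X \<in> lie_algebra K" shows "scale_matrix z X \<in> lie_algebra G"
proof -
  have "Re z *\<^sub>R X \<in> lie_algebra K" "Im z *\<^sub>R X \<in> lie_algebra K"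
    using assms K.subspace_lie_algebra by (auto intro: subspace_scale)
  then show ?thesis
    using complexif unfolding complexification_def scale_matrix_Complex by blast
qed

lemma exp_scale_mem: "X \<in> lie_algebra K \<Longrightarrow> matrix_exp (scale_matrix z X) \<in> G"
  by (rule G.exp_mem[OF scale_lie_algebra])

lemma exp_real_mem: "X \<in> lie_algebra K \<Longrightarrow> matrix_exp (scale_matrix (of_real t) X) \<in> K"
  by (simp add: scale_matrix_of_real lie_algebra_def)

lemma inverse_image:
  assumes "g \<in> G"
  obtains h where "h \<in> G" "g ** h = mat 1" "h ** g = mat 1" "\<phi> h ** \<phi> g = mat 1" "\<phi> g ** \<phi> h = mat 1"
proof -
  obtain h where h: "h \<in> G" "g ** h = mat 1" "h ** g = mat 1" using G.inverse_mem[OF assms] by blast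
  then show ?thesis
    using that hom_mult[OF h(1) assms] hom_mult[OF assms h(1)] hom_one by simp
qed

lemma \<phi>_tendsto:
  assumes "\<And>n. u n \<in> G" "g \<in> G" "(u \<longlongrightarrow> g) F"
  shows "((\<lambda>n. \<phi> (u n)) \<longlongrightarrow> \<phi> g) F"
proof (intro vec_tendstoI)
  fix i j
  have "continuous_on G (\<lambda>g. \<phi> g $ i $ j)" by (rule regular_on_continuous[OF reg invertG])
  from continuous_on_tendsto_compose[OF this assms(3,2)] assms(1)
  show "((\<lambda>n. \<phi> (u n) $ i $ j) \<longlongrightarrow> \<phi> g $ i $ j) F" by simp
qed

lemma entry_holomorphic:
  assumes "X \<in> lie_algebra K"
  shows "(\<lambda>z. \<phi> (matrix_exp (scale_matrix z X)) $ i $ j) holomorphic_on S"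
  by (rule regular_on_holomorphic[OF reg holomorphic_matrix_exp_scale])
    (use exp_scale_mem[OF assms] invertG in auto)

lemma matrix_coefficient_holomorphic:
  assumes "X \<in> lie_algebra K"
  shows "(\<lambda>z. tip k S (tensor_power_map k (\<phi> (matrix_exp (scale_matrix z X))) T)) holomorphic_on A"
proof -
  have "(\<lambda>z. tip k S (tensor_power_map k (\<phi> (matrix_exp (scale_matrix z X))) T))
      = (\<lambda>z. \<Sum>I | length I = k. \<Sum>J | length J = k. cnj (S I) *
          (\<Sum>J' | length J' = k. (\<Prod>l<k. \<phi> (matrix_exp (scale_matrix z X)) $ (J ! l) $ (J' ! l)) * T J') *
          (\<Prod>l<k. ip (axis (I ! l) 1) (axis (J ! l) 1)))"
    unfolding tensor_ip_def tensor_power_map_def by (intro ext sum.cong refl) simp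
  moreover have "\<dots> holomorphic_on A"
    by (intro holomorphic_intros entry_holomorphic assms)
  ultimately show ?thesis by simp
qed

text \<open>The scheme for passing from K to G: the property in question is recorded as a closed
  subgroup U. Its Lie algebra is a real subspace containing X and \<i> X for all X in the Lie
  algebra of K, hence the whole Lie algebra of G.\<close>

lemma subgroup_eq_G:
  assumes "closed_matrix_group U" "U \<subseteq> G"
    and exp: "\<And>X z. X \<in> lie_algebra K \<Longrightarrow> matrix_exp (scale_matrix z X) \<in> U"
  shows "U = G"
proof (rule connected_matrix_group_eqI[OF G assms(1,2) conG])
  interpret U: closed_matrix_group U by fact
  have "scale_matrix w X \<in> lie_algebra U" if "X \<in> lie_algebra K" for X w
  proof -
    have "t *\<^sub>R scale_matrix w X = scale_matrix (of_real t * w) X" for t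
      by (simp add: scale_matrix_def vec_eq_iff scaleR_conv_of_real[where 'a = complex])
    then show ?thesis using exp[OF that] by (simp add: lie_algebra_def)
  qed
  note sc = this
  show "lie_algebra G \<subseteq> lie_algebra U"
  proof
    fix Z assume "Z \<in> lie_algebra G"
    then obtain X Y where XY: "X \<in> lie_algebra K" "Y \<in> lie_algebra K" "Z = X + i_times Y"
      using complexif unfolding complexification_def by blast
    have "Z = scale_matrix 1 X + scale_matrix \<i> Y"
      by (simp add: XY(3) scale_matrix_def i_times_def vec_eq_iff)
    then show "Z \<in> lie_algebra U"
      using sc XY subspace_add[OF U.subspace_lie_algebra] by simp
  qed
qed

lemma tensor_power_map_tendsto:
  assumes "(u \<longlongrightarrow> A) F"
  shows "((\<lambda>n. tensor_power_map k (u n) T I) \<longlongrightarrow> tensor_power_map k A T I) F"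
  unfolding tensor_power_map_def
  by (cases "length I = k") (auto intro!: tendsto_intros tendsto_vec_nth assms)

text \<open>Weyl's unitarian trick: an entire function that is constant on the real line is constant.\<close>

lemma K_invariant_imp_G_invariant:
  assumes T: "T \<in> tensors k" and inv: "\<And>g. g \<in> K \<Longrightarrow> tensor_power_map k (\<phi> g) T = T"
  shows "T \<in> invariant_tensors G \<phi> k"
proof -
  define U where "U = {g \<in> G. tensor_power_map k (\<phi> g) T = T}"
  have "closed_matrix_group U"
  proof
    show "mat 1 \<in> U" using T by (simp add: U_def G.one_mem hom_one tensor_power_map_one_tensors)
    show "g ** h \<in> U" if "g \<in> U" "h \<in> U" for g h
      using that by (simp add: U_def G.mult_mem hom_mult tensor_power_map_mult)
    show "\<exists>h\<in>U. g ** h = mat 1 \<and> h ** g = mat 1" if g: "g \<in> U" for g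
    proof -
      have gG: "g \<in> G" and gT: "tensor_power_map k (\<phi> g) T = T" using g by (auto simp: U_def)
      obtain h where h: "h \<in> G" "g ** h = mat 1" "h ** g = mat 1" "\<phi> h ** \<phi> g = mat 1"
        using inverse_image[OF gG] by blast
      have "tensor_power_map k (\<phi> h) T = tensor_power_map k (\<phi> h ** \<phi> g) T"
        unfolding tensor_power_map_mult gT ..
      also have "\<dots> = T" unfolding h(4) by (rule tensor_power_map_one_tensors[OF T])
      finally show ?thesis using h by (auto simp: U_def)
    qed
    fix hs g assume hs: "\<And>n :: nat. hs n \<in> U" and lim: "hs \<longlonglongrightarrow> g" and g: "invertible g"
    have gG: "g \<in> G" using hs by (intro G.limit_mem[OF _ lim g]) (simp add: U_def)
    have "(\<lambda>n. \<phi> (hs n)) \<longlonglongrightarrow> \<phi> g" using hs by (intro \<phi>_tendsto gG lim) (simp add: U_def)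
    then have "(\<lambda>n. tensor_power_map k (\<phi> (hs n)) T I) \<longlonglongrightarrow> tensor_power_map k (\<phi> g) T I" for I
      by (rule tensor_power_map_tendsto)
    moreover have "tensor_power_map k (\<phi> (hs n)) T I = T I" for n I using hs[of n] by (simp add: U_def)
    ultimately have "tensor_power_map k (\<phi> g) T I = T I" for I by (simp add: LIMSEQ_const_iff)
    then show "g \<in> U" using gG by (auto simp: U_def)
  qed
  moreover have "U \<subseteq> G" by (auto simp: U_def)
  moreover have "matrix_exp (scale_matrix z X) \<in> U" if X: "X \<in> lie_algebra K" for X z
  proof -
    let ?T = "tensor_power_map k (\<phi> (matrix_exp (scale_matrix z X))) T"
    have eq: "tip k S ?T = tip k S T" for S
      by (rule entire_constant[OF matrix_coefficient_holomorphic[OF X]]) (simp add: inv exp_real_mem[OF X])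
    let ?D = "\<lambda>I. ?T I - T I"
    \<comment> \<open>\<open>eq\<close> holds against every tensor, in particular against the
      difference itself.\<close>
    have "tip k ?D ?D = 0" by (simp add: tip_diff_right eq)
    then have "ip_norm (tip k) ?D = 0" by (simp add: ip_norm_def)
    then have "?D I = 0" if "length I = k" for I
      using tip_coordinate_bound[of I] that by (metis mult_zero_right norm_le_zero_iff)
    then have "?T I = T I" for I
      using T by (cases "length I = k") (auto simp: tensor_power_map_def tensors_def)
    then show ?thesis using exp_scale_mem[OF X] by (auto simp: U_def)
  qed
  ultimately have "U = G" by (rule subgroup_eq_G)
  then show ?thesis using T by (auto simp: invariant_tensors_def U_def)
qed

text \<open>G does not act unitarily, but g enters only the linear slot of \<open>tip k\<close>, so
  the pairing is holomorphic along complex one-parameter subgroups. On K it is constant by unitarity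
  and invariance of S, hence constant throughout.\<close>

lemma tip_invariant_left:
  assumes S: "S \<in> invariant_tensors G \<phi> k" and g: "g \<in> G"
  shows "tip k S (tensor_power_map k (\<phi> g) T) = tip k S T"
proof -
  \<comment> \<open>All T at once: closure under products applies the condition to an already
    transformed tensor.\<close>
  define U where "U = {g \<in> G. \<forall>T. tip k S (tensor_power_map k (\<phi> g) T) = tip k S T}"
  have "closed_matrix_group U"
  proof
    show "mat 1 \<in> U"
      by (auto simp: U_def G.one_mem hom_one intro: tip_cong tensor_power_map_one)
    show "g ** h \<in> U" if "g \<in> U" "h \<in> U" for g h
      using that by (simp add: U_def G.mult_mem hom_mult tensor_power_map_mult)
    show "\<exists>h\<in>U. g ** h = mat 1 \<and> h ** g = mat 1" if g: "g \<in> U" for g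
    proof -
      have gG: "g \<in> G" and gT: "\<And>T. tip k S (tensor_power_map k (\<phi> g) T) = tip k S T" using g by (auto simp: U_def)
      obtain h where h: "h \<in> G" "g ** h = mat 1" "h ** g = mat 1" "\<phi> g ** \<phi> h = mat 1"
        using inverse_image[OF gG] by blast
      have "tip k S (tensor_power_map k (\<phi> h) T) = tip k S (tensor_power_map k (\<phi> g ** \<phi> h) T)" for T
        unfolding tensor_power_map_mult gT ..
      then have "tip k S (tensor_power_map k (\<phi> h) T) = tip k S T" for T
        unfolding h(4) by (auto intro: tip_cong tensor_power_map_one)
      then show ?thesis using h by (auto simp: U_def)
    qed
    fix hs g assume hs: "\<And>n :: nat. hs n \<in> U" and lim: "hs \<longlonglongrightarrow> g" and g: "invertible g"
    have gG: "g \<in> G" using hs by (intro G.limit_mem[OF _ lim g]) (simp add: U_def)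
    have "(\<lambda>n. \<phi> (hs n)) \<longlonglongrightarrow> \<phi> g" using hs by (intro \<phi>_tendsto gG lim) (simp add: U_def)
    then have "(\<lambda>n. tip k S (tensor_power_map k (\<phi> (hs n)) T)) \<longlonglongrightarrow> tip k S (tensor_power_map k (\<phi> g) T)" for T
      by (intro tip_tendsto tensor_power_map_tendsto tendsto_const)
    moreover have "tip k S (tensor_power_map k (\<phi> (hs n)) T) = tip k S T" for n T using hs[of n] by (simp add: U_def)
    ultimately show "g \<in> U" using gG by (simp add: U_def LIMSEQ_const_iff)
  qed
  moreover have "U \<subseteq> G" by (auto simp: U_def)
  moreover have "matrix_exp (scale_matrix z X) \<in> U" if X: "X \<in> lie_algebra K" for X z
  proof -
    have "tip k S (tensor_power_map k (\<phi> (matrix_exp (scale_matrix z X))) T) = tip k S T" for T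
    proof (rule entire_constant[OF matrix_coefficient_holomorphic[OF X]])
      fix t
      let ?u = "matrix_exp (scale_matrix (of_real t) X)"
      have u: "?u \<in> K" by (rule exp_real_mem[OF X])
      then have "tensor_power_map k (\<phi> ?u) S = S" using S KG by (auto simp: invariant_tensors_def)
      then show "tip k S (tensor_power_map k (\<phi> ?u) T) = tip k S T"
        using tip_tensor_power_map[OF unitary[OF u], of k S T] by simp
    qed
    then show ?thesis using exp_scale_mem[OF X] by (simp add: U_def)
  qed
  ultimately have "U = G" by (rule subgroup_eq_G)
  then show ?thesis using g by (auto simp: U_def)
qed

lemma tip_invariant_orbit:
  assumes "S \<in> invariant_tensors G \<phi> k" "g \<in> G"
  shows "tip k S (tensor_exp (\<phi> g *v x)) = tip k S (tensor_exp x)"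
proof -
  have "tip k S (tensor_exp (\<phi> g *v x)) = tip k S (tensor_power_map k (\<phi> g) (tensor_exp x))"
    by (rule tip_cong) (simp_all flip: tensor_power_map_tensor_exp)
  then show ?thesis by (simp add: tip_invariant_left[OF assms])
qed

section \<open>Projections onto the invariants\<close>

definition proj :: "nat \<Rightarrow> complex^'m \<Rightarrow> 'm tensor" where
  "proj k v = orthogonal_projection (tip k) (invariant_tensors G \<phi> k) (tensor_power k v)"

lemma invariant_tensors_diff:
  assumes "S \<in> invariant_tensors G \<phi> k" "T \<in> invariant_tensors G \<phi> k"
  shows "(\<lambda>I. S I - T I) \<in> invariant_tensors G \<phi> k"
proof -
  have "tensor_power_map k A (\<lambda>I. S I - T I) = (\<lambda>I. tensor_power_map k A S I - tensor_power_map k A T I)" for A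
    by (rule ext) (simp add: tensor_power_map_def right_diff_distrib sum_subtractf)
  then show ?thesis using assms by (simp add: invariant_tensors_def tensors_def)
qed

text \<open>Two candidates differ by an invariant tensor that is orthogonal to itself, so the
  definite description is justified.\<close>

lemma proj_eqI:
  assumes P: "P \<in> invariant_tensors G \<phi> k"
    and eq: "\<And>S. S \<in> invariant_tensors G \<phi> k \<Longrightarrow> tip k S (tensor_exp v) = tip k S P"
  shows "proj k v = P"
  unfolding proj_def orthogonal_projection_def
proof (rule the_equality)
  have v: "tip k S (tensor_power k v) = tip k S (tensor_exp v)" for S
    by (rule tip_cong) (simp_all add: tensor_power_def pure_tensor_def tensor_exp_def)
  show "P \<in> invariant_tensors G \<phi> k \<and>
      (\<forall>S\<in>invariant_tensors G \<phi> k. tip k S (\<lambda>I. tensor_power k v I - P I) = 0)"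
    using P eq by (simp add: tip_diff_right v)
  fix Q assume Q: "Q \<in> invariant_tensors G \<phi> k \<and>
      (\<forall>S\<in>invariant_tensors G \<phi> k. tip k S (\<lambda>I. tensor_power k v I - Q I) = 0)"
  let ?D = "\<lambda>I. Q I - P I"
  have D: "?D \<in> invariant_tensors G \<phi> k" using Q P by (simp add: invariant_tensors_diff)
  have "tip k ?D Q = tip k ?D P" using Q D eq by (simp add: tip_diff_right v)
  then have "tip k ?D ?D = 0" by (subst tip_diff_right) simp
  then have "ip_norm (tip k) ?D = 0" by (simp add: ip_norm_def)
  then have "?D I = 0" if "length I = k" for I
    using tip_coordinate_bound[of I] that by (metis mult_zero_right norm_le_zero_iff)
  moreover have "Q I = 0" "P I = 0" if "length I \<noteq> k" for I
    using Q P that by (auto simp: invariant_tensors_def tensors_def)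
  ultimately show "Q = P" by (metis ext eq_iff_diff_eq_0)
qed

text \<open>The limit P of averages over the K-orbit of w is fixed by K, hence by G in each degree,
  and pairs with invariants as w does; so its homogeneous parts are the projections of the powers of
  v. Only pairings of w enter, which lets w lie outside the orbit of v. With w = v the last two
  claims yield the existence of the projections.\<close>

lemma proj_lower_bound:
  assumes w: "\<And>k S. S \<in> invariant_tensors G \<phi> k \<Longrightarrow> tip k S (tensor_exp w) = tip k S (tensor_exp v)"
    and c: "\<And>k. k \<le> M \<Longrightarrow> 0 < c k"
    and low: "\<And>T. T \<in> averages ((\<lambda>g. \<phi> g *v w) ` K) \<Longrightarrow> L \<le> weighted_norm_sq M c T"
  shows "L \<le> (\<Sum>k\<le>M. c k * ip_norm (tip k) (proj k v) ^ 2)"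
    and "k \<le> M \<Longrightarrow> proj k v \<in> invariant_tensors G \<phi> k"
    and "k \<le> M \<Longrightarrow> S \<in> invariant_tensors G \<phi> k \<Longrightarrow> tip k S (tensor_exp v) = tip k S (proj k v)"
proof -
  let ?X = "(\<lambda>g. \<phi> g *v w) ` K"
  obtain P where P: "L \<le> weighted_norm_sq M c P"
    "\<And>A J. A \<in> \<phi> ` K \<Longrightarrow> length J \<le> M \<Longrightarrow> tensor_map A P J = P J"
    "\<And>k S s. k \<le> M \<Longrightarrow> (\<And>x. x \<in> ?X \<Longrightarrow> tip k S (tensor_exp x) = s) \<Longrightarrow> tip k S P = s"
  proof (rule invariant_average[where X = ?X and \<A> = "\<phi> ` K" and L = L and M = M and c = c])
    show "?X \<noteq> {}" using K.one_mem by blast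
    show "\<exists>B. B ** A = mat 1" if A: "A \<in> \<phi> ` K" for A
    proof -
      obtain g where g: "g \<in> K" "A = \<phi> g" using A by blast
      then have "g \<in> G" using KG by blast
      then show ?thesis using inverse_image g(2) by metis
    qed
    show "A *v x \<in> ?X" if A: "A \<in> \<phi> ` K" and x: "x \<in> ?X" for A x
    proof -
      obtain g where g: "g \<in> K" "A = \<phi> g" using A by blast
      obtain h where h: "h \<in> K" "x = \<phi> h *v w" using x by blast
      have "A *v x = \<phi> (g ** h) *v w"
        using g h hom_mult[OF subsetD[OF KG g(1)] subsetD[OF KG h(1)]] by (simp add: matrix_vector_mul_assoc)
      then show ?thesis using K.mult_mem[OF g(1) h(1)] by blast
    qed
    show "ip (A *v x) (A *v y) = ip x y" if "A \<in> \<phi> ` K" for A x y using that unitary by blast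
  qed (use c low in blast)+
  \<comment> \<open>\<open>P\<close> has entries in all degrees; \<open>Q k\<close> keeps degree k
    and is 0 on other lists, as \<open>tensors k\<close> demands.\<close>
  define Q where "Q k = (\<lambda>I. if length I = k then P I else 0)" for k
  have tipQ: "tip k S (Q k) = tip k S P" for S k by (rule tip_cong) (simp_all add: Q_def)
  have Qinv: "Q k \<in> invariant_tensors G \<phi> k" if k: "k \<le> M" for k
  proof (rule K_invariant_imp_G_invariant)
    show "Q k \<in> tensors k" by (simp add: Q_def tensors_def)
    fix g assume g: "g \<in> K"
    show "tensor_power_map k (\<phi> g) (Q k) = Q k"
    proof
      fix I
      show "tensor_power_map k (\<phi> g) (Q k) I = Q k I"
      proof (cases "length I = k")
        case True
        have "tensor_power_map k (\<phi> g) (Q k) I = tensor_map (\<phi> g) P I"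
          using True by (simp add: tensor_map_def tensor_power_map_def Q_def)
        also have "\<dots> = P I" using P(2) g True k by blast
        finally show ?thesis using True by (simp add: Q_def)
      qed (simp add: tensor_power_map_def Q_def)
    qed
  qed
  have Qv: "tip k S (tensor_exp v) = tip k S (Q k)" if k: "k \<le> M" and S: "S \<in> invariant_tensors G \<phi> k" for k S
  proof -
    have "tip k S P = tip k S (tensor_exp w)"
      using KG tip_invariant_orbit[OF S] by (intro P(3)[OF k]) blast
    then show ?thesis using w[OF S] by (simp add: tipQ)
  qed
  have proj: "proj k v = Q k" if "k \<le> M" for k
    using Qinv[OF that] Qv[OF that] by (rule proj_eqI)
  show "proj k v \<in> invariant_tensors G \<phi> k" if "k \<le> M" using Qinv proj that by simp
  show "tip k S (tensor_exp v) = tip k S (proj k v)" if "k \<le> M" "S \<in> invariant_tensors G \<phi> k"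
    using Qv proj that by simp
  have "tip k (Q k) (Q k) = tip k P P" for k by (rule tip_cong) (simp_all add: Q_def)
  then have "weighted_norm_sq M c P = (\<Sum>k\<le>M. c k * ip_norm (tip k) (proj k v) ^ 2)"
    unfolding weighted_norm_sq_def tip_norm_sq by (intro sum.cong refl) (simp add: proj)
  with P(1) show "L \<le> (\<Sum>k\<le>M. c k * ip_norm (tip k) (proj k v) ^ 2)" by simp
qed

lemma proj_invariant: "proj k v \<in> invariant_tensors G \<phi> k"
  by (rule proj_lower_bound(2)[where M = k and c = "\<lambda>_. 1" and L = 0 and w = v])
    (simp_all add: weighted_norm_sq_nonneg)

lemma tip_proj: "S \<in> invariant_tensors G \<phi> k \<Longrightarrow> tip k S (tensor_exp v) = tip k S (proj k v)"
  by (rule proj_lower_bound(3)[where M = k and c = "\<lambda>_. 1" and L = 0 and w = v])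
    (simp_all add: weighted_norm_sq_nonneg)

lemma ip_norm_tensor_exp: "ip_norm (tip k) (tensor_exp x) = ip_norm ip x ^ k"
proof -
  have "tip k (tensor_exp x) (tensor_exp x) = of_real ((ip_norm ip x ^ k) ^ 2)"
    by (simp add: tip_tensor_exp ip_self[of x] flip: of_real_power power_mult)
      (simp add: mult.commute)
  then have "ip_norm (tip k) (tensor_exp x) = sqrt ((ip_norm ip x ^ k) ^ 2)"
    unfolding ip_norm_def[of "tip k"] by simp
  then show ?thesis using ip_norm_nonneg[of x] by simp
qed

lemma proj_upper_bound:
  assumes "g \<in> G" shows "ip_norm (tip k) (proj k v) \<le> ip_norm ip (\<phi> g *v v) ^ k"
proof -
  let ?P = "proj k v"
  have "tip k ?P ?P = tip k ?P (tensor_exp (\<phi> g *v v))"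
    using tip_proj[OF proj_invariant, of k v v] tip_invariant_orbit[OF proj_invariant assms, of k v v] by simp
  then have "norm (complex_of_real (ip_norm (tip k) ?P ^ 2)) = norm (tip k ?P (tensor_exp (\<phi> g *v v)))"
    by (simp only: tip_self)
  then have "ip_norm (tip k) ?P ^ 2 = norm (tip k ?P (tensor_exp (\<phi> g *v v)))"
    unfolding norm_of_real by simp
  also have "\<dots> \<le> ip_norm (tip k) ?P * ip_norm ip (\<phi> g *v v) ^ k"
    using tip_Cauchy_Schwarz[of k ?P "tensor_exp (\<phi> g *v v)"] by (simp add: ip_norm_tensor_exp)
  finally have "ip_norm (tip k) ?P * ip_norm (tip k) ?P \<le> ip_norm (tip k) ?P * ip_norm ip (\<phi> g *v v) ^ k"
    by (simp add: power2_eq_square)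
  then show ?thesis
    using tip_norm_nonneg[of k ?P] ip_norm_nonneg[of "\<phi> g *v v"]
    by (cases "ip_norm (tip k) ?P = 0") (auto simp: mult_le_cancel_left)
qed

end

section \<open>Phases along the orbit of a minimal vector\<close>

lemma has_vector_derivative_vecI:
  assumes "\<And>i. ((\<lambda>t. f t $ i) has_vector_derivative f' $ i) (at t within S)"
  shows "(f has_vector_derivative f') (at t within S)"
  unfolding has_vector_derivative_def has_derivative_at_within
proof
  show "bounded_linear (\<lambda>x. x *\<^sub>R f')" by (rule bounded_linear_scaleR_left)
  show "((\<lambda>y. (f y - f t - (y - t) *\<^sub>R f') /\<^sub>R norm (y - t)) \<longlongrightarrow> 0) (at t within S)"
  proof (rule vec_tendstoI)
    fix i
    show "((\<lambda>y. ((f y - f t - (y - t) *\<^sub>R f') /\<^sub>R norm (y - t)) $ i) \<longlongrightarrow> 0 $ i) (at t within S)"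
      using assms[of i] unfolding has_vector_derivative_def has_derivative_at_within by simp
  qed
qed

context unitary_group_action
begin

text \<open>A is the image of X under the derivative of \<phi> at the identity. Since the entries
  are holomorphic in the complex parameter, one A serves the real and the imaginary direction. The
  group law, used in both orders, moves the derivative from 0 to t, and differentiating unitarity
  gives skewness.\<close>

lemma one_parameter_group:
  assumes X: "X \<in> lie_algebra K"
  defines "\<gamma> \<equiv> \<lambda>t x. \<phi> (matrix_exp (t *\<^sub>R X)) *v x"
  shows "\<exists>A. (\<forall>x t. ((\<lambda>s. \<gamma> s x) has_vector_derivative \<gamma> t (A *v x)) (at t)) \<and>
      (\<forall>x t. ((\<lambda>s. \<gamma> s x) has_vector_derivative A *v (\<gamma> t x)) (at t)) \<and>
      (\<forall>x y. ip (A *v x) y = - ip x (A *v y)) \<and>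
      (\<forall>x. ((\<lambda>s. \<phi> (matrix_exp (scale_matrix (\<i> * of_real s) X)) *v x) has_vector_derivative \<i> *s (A *v x)) (at 0))"
proof -
  define g where "g z = \<phi> (matrix_exp (scale_matrix z X))" for z
  define A where "A = (\<chi> i j. deriv (\<lambda>z. g z $ i $ j) 0)"
  have der: "((\<lambda>z. g z $ i $ j) has_field_derivative A $ i $ j) (at 0)" for i j
    using entry_holomorphic[OF X, of i j UNIV] unfolding g_def[symmetric] A_def
    by (simp add: holomorphic_derivI[of _ UNIV])
  \<comment> \<open>Used with c = 1 for the real direction and c = \<i> for the imaginary
    one.\<close>
  have der_c: "((\<lambda>s. g (c * of_real s) *v x) has_vector_derivative c *s (A *v x)) (at 0)" for c x
  proof (rule has_vector_derivative_vecI)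
    fix i
    have "((\<lambda>z. g (c * z) $ i $ j) has_field_derivative A $ i $ j * c) (at 0)" for j
      using DERIV_chain2[where f = "\<lambda>z. g z $ i $ j" and g = "\<lambda>z. c * z" and x = 0 and s = UNIV and Db = c] der
      by (auto intro!: derivative_eq_intros)
    then have "((\<lambda>z. \<Sum>j\<in>UNIV. g (c * z) $ i $ j * x $ j) has_field_derivative (\<Sum>j\<in>UNIV. A $ i $ j * c * x $ j)) (at (of_real 0))"
      by (intro DERIV_sum DERIV_cmult_right) simp
    then have "((\<lambda>s. \<Sum>j\<in>UNIV. g (c * of_real s) $ i $ j * x $ j) has_vector_derivative (\<Sum>j\<in>UNIV. A $ i $ j * c * x $ j)) (at 0)"
      by (rule has_vector_derivative_real_field)
    then show "((\<lambda>s. (g (c * of_real s) *v x) $ i) has_vector_derivative (c *s (A *v x)) $ i) (at 0)"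
      by (simp add: matrix_vector_mult_def sum_distrib_left mult_ac)
  qed
  have g\<gamma>: "g (of_real t) *v x = \<gamma> t x" for t x
    by (simp add: g_def \<gamma>_def scale_matrix_of_real)
  have der0: "((\<lambda>s. \<gamma> s x) has_vector_derivative A *v x) (at 0)" for x
    using der_c[of 1 x] by (simp add: g\<gamma>)
  have memG: "matrix_exp (t *\<^sub>R X) \<in> G" for t
    using exp_real_mem[OF X, of t] KG by (auto simp: scale_matrix_of_real)
  have add: "\<gamma> (s + t) x = \<gamma> s (\<gamma> t x)" for s t x
    unfolding \<gamma>_def matrix_exp_add_scaleR hom_mult[OF memG memG] by (simp add: matrix_vector_mul_assoc)
  have shift: "((\<lambda>s. \<gamma> (s - t) x) has_vector_derivative A *v x) (at t)" for t x
  proof -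
    have "((\<lambda>s. s - t) has_vector_derivative 1) (at t)"
      by (auto intro!: derivative_eq_intros)
    moreover have "((\<lambda>s. \<gamma> s x) has_vector_derivative A *v x) (at (t - t))" using der0 by simp
    ultimately show ?thesis
      using vector_diff_chain_at[of "\<lambda>s. s - t" 1 t "\<lambda>s. \<gamma> s x" "A *v x"] by (simp add: o_def)
  qed
  have 1: "((\<lambda>s. \<gamma> s x) has_vector_derivative \<gamma> t (A *v x)) (at t)" for x t
  proof -
    have "((\<lambda>s. \<gamma> t (\<gamma> (s - t) x)) has_vector_derivative \<gamma> t (A *v x)) (at t)"
      using bounded_linear.has_vector_derivative[OF matrix_vector_mul_bounded_linear shift]
      by (simp add: \<gamma>_def)
    then show ?thesis by (simp add: add[symmetric])
  qed
  have 2: "((\<lambda>s. \<gamma> s x) has_vector_derivative A *v (\<gamma> t x)) (at t)" for x t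
    using shift[of t "\<gamma> t x"] by (simp add: add[symmetric])
  have 0: "\<gamma> 0 x = x" for x by (simp add: \<gamma>_def hom_one)
  have 3: "ip (A *v x) y = - ip x (A *v y)" for x y
  proof -
    have "ip (\<gamma> s x) (\<gamma> s y) = ip x y" for s
      unfolding \<gamma>_def using unitary exp_real_mem[OF X, of s] by (simp add: scale_matrix_of_real)
    then have "((\<lambda>s. ip (\<gamma> s x) (\<gamma> s y)) has_vector_derivative 0) (at 0)" by simp
    moreover have "((\<lambda>s. ip (\<gamma> s x) (\<gamma> s y)) has_vector_derivative (ip (\<gamma> 0 x) (A *v y) + ip (A *v x) (\<gamma> 0 y))) (at 0)"
      by (rule bounded_bilinear.has_vector_derivative[OF bounded_bilinear_ip der0 der0])
    ultimately have "ip x (A *v y) + ip (A *v x) y = 0"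
      unfolding 0 by (rule vector_derivative_unique_at[symmetric])
    then show ?thesis by (simp add: add_eq_0_iff)
  qed
  show ?thesis using 1 2 3 der_c[of \<i>] unfolding g_def by blast
qed

text \<open>A second-order Taylor estimate for f(t) = Im \<langle>w, \<gamma> t w\<rangle>, with u =
  A w. Here f(0) = 0; f'(0) = Im \<langle>w, u\<rangle> = 0, because the norm is critical at w along
  \<i> X; and f''(t) = - Im \<langle>u, \<gamma> t u\<rangle> vanishes at 0 and is at most e times
  the squared norm of u. As \<gamma> 1 w - w equals u up to at most half the norm of u, passing from
  u to this difference costs the factor 4.\<close>

lemma phase_near_one:
  assumes X: "X \<in> lie_algebra K" and min: "\<And>g. g \<in> G \<Longrightarrow> ip_norm ip w \<le> ip_norm ip (\<phi> g *v w)"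
    and e: "0 < e" "e \<le> 1 / 2"
    and near: "\<And>t x. 0 \<le> t \<Longrightarrow> t \<le> 1 \<Longrightarrow> ip_norm ip (\<phi> (matrix_exp (t *\<^sub>R X)) *v x - x) \<le> e * ip_norm ip x"
  shows "\<bar>Im (ip w (\<phi> (matrix_exp X) *v w))\<bar> \<le> 4 * e * ip_norm ip (\<phi> (matrix_exp X) *v w - w) ^ 2"
proof -
  define \<gamma> where "\<gamma> t x = \<phi> (matrix_exp (t *\<^sub>R X)) *v x" for t x
  obtain A where A: "\<And>x t. ((\<lambda>s. \<gamma> s x) has_vector_derivative \<gamma> t (A *v x)) (at t)"
      "\<And>x t. ((\<lambda>s. \<gamma> s x) has_vector_derivative A *v (\<gamma> t x)) (at t)"
      "\<And>x y. ip (A *v x) y = - ip x (A *v y)"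
      "\<And>x. ((\<lambda>s. \<phi> (matrix_exp (scale_matrix (\<i> * of_real s) X)) *v x) has_vector_derivative \<i> *s (A *v x)) (at 0)"
    using one_parameter_group[OF X] unfolding \<gamma>_def by blast
  define u where "u = A *v w"
  have \<gamma>0: "\<gamma> 0 x = x" for x by (simp add: \<gamma>_def hom_one)
  have near': "ip_norm ip (\<gamma> t x - x) \<le> e * ip_norm ip x" if "t \<in> {0..1}" for t x
    using that near by (simp add: \<gamma>_def)
  text \<open>The first variation of the norm along \<open>\<i> X\<close> vanishes at a vector of minimal norm.\<close>
  have crit: "Im (ip w u) = 0"
  proof -
    define c where "c s = \<phi> (matrix_exp (scale_matrix (\<i> * of_real s) X)) *v w" for s
    have c0: "c 0 = w" using \<gamma>0[of w] by (simp add: c_def \<gamma>_def scale_matrix_def zero_vec_def[symmetric])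
    have "((\<lambda>s. ip (c s) (c s)) has_vector_derivative (ip (c 0) (\<i> *s u) + ip (\<i> *s u) (c 0))) (at 0)"
      unfolding u_def
      by (rule bounded_bilinear.has_vector_derivative[OF bounded_bilinear_ip]) (use A(4) in \<open>simp_all add: c_def\<close>)
    from bounded_linear.has_vector_derivative[OF bounded_linear_Re this]
    have "((\<lambda>s. Re (ip (c s) (c s))) has_real_derivative Re (ip w (\<i> *s u) + ip (\<i> *s u) w)) (at 0)"
      by (simp add: c0 has_real_derivative_iff_has_vector_derivative)
    then have "Re (ip w (\<i> *s u) + ip (\<i> *s u) w) = 0"
    proof (rule DERIV_local_min[where d = 1])
      show "\<forall>s. \<bar>0 - s\<bar> < 1 \<longrightarrow> Re (ip (c 0) (c 0)) \<le> Re (ip (c s) (c s))"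
      proof (intro allI impI)
        fix s
        have "ip_norm ip w ^ 2 \<le> ip_norm ip (c s) ^ 2"
          unfolding c_def by (intro power_mono min exp_scale_mem X ip_norm_nonneg)
        then show "Re (ip (c 0) (c 0)) \<le> Re (ip (c s) (c s))" by (simp add: c0 ip_norm_sq)
      qed
    qed simp
    then show ?thesis using conj_sym[of w u] by (simp add: scale_right scale_left)
  qed
  have derip: "((\<lambda>s. ip y (\<gamma> s x)) has_vector_derivative ip y (\<gamma> t (A *v x))) (at t within T)"
    "((\<lambda>s. ip y (\<gamma> s x)) has_vector_derivative ip y (A *v (\<gamma> t x))) (at t within T)" for x y t T
    by (rule has_vector_derivative_at_within,
        rule bounded_linear.has_vector_derivative[OF bounded_bilinear.bounded_linear_right[OF bounded_bilinear_ip]],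
        rule A)+
  define d where "d = \<gamma> 1 w - w - u"
  have d: "ip_norm ip d \<le> e * ip_norm ip u"
  proof -
    \<comment> \<open>Pairing with d itself reduces the mean value estimate for
      \<open>\<gamma> s w\<close> in the given norm to one for a complex-valued function.\<close>
    have "norm (ip d (\<gamma> 1 w) - ip d (\<gamma> 0 w) - (1 - 0) *\<^sub>R ip d (\<gamma> 0 u)) \<le> norm (1 - 0 :: real) * (ip_norm ip d * (e * ip_norm ip u))"
    proof (rule vector_differentiable_bound_linearization[where S = "{0..1}" and ?x0.0 = 0 and f' = "\<lambda>t. ip d (\<gamma> t u)"])
      show "((\<lambda>s. ip d (\<gamma> s w)) has_vector_derivative ip d (\<gamma> t u)) (at t within {0..1})" for t
        unfolding u_def by (rule derip(1))
      show "norm (ip d (\<gamma> t u) - ip d (\<gamma> 0 u)) \<le> ip_norm ip d * (e * ip_norm ip u)" if "t \<in> {0..1}" for t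
      proof -
        have "norm (ip d (\<gamma> t u - u)) \<le> ip_norm ip d * ip_norm ip (\<gamma> t u - u)" by (rule Cauchy_Schwarz)
        also have "\<dots> \<le> ip_norm ip d * (e * ip_norm ip u)"
          by (intro mult_left_mono near' that ip_norm_nonneg)
        finally show ?thesis by (simp add: \<gamma>0 diff_right)
      qed
    qed (auto simp: closed_segment_eq_real_ivl)
    moreover have "ip d (\<gamma> 1 w) - ip d (\<gamma> 0 w) - (1 - 0) *\<^sub>R ip d (\<gamma> 0 u) = ip d d"
      by (simp add: \<gamma>0 d_def flip: diff_right)
    ultimately have "norm (ip d d) \<le> ip_norm ip d * (e * ip_norm ip u)" by simp
    then have "ip_norm ip d * ip_norm ip d \<le> ip_norm ip d * (e * ip_norm ip u)"
      by (simp add: ip_self[of d] power2_eq_square norm_mult ip_norm_nonneg)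
    moreover have "0 \<le> e * ip_norm ip u" using e(1) ip_norm_nonneg[of u] by simp
    ultimately show ?thesis using ip_norm_nonneg[of d]
      by (cases "ip_norm ip d = 0") (auto simp: mult_le_cancel_left)
  qed
  have uy: "ip_norm ip u \<le> 2 * ip_norm ip (\<gamma> 1 w - w)"
  proof -
    have "ip_norm ip u \<le> ip_norm ip (\<gamma> 1 w - w) + ip_norm ip (- d)"
      using ip_norm_triangle[of "\<gamma> 1 w - w" "- d"] by (simp add: d_def)
    also have "ip_norm ip (- d) = ip_norm ip d" by (simp add: ip_norm_def minus_left minus_right)
    also have "ip_norm ip d \<le> (1 / 2) * ip_norm ip u"
      using d mult_right_mono[OF e(2) ip_norm_nonneg[of u]] by linarith
    finally show ?thesis by simp
  qed
  define q where "q t = Im (ip w (\<gamma> t u))" for t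
  have q: "\<bar>q t\<bar> \<le> e * ip_norm ip u ^ 2" if t: "t \<in> {0..1}" for t
  proof -
    have "norm (q t - q 0 - (t - 0) *\<^sub>R (- Im (ip u (\<gamma> 0 u)))) \<le> norm (t - 0) * (e * ip_norm ip u ^ 2)"
    proof (rule vector_differentiable_bound_linearization[where S = "{0..1}" and ?x0.0 = 0 and f' = "\<lambda>s. - Im (ip u (\<gamma> s u))"])
      \<comment> \<open>Skewness moves \<open>A\<close> onto w in the first slot, which gives
        -u.\<close>
      show "(q has_vector_derivative - Im (ip u (\<gamma> s u))) (at s within {0..1})" for s
        using bounded_linear.has_vector_derivative[OF bounded_linear_Im derip(2)[of w u s "{0..1}"]] A(3)[of w "\<gamma> s u"]
        unfolding q_def u_def by simp
      show "norm (- Im (ip u (\<gamma> s u)) - - Im (ip u (\<gamma> 0 u))) \<le> e * ip_norm ip u ^ 2" if "s \<in> {0..1}" for s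
      proof -
        have "\<bar>Im (ip u (\<gamma> s u - u))\<bar> \<le> ip_norm ip u * ip_norm ip (\<gamma> s u - u)"
          using Cauchy_Schwarz[of u "\<gamma> s u - u"] abs_Im_le_cmod[of "ip u (\<gamma> s u - u)"] by linarith
        also have "\<dots> \<le> ip_norm ip u * (e * ip_norm ip u)"
          by (intro mult_left_mono near' that ip_norm_nonneg)
        finally show ?thesis by (simp add: \<gamma>0 diff_right power2_eq_square mult_ac)
      qed
    qed (use t in \<open>auto simp: closed_segment_eq_real_ivl\<close>)
    moreover have "q 0 = 0" by (simp add: q_def \<gamma>0 crit)
    moreover have "Im (ip u (\<gamma> 0 u)) = 0" by (simp add: \<gamma>0 im_self)
    ultimately have "\<bar>q t\<bar> \<le> t * (e * ip_norm ip u ^ 2)" using t by simp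
    moreover have "t * (e * ip_norm ip u ^ 2) \<le> 1 * (e * ip_norm ip u ^ 2)"
      using t e(1) by (intro mult_right_mono) auto
    ultimately show ?thesis by linarith
  qed
  have "norm (Im (ip w (\<gamma> 1 w)) - Im (ip w (\<gamma> 0 w)) - (1 - 0) *\<^sub>R q 0) \<le> norm (1 - 0 :: real) * (e * ip_norm ip u ^ 2)"
  proof (rule vector_differentiable_bound_linearization[where S = "{0..1}" and ?x0.0 = 0 and f' = "q"])
    show "((\<lambda>s. Im (ip w (\<gamma> s w))) has_vector_derivative q s) (at s within {0..1})" for s
      unfolding q_def u_def by (rule bounded_linear.has_vector_derivative[OF bounded_linear_Im derip(1)])
    show "norm (q s - q 0) \<le> e * ip_norm ip u ^ 2" if "s \<in> {0..1}" for s
      using q[OF that] by (simp add: q_def \<gamma>0 crit)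
  qed (auto simp: closed_segment_eq_real_ivl)
  then have "\<bar>Im (ip w (\<gamma> 1 w))\<bar> \<le> e * ip_norm ip u ^ 2"
    by (simp add: q_def \<gamma>0 crit im_self)
  also have "\<dots> \<le> e * (2 * ip_norm ip (\<gamma> 1 w - w)) ^ 2"
    using uy e(1) by (intro mult_left_mono power_mono ip_norm_nonneg) simp_all
  finally show ?thesis by (simp add: \<gamma>_def power_mult_distrib mult_ac)
qed

text \<open>An element of K near the identity is the exponential of a small X; then t X is small for
  all t between 0 and 1, and \<phi> of its exponential moves each vector by at most a small fraction
  of its norm.\<close>

lemma phase_neighbourhood:
  assumes min: "\<And>g. g \<in> G \<Longrightarrow> ip_norm ip w \<le> ip_norm ip (\<phi> g *v w)" and e: "e > 0"
  shows "\<exists>d>0. \<forall>k\<in>K. norm (k - mat 1) < d \<longrightarrow>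
    \<bar>Im (ip w (\<phi> k *v w))\<bar> \<le> e * ip_norm ip (\<phi> k *v w - w) ^ 2"
proof -
  define e' where "e' = min (1 / 2) (e / 4)"
  have e': "e' > 0" "e' \<le> 1 / 2" "4 * e' \<le> e" using e by (auto simp: e'_def)
  obtain c C where cC: "c > 0" "C > 0" "\<And>x. c * norm x \<le> ip_norm ip x" "\<And>x. ip_norm ip x \<le> C * norm x"
    using ip_norm_equiv by blast
  have bb: "bounded_bilinear ((*v) :: complex^'m^'m \<Rightarrow> complex^'m \<Rightarrow> complex^'m)"
    unfolding bilinear_conv_bounded_bilinear[symmetric] bilinear_def
    by (auto intro!: linearI simp: matrix_vector_mult_def vec_eq_iff sum.distrib scaleR_right.sum distrib_left distrib_right)
  obtain B where B: "B > 0" "\<And>(D :: complex^'m^'m) x. norm (D *v x) \<le> norm D * norm x * B"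
    using bounded_bilinear.pos_bounded[OF bb] by blast
  \<comment> \<open>Solves C s B = e' c: C and B pass from the matrix norm to the given norm, and c
    passes back from the Euclidean norm of x.\<close>
  define s where "s = e' * c / (C * B)"
  have s: "s > 0" using e' cC B by (simp add: s_def)
  have "continuous_on G \<phi>"
    unfolding continuous_on_def
  proof
    fix g assume "g \<in> G"
    show "(\<phi> \<longlongrightarrow> \<phi> g) (at g within G)"
    proof (intro vec_tendstoI)
      fix i j
      show "((\<lambda>x. \<phi> x $ i $ j) \<longlongrightarrow> \<phi> g $ i $ j) (at g within G)"
        using regular_on_continuous[OF reg invertG] \<open>g \<in> G\<close> unfolding continuous_on_def by blast
    qed
  qed
  then obtain r where r: "r > 0" "\<And>g. g \<in> G \<Longrightarrow> norm (g - mat 1) < r \<Longrightarrow> norm (\<phi> g - \<phi> (mat 1)) < s"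
    using G.one_mem s unfolding continuous_on_iff dist_norm by blast
  have "continuous_on UNIV (matrix_exp :: complex^'n^'n \<Rightarrow> _)" by (rule continuous_on_matrix_exp)
  then have "isCont matrix_exp (0 :: complex^'n^'n)" by (simp add: continuous_on_eq_continuous_at)
  then obtain \<delta> where \<delta>: "\<delta> > 0" "\<And>X :: complex^'n^'n. norm X < \<delta> \<Longrightarrow> norm (matrix_exp X - mat 1) < r"
    using r(1) unfolding continuous_at_eps_delta dist_norm by force
  obtain d where d: "d > 0" "\<And>k. k \<in> K \<Longrightarrow> norm (k - mat 1) < d \<Longrightarrow> \<exists>X\<in>lie_algebra K. norm X < \<delta> \<and> k = matrix_exp X"
    using K.exp_covers_neighbourhood[OF \<delta>(1)] by blast
  have "\<bar>Im (ip w (\<phi> k *v w))\<bar> \<le> e * ip_norm ip (\<phi> k *v w - w) ^ 2" if k: "k \<in> K" "norm (k - mat 1) < d" for k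
  proof -
    obtain X where X: "X \<in> lie_algebra K" "norm X < \<delta>" "k = matrix_exp X" using d(2)[OF k] by blast
    have "\<bar>Im (ip w (\<phi> (matrix_exp X) *v w))\<bar> \<le> 4 * e' * ip_norm ip (\<phi> (matrix_exp X) *v w - w) ^ 2"
    proof (rule phase_near_one[OF X(1) min e'(1,2)])
      fix t :: real and x assume t: "0 \<le> t" "t \<le> 1"
      let ?D = "\<phi> (matrix_exp (t *\<^sub>R X)) - \<phi> (mat 1)"
      have "norm (t *\<^sub>R X) \<le> 1 * norm X" unfolding norm_scaleR using t by (intro mult_right_mono) auto
      then have "norm (matrix_exp (t *\<^sub>R X) - mat 1) < r" using X(2) by (intro \<delta>(2)) simp
      moreover have "matrix_exp (t *\<^sub>R X) \<in> G"
        using exp_real_mem[OF X(1), of t] KG by (auto simp: scale_matrix_of_real)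
      ultimately have D: "norm ?D < s" by (rule r(2)[rotated])
      have "ip_norm ip (\<phi> (matrix_exp (t *\<^sub>R X)) *v x - x) = ip_norm ip (?D *v x)"
        by (simp add: matrix_vector_mult_diff_rdistrib hom_one)
      also have "\<dots> \<le> C * norm (?D *v x)" by (rule cC)
      also have "\<dots> \<le> C * (norm ?D * norm x * B)" using cC by (intro mult_left_mono B) simp
      also have "\<dots> \<le> C * (s * norm x * B)"
        using cC B D by (intro mult_left_mono mult_right_mono) auto
      also have "\<dots> = e' * (c * norm x)" using cC B by (simp add: s_def)
      also have "\<dots> \<le> e' * ip_norm ip x" using e' by (intro mult_left_mono cC) simp
      finally show "ip_norm ip (\<phi> (matrix_exp (t *\<^sub>R X)) *v x - x) \<le> e' * ip_norm ip x" .
    qed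
    also have "\<dots> \<le> e * ip_norm ip (\<phi> (matrix_exp X) *v w - w) ^ 2"
      using e'(3) by (intro mult_right_mono) auto
    finally show ?thesis by (simp add: X(3))
  qed
  with d(1) show ?thesis by blast
qed

text \<open>An element k that hardly moves w need not be near the identity. By compactness of K such
  elements accumulate at some l fixing w; then k times the inverse of l comes near the identity and
  moves w exactly as k does.\<close>

lemma orbit_phase:
  assumes min: "\<And>g. g \<in> G \<Longrightarrow> ip_norm ip w \<le> ip_norm ip (\<phi> g *v w)" and e: "e > 0"
  shows "\<exists>d>0. \<forall>k\<in>K. ip_norm ip (\<phi> k *v w - w) < d \<longrightarrow>
    \<bar>Im (ip w (\<phi> k *v w))\<bar> \<le> e * ip_norm ip (\<phi> k *v w - w) ^ 2"
proof (rule ccontr)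
  assume neg: "\<not> ?thesis"
  obtain d where d: "d > 0" "\<And>k. k \<in> K \<Longrightarrow> norm (k - mat 1) < d \<Longrightarrow>
    \<bar>Im (ip w (\<phi> k *v w))\<bar> \<le> e * ip_norm ip (\<phi> k *v w - w) ^ 2"
    using phase_neighbourhood[OF min e] by blast
  have "\<exists>k\<in>K. ip_norm ip (\<phi> k *v w - w) < 1 / (1 + real n) \<and>
      \<not> \<bar>Im (ip w (\<phi> k *v w))\<bar> \<le> e * ip_norm ip (\<phi> k *v w - w) ^ 2" for n
    using neg by (meson add_pos_nonneg divide_pos_pos of_nat_0_le_iff zero_less_one)
  then obtain k where k: "\<And>n. k n \<in> K" "\<And>n. ip_norm ip (\<phi> (k n) *v w - w) < 1 / (1 + real n)"
      "\<And>n. \<not> \<bar>Im (ip w (\<phi> (k n) *v w))\<bar> \<le> e * ip_norm ip (\<phi> (k n) *v w - w) ^ 2" by metis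
  obtain l r where lr: "l \<in> K" "strict_mono r" "(k \<circ> r) \<longlonglongrightarrow> l"
    using compact_imp_seq_compact[OF compK] k(1) unfolding seq_compact_def by metis
  obtain l' where l': "l' \<in> K" "l ** l' = mat 1" "l' ** l = mat 1" using K.inverse_mem[OF lr(1)] by blast
  have bb: "bounded_linear (\<lambda>A :: complex^'m^'m. A *v w)"
    unfolding linear_conv_bounded_linear[symmetric]
    by (auto intro!: linearI simp: matrix_vector_mult_def vec_eq_iff sum.distrib scaleR_right.sum distrib_right)
  have lim1: "(\<lambda>n. \<phi> (k (r n)) *v w) \<longlonglongrightarrow> \<phi> l *v w"
    using bounded_linear.tendsto[OF bb \<phi>_tendsto[of "k \<circ> r" l]] lr k(1) KG by (auto simp: o_def)
  have lw: "\<phi> l *v w = w"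
  proof -
    have "(\<lambda>n. ip_norm ip (\<phi> (k (r n)) *v w - w)) \<longlonglongrightarrow> 0"
    proof (rule tendsto_sandwich[OF always_eventually[OF allI] always_eventually[OF allI] tendsto_const])
      show "ip_norm ip (\<phi> (k (r n)) *v w - w) \<le> ((\<lambda>n. 1 / (1 + real n)) \<circ> r) n" for n
        using k(2)[of "r n"] by simp
      have "(\<lambda>n. 1 / (1 + real n)) \<longlonglongrightarrow> 0"
        using lim_1_over_n[THEN LIMSEQ_Suc] by (simp add: add_ac)
      then show "((\<lambda>n. 1 / (1 + real n)) \<circ> r) \<longlonglongrightarrow> 0" by (rule LIMSEQ_subseq_LIMSEQ[OF _ lr(2)])
    qed (rule ip_norm_nonneg)
    moreover have "(\<lambda>n. ip_norm ip (\<phi> (k (r n)) *v w - w)) \<longlonglongrightarrow> ip_norm ip (\<phi> l *v w - w)"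
      by (intro tendsto_ip_norm tendsto_diff lim1 tendsto_const)
    ultimately have "ip_norm ip (\<phi> l *v w - w) = 0" using LIMSEQ_unique by blast
    then show ?thesis by (simp add: ip_norm_eq_0)
  qed
  have l'w: "\<phi> l' *v w = w"
  proof -
    have "\<phi> l' ** \<phi> l = mat 1"
      unfolding hom_mult[OF subsetD[OF KG l'(1)] subsetD[OF KG lr(1)], symmetric] l'(3) by (rule hom_one)
    then have "\<phi> l' *v (\<phi> l *v w) = w" by (simp add: matrix_vector_mul_assoc)
    then show ?thesis by (simp add: lw)
  qed
  have "(\<lambda>n. k (r n) ** l') \<longlonglongrightarrow> l ** l'"
    using lr(3) by (intro bounded_bilinear.tendsto[OF bounded_bilinear_matrix_mult] tendsto_const) (simp add: o_def)
  then have "(\<lambda>n. k (r n) ** l') \<longlonglongrightarrow> mat 1" by (simp add: l')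
  from LIMSEQ_D[OF this d(1)] obtain n where n: "norm (k (r n) ** l' - mat 1) < d" by auto
  have "\<phi> (k (r n) ** l') *v w = \<phi> (k (r n)) *v w"
    unfolding hom_mult[OF subsetD[OF KG k(1)] subsetD[OF KG l'(1)]] matrix_vector_mul_assoc[symmetric] l'w ..
  then show False using d(2)[OF K.mult_mem[OF k(1) l'(1)] n] k(3)[of "r n"] by simp
qed

text \<open>A bounded norm-minimizing sequence in the orbit of v has a limit point w, possibly
  outside the orbit. Each \<phi> h w is again a limit of orbit points, so w is minimal in its own
  orbit; pairings with invariants are constant on the orbit and pass to the limit.\<close>

lemma minimal_vector:
  defines "m v \<equiv> INF g\<in>G. ip_norm ip (\<phi> g *v v)"
  shows "\<exists>w. ip_norm ip w = m v \<and> (\<forall>g\<in>G. ip_norm ip w \<le> ip_norm ip (\<phi> g *v w)) \<and>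
    (\<forall>k. \<forall>S\<in>invariant_tensors G \<phi> k. tip k S (tensor_exp w) = tip k S (tensor_exp v))"
proof -
  have bdd: "bdd_below ((\<lambda>g. ip_norm ip (\<phi> g *v v)) ` G)"
    by (rule bdd_belowI[where m = 0]) (auto simp: ip_norm_nonneg)
  have low: "m v \<le> ip_norm ip (\<phi> g *v v)" if "g \<in> G" for g
    unfolding m_def using that bdd by (rule cINF_lower[rotated])
  have ne: "(\<lambda>g. ip_norm ip (\<phi> g *v v)) ` G \<noteq> {}" using G.one_mem by blast
  have "\<exists>g\<in>G. ip_norm ip (\<phi> g *v v) < m v + 1 / (1 + real n)" for n
  proof -
    have "m v < m v + 1 / (1 + real n)" by (simp add: add_pos_nonneg)
    then show ?thesis unfolding m_def using cInf_lessD[OF ne] by blast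
  qed
  then obtain g where g: "\<And>n. g n \<in> G" "\<And>n. ip_norm ip (\<phi> (g n) *v v) < m v + 1 / (1 + real n)" by metis
  obtain c C where cC: "c > 0" "\<And>x. c * norm x \<le> ip_norm ip x"
    using ip_norm_equiv by metis
  have "\<phi> (g n) *v v \<in> cball 0 ((m v + 1) / c)" for n
  proof -
    have "1 / (1 + real n) \<le> 1" by simp
    then have "c * norm (\<phi> (g n) *v v) \<le> m v + 1" using g(2)[of n] cC(2)[of "\<phi> (g n) *v v"] by linarith
    then show ?thesis using cC(1) by (simp add: field_simps)
  qed
  then obtain w r where w: "strict_mono r" "((\<lambda>n. \<phi> (g n) *v v) \<circ> r) \<longlonglongrightarrow> w"
    using compact_imp_seq_compact[OF compact_cball] unfolding seq_compact_def by metis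
  have lim: "(\<lambda>n. \<phi> (g (r n)) *v v) \<longlonglongrightarrow> w" using w(2) by (simp add: o_def)
  have m: "ip_norm ip w = m v"
  proof (rule LIMSEQ_unique[OF tendsto_ip_norm[OF lim]])
    show "(\<lambda>n. ip_norm ip (\<phi> (g (r n)) *v v)) \<longlonglongrightarrow> m v"
    proof (rule tendsto_sandwich[OF always_eventually[OF allI] always_eventually[OF allI] tendsto_const])
      show "m v \<le> ip_norm ip (\<phi> (g (r n)) *v v)" for n by (rule low[OF g(1)])
      show "ip_norm ip (\<phi> (g (r n)) *v v) \<le> ((\<lambda>n. m v + 1 / (1 + real n)) \<circ> r) n" for n
        using g(2)[of "r n"] by simp
      have "(\<lambda>n. 1 / (1 + real n)) \<longlonglongrightarrow> 0"
        using lim_1_over_n[THEN LIMSEQ_Suc] by (simp add: add_ac)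
      from LIMSEQ_subseq_LIMSEQ[OF tendsto_add[OF tendsto_const this] w(1)]
      show "((\<lambda>n. m v + 1 / (1 + real n)) \<circ> r) \<longlonglongrightarrow> m v" by simp
    qed
  qed
  have "m v \<le> ip_norm ip (\<phi> h *v w)" if h: "h \<in> G" for h
  proof (rule LIMSEQ_le_const)
    show "(\<lambda>n. ip_norm ip (\<phi> h *v (\<phi> (g (r n)) *v v))) \<longlonglongrightarrow> ip_norm ip (\<phi> h *v w)"
      by (intro tendsto_ip_norm bounded_linear.tendsto[OF matrix_vector_mul_bounded_linear] lim)
    have "m v \<le> ip_norm ip (\<phi> h *v (\<phi> (g (r n)) *v v))" for n
      using low[OF G.mult_mem[OF h g(1)]] hom_mult[OF h g(1)] by (simp add: matrix_vector_mul_assoc)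
    then show "\<exists>N. \<forall>n\<ge>N. m v \<le> ip_norm ip (\<phi> h *v (\<phi> (g (r n)) *v v))" by blast
  qed
  moreover have "tip k S (tensor_exp w) = tip k S (tensor_exp v)" if S: "S \<in> invariant_tensors G \<phi> k" for k S
  proof -
    have "(\<lambda>n. tip k S (tensor_exp (\<phi> (g (r n)) *v v))) \<longlonglongrightarrow> tip k S (tensor_exp w)"
      unfolding tensor_exp_def
      by (intro tip_tendsto tendsto_const tendsto_prod tendsto_vec_nth lim)
    then show ?thesis by (simp add: tip_invariant_orbit[OF S g(1)] LIMSEQ_const_iff)
  qed
  ultimately show ?thesis using m by auto
qed

text \<open>Translating by an inverse in K, which acts unitarily, moves one of the two points to
  w.\<close>

lemma orbit_phase_pairs:
  assumes min: "\<And>g. g \<in> G \<Longrightarrow> ip_norm ip w \<le> ip_norm ip (\<phi> g *v w)" and e: "e > 0"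
  defines "X \<equiv> (\<lambda>k. \<phi> k *v w) ` K"
  shows "\<exists>d>0. \<forall>x\<in>X. \<forall>y\<in>X. ip_norm ip (x - y) < d \<longrightarrow> \<bar>Im (ip x y)\<bar> \<le> e * ip_norm ip (x - y) ^ 2"
proof -
  obtain d where d: "d > 0" "\<And>k. k \<in> K \<Longrightarrow> ip_norm ip (\<phi> k *v w - w) < d \<Longrightarrow>
    \<bar>Im (ip w (\<phi> k *v w))\<bar> \<le> e * ip_norm ip (\<phi> k *v w - w) ^ 2"
    using orbit_phase[OF min e] by blast
  have "\<bar>Im (ip x y)\<bar> \<le> e * ip_norm ip (x - y) ^ 2"
    if xy: "x \<in> X" "y \<in> X" and lt: "ip_norm ip (x - y) < d" for x y
  proof -
    obtain g where g: "g \<in> K" "x = \<phi> g *v w" using xy by (auto simp: X_def)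
    obtain h where h: "h \<in> K" "y = \<phi> h *v w" using xy by (auto simp: X_def)
    obtain g' where g': "g' \<in> K" "g ** g' = mat 1" using K.inverse_mem[OF g(1)] by blast
    define k where "k = g' ** h"
    have k: "k \<in> K" unfolding k_def by (rule K.mult_mem[OF g'(1) h(1)])
    have "g ** k = h" by (simp add: k_def matrix_mul_assoc g')
    then have y: "y = \<phi> g *v (\<phi> k *v w)"
      using hom_mult[OF subsetD[OF KG g(1)] subsetD[OF KG k]] by (simp add: h matrix_vector_mul_assoc)
    have 1: "ip x y = ip w (\<phi> k *v w)" unfolding y g(2) by (rule unitary[OF g(1)])
    have "x - y = \<phi> g *v (w - \<phi> k *v w)" by (simp add: y g(2) matrix_vector_mult_diff_distrib)
    then have "ip_norm ip (x - y) = ip_norm ip (w - \<phi> k *v w)"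
      by (simp add: ip_norm_def unitary[OF g(1)])
    also have "\<dots> = ip_norm ip (\<phi> k *v w - w)"
      using minus_left[of "\<phi> k *v w - w"] minus_right[of _ "\<phi> k *v w - w"] by (simp add: ip_norm_def)
    finally have 2: "ip_norm ip (x - y) = ip_norm ip (\<phi> k *v w - w)" .
    show ?thesis using d(2)[OF k] lt unfolding 1 2 by blast
  qed
  with d(1) show ?thesis by blast
qed

section \<open>Comparison of growth rates\<close>

text \<open>Exponential decay relative to m^(2k) would bound the weighted sums by the kernel series
  at \<rho>, for all z < 1 and all M, contrary to \<open>averages_lower_bound\<close>. The factor D
  leaves room for finitely many exceptional degrees.\<close>

lemma proj_not_exponentially_small:
  assumes m: "m = (INF g\<in>G. ip_norm ip (\<phi> g *v v))" "m > 0" and \<rho>: "0 < \<rho>" "\<rho> < 1" and D: "D \<ge> 0"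
  shows "\<exists>k. D * \<rho> ^ k * (m ^ 2) ^ k < ip_norm (tip k) (proj k v) ^ 2"
proof (rule ccontr)
  assume "\<not> ?thesis"
  then have small: "ip_norm (tip k) (proj k v) ^ 2 \<le> D * \<rho> ^ k * (m ^ 2) ^ k" for k
    by (simp add: not_less)
  let ?N = "Suc CARD('m)"
  obtain c where c: "\<And>k. 0 < c k"
      "\<And>y :: complex. norm y < 1 \<Longrightarrow> (\<lambda>k. complex_of_real (c k) * y ^ k) sums (1 / (1 - y)) ^ ?N"
    using power_kernel_coefficients[of "CARD('m)"] by blast
  obtain w where w: "ip_norm ip w = m" "\<And>g. g \<in> G \<Longrightarrow> ip_norm ip w \<le> ip_norm ip (\<phi> g *v w)"
      "\<And>k S. S \<in> invariant_tensors G \<phi> k \<Longrightarrow> tip k S (tensor_exp w) = tip k S (tensor_exp v)"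
    using minimal_vector[of v] m(1) by blast
  let ?X = "(\<lambda>k. \<phi> k *v w) ` K"
  \<comment> \<open>Independent of z and M, so these can be chosen afterwards to reach B +
    1.\<close>
  define B where "B = D * (1 / (1 - \<rho>)) ^ ?N"
  have "\<exists>z M. 0 < z \<and> z < 1 \<and> (\<forall>T\<in>averages ?X. B + 1 \<le> weighted_norm_sq M (\<lambda>k. c k * (z / m ^ 2) ^ k) T)"
  proof (rule averages_lower_bound[OF m(2) _ orbit_phase_pairs[OF w(2)] c])
    show "ip_norm ip x = m" if "x \<in> ?X" for x
      using that w(1) by (auto simp: ip_norm_def unitary)
  qed
  then obtain z M where z: "0 < z" "z < 1"
      "\<And>T. T \<in> averages ?X \<Longrightarrow> B + 1 \<le> weighted_norm_sq M (\<lambda>k. c k * (z / m ^ 2) ^ k) T"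
    by blast
  have "B + 1 \<le> (\<Sum>k\<le>M. c k * (z / m ^ 2) ^ k * ip_norm (tip k) (proj k v) ^ 2)"
    using z m c by (intro proj_lower_bound(1)[OF w(3)]) auto
  also have "\<dots> \<le> (\<Sum>k\<le>M. D * (c k * \<rho> ^ k))"
  proof (rule sum_mono)
    fix k
    have "c k * (z / m ^ 2) ^ k * ip_norm (tip k) (proj k v) ^ 2 \<le> c k * (z / m ^ 2) ^ k * (D * \<rho> ^ k * (m ^ 2) ^ k)"
      using c(1)[of k] z by (intro mult_left_mono small) auto
    also have "\<dots> = (D * (c k * \<rho> ^ k)) * z ^ k" using m by (simp add: power_divide)
    also have "\<dots> \<le> (D * (c k * \<rho> ^ k)) * 1"
      using c(1)[of k] z D \<rho> by (intro mult_left_mono power_le_one) auto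
    finally show "c k * (z / m ^ 2) ^ k * ip_norm (tip k) (proj k v) ^ 2 \<le> D * (c k * \<rho> ^ k)" by simp
  qed
  also have "\<dots> = D * (\<Sum>k\<le>M. c k * \<rho> ^ k)" by (simp add: sum_distrib_left)
  also have "\<dots> \<le> D * (1 / (1 - \<rho>)) ^ ?N"
  proof (rule mult_left_mono[OF _ D])
    have "(\<lambda>k. complex_of_real (c k) * of_real \<rho> ^ k) sums (1 / (1 - of_real \<rho>)) ^ ?N"
      using c(2)[of "of_real \<rho>"] \<rho> by simp
    then have "(\<lambda>k. complex_of_real (c k * \<rho> ^ k)) sums complex_of_real ((1 / (1 - \<rho>)) ^ ?N)" by simp
    then have s: "(\<lambda>k. c k * \<rho> ^ k) sums ((1 / (1 - \<rho>)) ^ ?N)" by (simp only: sums_of_real_iff)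
    show "(\<Sum>k\<le>M. c k * \<rho> ^ k) \<le> (1 / (1 - \<rho>)) ^ ?N"
      unfolding sums_unique[OF s]
      using c(1) \<rho> by (intro sum_le_suminf sums_summable[OF s]) (auto intro: less_imp_le)
  qed
  finally show False by (simp add: B_def)
qed

theorem limsup_proj:
  "limsup (\<lambda>k. ereal (root k (ip_norm (tip k) (proj k v)))) = ereal (INF g\<in>G. ip_norm ip (\<phi> g *v v))"
proof (rule antisym)
  define m where "m = (INF g\<in>G. ip_norm ip (\<phi> g *v v))"
  let ?a = "\<lambda>k. ip_norm (tip k) (proj k v)"
  have root_le: "root k (?a k) \<le> m" if "k > 0" for k
    unfolding m_def
  proof (rule cINF_greatest)
    show "G \<noteq> {}" using G.one_mem by blast
    fix g assume "g \<in> G"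
    from proj_upper_bound[OF this, of k v] have "root k (?a k) \<le> root k (ip_norm ip (\<phi> g *v v) ^ k)"
      using that by simp
    then show "root k (?a k) \<le> ip_norm ip (\<phi> g *v v)"
      using that ip_norm_nonneg[of "\<phi> g *v v"] by (simp add: real_root_power_cancel)
  qed
  show "limsup (\<lambda>k. ereal (root k (?a k))) \<le> ereal m"
    by (rule Limsup_bounded) (auto simp: eventually_sequentially intro!: root_le exI[of _ 1])
  show "ereal m \<le> limsup (\<lambda>k. ereal (root k (?a k)))"
  proof (rule ccontr)
    assume "\<not> ?thesis"
    then have "limsup (\<lambda>k. ereal (root k (?a k))) < ereal m" by simp
    then obtain y where y: "limsup (\<lambda>k. ereal (root k (?a k))) < ereal y" "ereal y < ereal m"
      using ereal_dense2 by blast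
    from Limsup_lessD[OF y(1)] obtain k0 where k0: "\<And>k. k \<ge> k0 \<Longrightarrow> root k (?a k) < y"
      by (auto simp: eventually_sequentially)
    \<comment> \<open>For k0 = 0 this rests on the convention \<open>root 0 x = 0\<close>.
      Positivity of y forces m > 0, so the case m = 0 is settled by the same contradiction.\<close>
    have "0 \<le> root k0 (?a k0)" using tip_norm_nonneg by (cases "k0 = 0") auto
    then have ypos: "0 < y" using k0[of k0] by simp
    have ym: "y < m" using y(2) by simp
    define \<rho> where "\<rho> = y / m"
    have \<rho>: "0 < \<rho>" "\<rho> < 1" using ypos ym by (auto simp: \<rho>_def)
    have pow: "?a k = root k (?a k) ^ k" if "k > 0" for k
      using that tip_norm_nonneg[of k "proj k v"] by simp
    \<comment> \<open>The factor \<open>1 / \<rho> ^ k0\<close> absorbs the degrees below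
      \<open>k0\<close>, where only the bound by m^k is available. From \<open>k0\<close> on the
      quotient by m^(2k) even decays like \<rho>^(2k), and one factor \<rho>^k is given
      away.\<close>
    have "?a k ^ 2 \<le> (1 / \<rho> ^ k0) * \<rho> ^ k * (m ^ 2) ^ k" for k
    proof (cases "k \<ge> k0 \<and> k > 0")
      case True
      then have k: "k \<ge> k0" "k > 0" by auto
      have "root k (?a k) ^ k \<le> y ^ k"
        using k0[OF k(1)] k(2) tip_norm_nonneg[of k "proj k v"] by (intro power_mono) auto
      then have "?a k \<le> y ^ k" using pow[OF k(2)] by (rule ord_eq_le_trans[rotated])
      then have "?a k ^ 2 \<le> (y ^ k) ^ 2" by (intro power_mono tip_norm_nonneg)
      also have "\<dots> = (\<rho> ^ k * \<rho> ^ k) * (m ^ 2) ^ k"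
        using ym ypos by (simp add: \<rho>_def power_divide power2_eq_square power_mult_distrib)
      also have "\<dots> \<le> (1 / \<rho> ^ k0 * \<rho> ^ k) * (m ^ 2) ^ k"
      proof (intro mult_right_mono)
        have "\<rho> ^ k \<le> 1" "\<rho> ^ k0 \<le> 1" using \<rho> by (auto intro: power_le_one)
        then show "\<rho> ^ k \<le> 1 / \<rho> ^ k0" using \<rho> by (simp add: field_simps mult_le_one)
      qed (use \<rho> in auto)
      finally show ?thesis .
    next
      case False
      then have k: "k \<le> k0" by auto
      have "?a k \<le> m ^ k"
      proof (cases "k = 0")
        case True
        then show ?thesis using proj_upper_bound[OF G.one_mem, of 0 v] by simp
      next
        case False
        then have k: "k > 0" by simp
        have "root k (?a k) ^ k \<le> m ^ k"
          using root_le[OF k] k tip_norm_nonneg[of k "proj k v"] by (intro power_mono) auto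
        then show ?thesis using pow[OF k] by (rule ord_eq_le_trans[rotated])
      qed
      then have "?a k ^ 2 \<le> (m ^ k) ^ 2" by (intro power_mono tip_norm_nonneg)
      also have "\<dots> = 1 * (m ^ 2) ^ k" by (simp add: power_mult[symmetric] mult.commute)
      also have "\<dots> \<le> (1 / \<rho> ^ k0 * \<rho> ^ k) * (m ^ 2) ^ k"
      proof (intro mult_right_mono)
        have "\<rho> ^ k0 \<le> \<rho> ^ k" using \<rho> k by (intro power_decreasing) auto
        then show "1 \<le> 1 / \<rho> ^ k0 * \<rho> ^ k" using \<rho> by (simp add: field_simps)
      qed simp
      finally show ?thesis .
    qed
    moreover have "m > 0" using ypos ym by simp
    ultimately show False
      using proj_not_exponentially_small[OF m_def _ \<rho>, of "1 / \<rho> ^ k0"] \<rho> by (auto simp: not_less[symmetric])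
  qed
qed

end

theorem theorem1p1:
  fixes G K :: "(complex^'n^'n) set"
    and \<phi> :: "complex^'n^'n \<Rightarrow> complex^'m^'m"
    and ip :: "complex^'m \<Rightarrow> complex^'m \<Rightarrow> complex"
  assumes "reductive G" and "connected G"
    and "maximal_compact_subgroup K G"
    and "connected K" and "complexification K G"
    and "rational_representation G \<phi>"
    and "hermitian_inner_product ip" and "invariant_under K \<phi> ip"
  shows "\<forall>v. limsup (\<lambda>k. ereal (root k (ip_norm (tensor_ip k ip)
            (orthogonal_projection (tensor_ip k ip) (invariant_tensors G \<phi> k) (tensor_power k v)))))
          = ereal (INF g\<in>G. ip_norm ip (\<phi> g *v v))"
proof -
  have alg: "linear_algebraic_group G" using assms(1) by (simp add: reductive_def)
  then have sub: "subgroup G general_linear" by (simp add: linear_algebraic_group_def)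
  have K: "subgroup K (group_on G)" "compact K"
    using assms(3) by (auto simp: maximal_compact_subgroup_def)
  note KG = compact_subgroup_closed_matrix_group[OF sub K]
  interpret G: closed_matrix_group G by (rule linear_algebraic_group_closed_matrix_group[OF alg])
  interpret K: closed_matrix_group K by (rule KG(1))
  have hom: "\<phi> \<in> hom (group_on G) general_linear" and reg: "\<And>i j. regular_on G (\<lambda>g. \<phi> g $ i $ j)"
    using assms(6) by (auto simp: rational_representation_def)
  have mult: "\<phi> (g ** h) = \<phi> g ** \<phi> h" if "g \<in> G" "h \<in> G" for g h
    using hom that by (auto simp: hom_def general_linear_def)
  \<comment> \<open>\<open>hom\<close> gives multiplicativity and invertible values only; an
    invertible idempotent is the identity.\<close>
  have "invertible (\<phi> (mat 1))"
    using hom G.one_mem by (auto simp: hom_def general_linear_def)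
  then obtain B where B: "B ** \<phi> (mat 1) = mat 1" by (auto simp: invertible_def)
  have "\<phi> (mat 1) = (B ** \<phi> (mat 1)) ** \<phi> (mat 1)" by (simp add: B)
  also have "\<dots> = B ** \<phi> (mat 1)"
    using mult[OF G.one_mem G.one_mem] by (simp flip: matrix_mul_assoc)
  finally have one: "\<phi> (mat 1) = mat 1" by (simp add: B)
  interpret unitary_group_action ip G K \<phi>
  proof
    show "hermitian_inner_product ip" by (rule assms(7))
    show "K \<subseteq> G" by (rule KG(2))
    show "invertible g" if "g \<in> G" for g
      using subgroup.subset[OF sub] that by (auto simp: general_linear_def)
    show "ip (\<phi> k *v x) (\<phi> k *v y) = ip x y" if "k \<in> K" for k x y
      using assms(8) that by (auto simp: invariant_under_def)
  qed (use assms K mult one reg in auto)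
  show ?thesis using limsup_proj unfolding proj_def by blast
qed

end
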